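(* Let $v\ge0$, let $\alpha_1,\ldots,\alpha_v\in K$ with $|\alpha_1|=\cdots=|\alpha_v|=1$, and let $X=\mathrm{Sp}\,K\langle x,\frac{1}{x-\alpha_1},\ldots,\frac{1}{x-\alpha_v}\rangle$ (so $X$ is the closed unit disc when $v=0$). Let $\lambda\in K\setminus\mathbb{Z}$. Then the left $\mathcal{D}^\dagger_\varpi(X)$-module $\mathcal{D}^\dagger_\varpi(X)/\mathcal{D}^\dagger_\varpi(X)(x\partial-\lambda)$ is simple if $\lambda\in\mathbb{Z}_p$, and is zero otherwise.
   Context: $K$ is a discretely valued field containing a finite extension of $\mathbb{Q}_p$, complete with $|p|=1/p$, and $\varpi=p^{-1/(p-1)}$. $\mathbb{A}$ is the rigid $K$-analytic affine line with coordinate $x$ and $\partial_x=d/dx$. For an affinoid subdomain $X$ of $\mathbb{A}$ and $c$ greater than the spectral radius $\lim_n\|\partial_x^n\|^{1/n}$ of $\partial_x$ on $\mathcal{O}(X)$ (here this radius equals $\varpi$), $\mathcal{D}_c(X)$ is the $K$-Banach algebra of series $\sum_{j\ge0}a_j\partial^j$ ($a_j\in\mathcal{O}(X)$, $|a_j|_Xc^j\to0$) with product $(\sum u_i\partial^i)(\sum v_j\partial^j)=\sum_k(\sum_iu_i\sum_{m\ge0}\binom{i}{m}\partial_x^m(v_{k-i+m}))\partial^k$, and $\mathcal{D}^\dagger_\varpi(X)=\mathrm{colim}_{c>\varpi}\mathcal{D}_c(X)$ (a union of these algebras). *)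

theory Defs
  imports
    "HOL-Algebra.QuotRing"
    "HOL-Algebra.Module"
    "HOL-Analysis.Abstract_Metric_Spaces"
    "HOL-Computational_Algebra.Primes"
    "HOL-Library.Poly_Mapping"
begin

section \<open>The ground field\<close>

text \<open>
  That the field contains a finite extension of the \<open>p\<close>-adic numbers is not a separate
  assumption: \<open>\<bar>p\<bar> = 1/p\<close> forces characteristic \<open>0\<close> and induces the \<open>p\<close>-adic absolute value on
  the rationals, so by completeness the closure of the rationals is a copy of the
  \<open>p\<close>-adic numbers inside the field.
\<close>

locale complete_discretely_valued_field =
  fixes absv :: "'k::field \<Rightarrow> real" and p :: nat
  assumes absv_nonneg: "0 \<le> absv a"
    and absv_eq_0_iff: "absv a = 0 \<longleftrightarrow> a = 0"
    and absv_mult: "absv (a * b) = absv a * absv b"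
    and absv_ultrametric: "absv (a + b) \<le> max (absv a) (absv b)"
    and absv_discrete:
      "\<exists>\<pi>. 0 < absv \<pi> \<and> absv \<pi> < 1 \<and> (\<forall>a. a \<noteq> 0 \<longrightarrow> (\<exists>n::int. absv a = absv \<pi> powi n))"
    and absv_complete: "Metric_space.mcomplete UNIV (\<lambda>a b. absv (a - b))"
    and prime_p: "prime p"
    and absv_p: "absv (of_nat p) = 1 / real p"

text \<open>The \<open>p\<close>-adic integers, as the closure of the integers in the field.\<close>

definition padic_integers :: "('k::field \<Rightarrow> real) \<Rightarrow> 'k set" where
  "padic_integers absv =
     Metric_space.mtopology UNIV (\<lambda>a b. absv (a - b)) closure_of \<int>"

definition varpi :: "nat \<Rightarrow> real" where
  "varpi p = real p powr (- 1 / (real p - 1))"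


section \<open>The Tate algebra \<open>K\<langle>x, y\<^sub>1, \<dots>, y\<^sub>v\<rangle>\<close>\<close>

text \<open>
  A series is its coefficient function; an exponent is a finitely supported function on the
  variable indices, where index \<open>0\<close> stands for \<open>x\<close> and index \<open>i\<close>, with \<open>1 \<le> i \<le> v\<close>,
  for \<open>y\<^sub>i\<close>.
\<close>

type_synonym 'k series = "(nat \<Rightarrow>\<^sub>0 nat) \<Rightarrow> 'k"

definition tate_algebra :: "('k::field \<Rightarrow> real) \<Rightarrow> nat \<Rightarrow> 'k series ring" where
  "tate_algebra absv v =
     \<lparr>carrier = {f. (\<forall>e. f e \<noteq> 0 \<longrightarrow> Poly_Mapping.keys e \<subseteq> {0..v}) \<and>
                    (\<forall>\<epsilon>>0. finite {e. absv (f e) \<ge> \<epsilon>})},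
      monoid.mult = (\<lambda>f g e. \<Sum>(a, b) | a + b = e. f a * g b),
      one = (\<lambda>e. if e = 0 then 1 else 0),
      zero = (\<lambda>e. 0),
      add = (\<lambda>f g e. f e + g e)\<rparr>"

definition gauss_norm :: "('k::field \<Rightarrow> real) \<Rightarrow> 'k series \<Rightarrow> real" where
  "gauss_norm absv f = (SUP e. absv (f e))"

definition tate_const :: "'k::field \<Rightarrow> 'k series" where
  "tate_const a = (\<lambda>e. if e = 0 then a else 0)"

definition tate_var :: "nat \<Rightarrow> 'k::field series" where
  "tate_var i = (\<lambda>e. if e = Poly_Mapping.single i 1 then 1 else 0)"

definition tate_pderiv :: "nat \<Rightarrow> 'k::field series \<Rightarrow> 'k series" where
  "tate_pderiv i f =
     (\<lambda>e. of_nat (Poly_Mapping.lookup e i + 1) * f (e + Poly_Mapping.single i 1))"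

text \<open>
  The derivation \<open>\<partial>/\<partial>x - \<Sum>\<^sub>i y\<^sub>i\<^sup>2 \<partial>/\<partial>y\<^sub>i\<close>, which lifts \<open>d/dx\<close> since
  \<open>d/dx (x - \<alpha>\<^sub>i)\<^sup>-\<^sup>1 = - (x - \<alpha>\<^sub>i)\<^sup>-\<^sup>2\<close>. It maps \<open>(x - \<alpha>\<^sub>i) y\<^sub>i - 1\<close>
  to \<open>- y\<^sub>i ((x - \<alpha>\<^sub>i) y\<^sub>i - 1)\<close>.
\<close>

definition tate_deriv :: "('k::field \<Rightarrow> real) \<Rightarrow> nat \<Rightarrow> 'k series \<Rightarrow> 'k series" where
  "tate_deriv absv v f =
     (let T = tate_algebra absv v in
      tate_pderiv 0 f \<ominus>\<^bsub>T\<^esub>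
        finsum T (\<lambda>i. (tate_var i \<otimes>\<^bsub>T\<^esub> tate_var i) \<otimes>\<^bsub>T\<^esub> tate_pderiv i f) {1..v})"


section \<open>The affinoid algebra \<open>\<O>(X) = K\<langle>x, 1/(x-\<alpha>\<^sub>1), \<dots>, 1/(x-\<alpha>\<^sub>v)\<rangle>\<close>\<close>

text \<open>The centres are \<open>\<alpha> 1, \<dots>, \<alpha> v\<close>; other values of \<open>\<alpha>\<close> are irrelevant.\<close>

definition aff_ideal :: "('k::field \<Rightarrow> real) \<Rightarrow> nat \<Rightarrow> (nat \<Rightarrow> 'k) \<Rightarrow> 'k series set" where
  "aff_ideal absv v \<alpha> =
     (let T = tate_algebra absv v in
      Idl\<^bsub>T\<^esub> {((tate_var 0 \<ominus>\<^bsub>T\<^esub> tate_const (\<alpha> i)) \<otimes>\<^bsub>T\<^esub> tate_var i) \<ominus>\<^bsub>T\<^esub> \<one>\<^bsub>T\<^esub> | i. i \<in> {1..v}})"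

definition aff_ring :: "('k::field \<Rightarrow> real) \<Rightarrow> nat \<Rightarrow> (nat \<Rightarrow> 'k) \<Rightarrow> 'k series set ring" where
  "aff_ring absv v \<alpha> = tate_algebra absv v Quot aff_ideal absv v \<alpha>"

definition aff_class ::
  "('k::field \<Rightarrow> real) \<Rightarrow> nat \<Rightarrow> (nat \<Rightarrow> 'k) \<Rightarrow> 'k series \<Rightarrow> 'k series set" where
  "aff_class absv v \<alpha> f = aff_ideal absv v \<alpha> +>\<^bsub>tate_algebra absv v\<^esub> f"

text \<open>
  The residue norm. As \<open>\<O>(X)\<close> is reduced, it is equivalent to the supremum norm on \<open>X\<close>, so
  both give the same convergence conditions below.
\<close>

definition aff_norm :: "('k::field \<Rightarrow> real) \<Rightarrow> 'k series set \<Rightarrow> real" where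
  "aff_norm absv C = (INF f\<in>C. gauss_norm absv f)"

text \<open>Defined on cosets in the same style as \<^const>\<open>rcoset_mult\<close>.\<close>

definition aff_deriv ::
  "('k::field \<Rightarrow> real) \<Rightarrow> nat \<Rightarrow> (nat \<Rightarrow> 'k) \<Rightarrow> 'k series set \<Rightarrow> 'k series set" where
  "aff_deriv absv v \<alpha> C = (\<Union>f\<in>C. aff_class absv v \<alpha> (tate_deriv absv v f))"

definition aff_suminf ::
  "('k::field \<Rightarrow> real) \<Rightarrow> nat \<Rightarrow> (nat \<Rightarrow> 'k) \<Rightarrow> (nat \<Rightarrow> 'k series set) \<Rightarrow> 'k series set" where
  "aff_suminf absv v \<alpha> s =
     (let A = aff_ring absv v \<alpha> in
      THE L. L \<in> carrier A \<and>
        (\<lambda>n. aff_norm absv (finsum A s {..<n} \<ominus>\<^bsub>A\<^esub> L)) \<longlonglongrightarrow> 0)"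


section \<open>Completed rings of differential operators\<close>

text \<open>The operator \<open>\<Sum>\<^sub>j a\<^sub>j \<partial>\<^sup>j\<close> is its coefficient sequence \<open>a\<close>.\<close>

type_synonym 'k diffop = "nat \<Rightarrow> 'k series set"

definition D_carrier ::
  "('k::field \<Rightarrow> real) \<Rightarrow> nat \<Rightarrow> (nat \<Rightarrow> 'k) \<Rightarrow> real \<Rightarrow> 'k diffop set" where
  "D_carrier absv v \<alpha> c =
     {a. (\<forall>j. a j \<in> carrier (aff_ring absv v \<alpha>)) \<and> (\<lambda>j. aff_norm absv (a j) * c ^ j) \<longlonglongrightarrow> 0}"

text \<open>
  In the inner sum the term for \<open>m\<close> involves the coefficient of index \<open>k - i + m\<close>; terms with
  \<open>k - i + m < 0\<close> or \<open>m > i\<close> vanish and are left out.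
\<close>

definition D_mult ::
  "('k::field \<Rightarrow> real) \<Rightarrow> nat \<Rightarrow> (nat \<Rightarrow> 'k) \<Rightarrow> 'k diffop \<Rightarrow> 'k diffop \<Rightarrow> 'k diffop" where
  "D_mult absv v \<alpha> a b =
     (let A = aff_ring absv v \<alpha> in
      (\<lambda>k. aff_suminf absv v \<alpha> (\<lambda>i.
        a i \<otimes>\<^bsub>A\<^esub>
          finsum A (\<lambda>m. add_pow A (i choose m) ((aff_deriv absv v \<alpha> ^^ m) (b (k + m - i))))
            {m. m \<le> i \<and> i \<le> k + m})))"

definition D_ring ::
  "('k::field \<Rightarrow> real) \<Rightarrow> nat \<Rightarrow> (nat \<Rightarrow> 'k) \<Rightarrow> real \<Rightarrow> 'k diffop ring" where
  "D_ring absv v \<alpha> c =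
     (let A = aff_ring absv v \<alpha> in
      \<lparr>carrier = D_carrier absv v \<alpha> c,
       monoid.mult = D_mult absv v \<alpha>,
       one = (\<lambda>j. if j = 0 then \<one>\<^bsub>A\<^esub> else \<zero>\<^bsub>A\<^esub>),
       zero = (\<lambda>j. \<zero>\<^bsub>A\<^esub>),
       add = (\<lambda>a b j. a j \<oplus>\<^bsub>A\<^esub> b j)\<rparr>)"

text \<open>
  The union of the rings \<open>\<D>\<^sub>c(X)\<close> over \<open>c > r\<close>. Their operations do not depend on \<open>c\<close>, so those
  of \<open>\<D>\<^sub>r(X)\<close> are used.
\<close>

definition D_dagger ::
  "('k::field \<Rightarrow> real) \<Rightarrow> nat \<Rightarrow> (nat \<Rightarrow> 'k) \<Rightarrow> real \<Rightarrow> 'k diffop ring" where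
  "D_dagger absv v \<alpha> r =
     (D_ring absv v \<alpha> r)\<lparr>carrier := (\<Union>c\<in>{r<..}. carrier (D_ring absv v \<alpha> c))\<rparr>"

text \<open>The operator \<open>x\<partial> - \<lambda>\<close>.\<close>

definition euler_op ::
  "('k::field \<Rightarrow> real) \<Rightarrow> nat \<Rightarrow> (nat \<Rightarrow> 'k) \<Rightarrow> 'k \<Rightarrow> 'k diffop" where
  "euler_op absv v \<alpha> l =
     (\<lambda>j. if j = 0 then aff_class absv v \<alpha> (tate_const (- l))
          else if j = 1 then aff_class absv v \<alpha> (tate_var 0)
          else \<zero>\<^bsub>aff_ring absv v \<alpha>\<^esub>)"


section \<open>Left modules over noncommutative rings\<close>

text \<open>The locale \<^locale>\<open>module\<close> requires a commutative base ring.\<close>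

locale left_module = R?: ring R + M?: abelian_group M
  for R (structure) and M (structure) +
  assumes smult_closed:
      "\<lbrakk>a \<in> carrier R; x \<in> carrier M\<rbrakk> \<Longrightarrow> a \<odot>\<^bsub>M\<^esub> x \<in> carrier M"
    and smult_l_distr:
      "\<lbrakk>a \<in> carrier R; b \<in> carrier R; x \<in> carrier M\<rbrakk> \<Longrightarrow>
       (a \<oplus> b) \<odot>\<^bsub>M\<^esub> x = a \<odot>\<^bsub>M\<^esub> x \<oplus>\<^bsub>M\<^esub> b \<odot>\<^bsub>M\<^esub> x"
    and smult_r_distr:
      "\<lbrakk>a \<in> carrier R; x \<in> carrier M; y \<in> carrier M\<rbrakk> \<Longrightarrow>
       a \<odot>\<^bsub>M\<^esub> (x \<oplus>\<^bsub>M\<^esub> y) = a \<odot>\<^bsub>M\<^esub> x \<oplus>\<^bsub>M\<^esub> a \<odot>\<^bsub>M\<^esub> y"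
    and smult_assoc1:
      "\<lbrakk>a \<in> carrier R; b \<in> carrier R; x \<in> carrier M\<rbrakk> \<Longrightarrow>
       (a \<otimes> b) \<odot>\<^bsub>M\<^esub> x = a \<odot>\<^bsub>M\<^esub> (b \<odot>\<^bsub>M\<^esub> x)"
    and smult_one: "x \<in> carrier M \<Longrightarrow> \<one> \<odot>\<^bsub>M\<^esub> x = x"

locale simple_left_module = left_module +
  assumes nonzero: "carrier M \<noteq> {\<zero>\<^bsub>M\<^esub>}"
    and submodule_trivial:
      "submodule N R M \<Longrightarrow> N = {\<zero>\<^bsub>M\<^esub>} \<or> N = carrier M"

text \<open>
  The quotient \<open>R/I\<close> of \<open>R\<close> by a left ideal \<open>I\<close>. The multiplicative fields of the module record
  play no role. For the left ideal \<open>R a\<close> the library notation \<open>PIdl\<^bsub>R\<^esub> a\<close> is available, which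
  denotes the set of all left multiples of \<open>a\<close> also when \<open>R\<close> is not commutative.
\<close>

definition quot_left_module :: "('a, 'b) ring_scheme \<Rightarrow> 'a set \<Rightarrow> ('a, 'a set) module" where
  "quot_left_module R I =
     \<lparr>carrier = a_rcosets\<^bsub>R\<^esub> I, monoid.mult = undefined, one = undefined,
      zero = I, add = set_add R,
      smult = (\<lambda>r C. \<Union>a\<in>C. I +>\<^bsub>R\<^esub> (r \<otimes>\<^bsub>R\<^esub> a))\<rparr>"

end

theory Submission
  imports Defs "HOL-Computational_Algebra.Formal_Power_Series"
begin

text \<open>
  Taylor expansion at \<open>0\<close> identifies \<open>\<O>(X)\<close>, isometrically, with a closed ring of bounded power
  series, so an operator becomes a sequence of power series. Its symbol describes how it acts on
  the powers \<open>x\<^sup>t\<close> for \<open>p\<close>-adic integers \<open>t\<close>; products of operators correspond to compositions, and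
  the symbols at natural numbers determine the operator. This gives the ring axioms.

  If \<open>\<lambda>\<close> is not a \<open>p\<close>-adic integer, then \<open>- \<Sum>\<^sub>n x\<^sup>n \<partial>\<^sup>n / (\<lambda> (\<lambda> - 1) \<cdots> (\<lambda> - n))\<close> converges and is a left
  inverse of \<open>x\<partial> - \<lambda>\<close>.

  If \<open>\<lambda>\<close> is a \<open>p\<close>-adic integer but not an integer, the left multiples of \<open>x\<partial> - \<lambda>\<close> are exactly the
  operators that kill \<open>x\<^sup>\<lambda>\<close>. Let \<open>b x\<^sup>\<lambda> = \<Sum>\<^sub>n F(n) x\<^bsup>\<lambda>+n\<^esup> \<noteq> 0\<close>. Choose \<open>a\<close> with \<open>\<bar>F(n)\<bar> < \<bar>F(a)\<bar>\<close> for all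
  \<open>n < a\<close>; after multiplication by a power of \<open>x\<close>, \<open>a \<ge> 0\<close>. Multiplication by a power of
  \<open>\<Prod>(x - \<alpha>\<^sub>i)\<close> keeps \<open>\<bar>F(a)\<bar>\<close> and makes \<open>b\<close> a finite operator with polynomial coefficients up to a
  small error. An integer-valued polynomial in \<open>x\<partial> - \<lambda>\<close> removes all other components of the finite
  part without enlarging the error, and \<open>\<partial>\<^sup>a\<close> then yields a nonzero constant plus a small operator,
  which a Neumann series inverts.
\<close>

unbundle no vec_syntax and fps_syntax

text \<open>All centres have absolute value 1, so \<open>den\<close> and its inverse both have
  Taylor coefficients of absolute value at most 1. Clearing denominators therefore costs nothing,
  and this is what makes Taylor expansion isometric for the residue norm. The analytic input is one
  comparison: |t (t - 1) ... (t - j + 1)| is at most |j!| for a p-adic integer t, and |j!| = O(c^j)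
  for every c > \<open>varpi p\<close>; for any other t the product is bounded below by a multiple
  of c^j for some c > \<open>varpi p\<close>. This lets operators act on x^t and decides whether the
  formal inverse of x\<partial> - \<lambda> converges. The obstacle to simplicity is that the degree
  of the polynomial part is not controlled by the error, so a projection onto one component could
  have a large norm. Two facts avoid this: an integer-valued polynomial is bounded by 1 at integers
  whatever its degree, and an operator may be replaced by any other with the same effect on
  x^\<lambda>, which allows acting on the error coefficient by coefficient. Only \<partial>^a costs
  a factor, and a is fixed before the error is chosen.\<close>

context complete_discretely_valued_field
begin

section \<open>Elementary properties of the absolute value\<close>

lemma absv_zero [simp]: "absv 0 = 0"
  by (simp add: absv_eq_0_iff)

lemma absv_one [simp]: "absv 1 = 1"
proof -
  have "absv 1 * absv 1 = absv 1"
    by (simp flip: absv_mult)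
  then show ?thesis
    by (simp add: absv_eq_0_iff)
qed

lemma absv_minus [simp]: "absv (- a) = absv a"
proof -
  have "absv (- 1) * absv (- 1) = 1"
    by (simp flip: absv_mult)
  then have "(absv (- 1))\<^sup>2 = 1"
    by (simp add: power2_eq_square)
  then have "absv (- 1) = 1"
    using absv_nonneg[of "-1"] by (simp add: power2_eq_1_iff)
  then show ?thesis
    using absv_mult[of "-1" a] by simp
qed

lemma absv_diff_commute: "absv (a - b) = absv (b - a)"
  using absv_minus[of "a - b"] by simp

lemma absv_add_le: "absv a \<le> r \<Longrightarrow> absv b \<le> r \<Longrightarrow> absv (a + b) \<le> r"
  using absv_ultrametric[of a b] by simp

lemma absv_diff_le: "absv a \<le> r \<Longrightarrow> absv b \<le> r \<Longrightarrow> absv (a - b) \<le> r"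
  using absv_add_le[of a r "- b"] by simp

lemma absv_add_less: "absv a < r \<Longrightarrow> absv b < r \<Longrightarrow> absv (a + b) < r"
  using absv_ultrametric[of a b] by simp

lemma absv_add_eq: assumes "absv b < absv a" shows "absv (a + b) = absv a"
proof (rule antisym)
  show "absv (a + b) \<le> absv a"
    using assms by (intro absv_add_le) auto
  show "absv a \<le> absv (a + b)"
    using absv_ultrametric[of "a + b" "- b"] assms by simp
qed

lemma absv_sum_le: "0 \<le> r \<Longrightarrow> (\<And>i. i \<in> A \<Longrightarrow> absv (f i) \<le> r) \<Longrightarrow> absv (sum f A) \<le> r"
  by (induction A rule: infinite_finite_induct) (auto intro: absv_add_le)

lemma absv_prod: "absv (prod f A) = (\<Prod>i\<in>A. absv (f i))"
  by (induction A rule: infinite_finite_induct) (auto simp: absv_mult)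

lemma absv_power: "absv (a ^ n) = absv a ^ n"
  by (induction n) (auto simp: absv_mult)

lemma absv_inverse: "absv (inverse a) = inverse (absv a)"
proof (cases "a = 0")
  case False
  then have "absv a * absv (inverse a) = 1"
    by (simp flip: absv_mult)
  then show ?thesis
    by (simp add: inverse_unique)
qed simp

lemma absv_of_nat_le: "absv (of_nat n) \<le> 1"
  by (induction n) (auto intro: absv_add_le)

lemma absv_of_int_le: "absv (of_int n) \<le> 1"
  by (cases n) (auto simp: absv_of_nat_le simp del: of_nat_Suc intro: absv_diff_le)

lemma absv_mult_le: "absv a \<le> r \<Longrightarrow> absv b \<le> s \<Longrightarrow> absv (a * b) \<le> r * s"
  using absv_nonneg by (auto simp: absv_mult intro!: mult_mono order_trans[OF absv_nonneg])

lemma absv_Metric_space: "Metric_space UNIV (\<lambda>a b. absv (a - b))"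
proof
  fix x y z :: 'k
  show "absv (x - y) = absv (y - x)"
    by (rule absv_diff_commute)
  show "absv (x - z) \<le> absv (x - y) + absv (y - z)"
    using absv_ultrametric[of "x - y" "y - z"] absv_nonneg[of "x - y"] absv_nonneg[of "y - z"]
    by simp
qed (simp_all add: absv_nonneg absv_eq_0_iff)

lemma absv_complete_exists:
  fixes s :: "nat \<Rightarrow> 'k"
  assumes "\<And>\<epsilon>. 0 < \<epsilon> \<Longrightarrow> \<exists>N. \<forall>m n. N \<le> m \<longrightarrow> N \<le> n \<longrightarrow> absv (s m - s n) < \<epsilon>"
  shows "\<exists>L. \<forall>\<epsilon>>0. \<exists>N. \<forall>n\<ge>N. absv (s n - L) < \<epsilon>"
proof -
  interpret M: Metric_space UNIV "\<lambda>a b. absv (a - b)"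
    by (rule absv_Metric_space)
  have "M.MCauchy s"
    using assms by (simp add: M.MCauchy_def)
  then obtain L where "limitin M.mtopology s L sequentially"
    using absv_complete by (auto simp: M.mcomplete_def)
  then show ?thesis
    unfolding M.limit_metric_sequentially by auto
qed


section \<open>Unconditional sums in the ground field\<close>

definition null_family :: "('i \<Rightarrow> 'k) \<Rightarrow> bool" where
  "null_family s \<longleftrightarrow> (\<forall>\<epsilon>>0. finite {i. \<epsilon> \<le> absv (s i)})"

text \<open>The limit over finite index sets, with an explicit modulus: by the ultrametric
  inequality, terms below \<epsilon> change a partial sum by at most \<epsilon>, so one \<epsilon>
  serves both as threshold and as error. The index type needs no enumeration.\<close>

definition is_nsum :: "('i \<Rightarrow> 'k) \<Rightarrow> 'k \<Rightarrow> bool" where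
  "is_nsum s L \<longleftrightarrow>
     (\<forall>\<epsilon>>0. \<forall>F. finite F \<longrightarrow> {i. \<epsilon> \<le> absv (s i)} \<subseteq> F \<longrightarrow> absv (sum s F - L) \<le> \<epsilon>)"

definition nsum :: "('i \<Rightarrow> 'k) \<Rightarrow> 'k" where
  "nsum s = (THE L. is_nsum s L)"

lemma null_familyD: "null_family s \<Longrightarrow> 0 < \<epsilon> \<Longrightarrow> finite {i. \<epsilon> \<le> absv (s i)}"
  by (simp add: null_family_def)

lemma absv_sum_diff_le:
  assumes "0 \<le> r" "finite F" "finite F'"
    and "\<And>i. r < absv (s i) \<Longrightarrow> i \<in> F \<longleftrightarrow> i \<in> F'"
  shows "absv (sum s F - sum s F') \<le> r"
proof -
  have "sum s F - sum s F' = sum s (F - F') - sum s (F' - F)"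
    using assms sum.subset_diff[of "F \<inter> F'" F s] sum.subset_diff[of "F \<inter> F'" F' s]
    by (simp add: Diff_Int)
  moreover have "absv (sum s (F - F')) \<le> r" "absv (sum s (F' - F)) \<le> r"
    using assms by (auto intro!: absv_sum_le) (meson linorder_not_less)+
  ultimately show ?thesis
    by (simp add: absv_diff_le)
qed

lemma zero_of_absv_le:
  assumes "\<And>\<epsilon>. 0 < \<epsilon> \<Longrightarrow> absv a \<le> \<epsilon>"
  shows "a = 0"
proof (rule ccontr)
  assume "a \<noteq> 0"
  then have "0 < absv a"
    using absv_eq_0_iff[of a] absv_nonneg[of a] by linarith
  then show False
    using assms[of "absv a / 2"] by simp
qed

lemma is_nsum_unique:
  assumes "null_family s" "is_nsum s L" "is_nsum s L'"
  shows "L = L'"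
proof -
  have "absv (L - L') \<le> \<epsilon>" if "0 < \<epsilon>" for \<epsilon>
  proof -
    let ?F = "{i. \<epsilon> \<le> absv (s i)}"
    have "absv (sum s ?F - L') \<le> \<epsilon>" "absv (sum s ?F - L) \<le> \<epsilon>"
      using assms that by (auto simp: is_nsum_def null_familyD)
    from absv_diff_le[OF this] show ?thesis
      by simp
  qed
  then show ?thesis
    using zero_of_absv_le[of "L - L'"] by simp
qed

text \<open>The finite sets \<open>F n\<close> of terms of size at least 1/(n+1) exhaust the nonzero
  terms. Two of them differ only in small terms, so the sums over them form a Cauchy
  sequence.\<close>

lemma is_nsum_exists:
  assumes "null_family s"
  shows "\<exists>L. is_nsum s L"
proof -
  define F where "F n = {i. 1 / real (Suc n) \<le> absv (s i)}" for n
  have fin: "finite (F n)" for n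
    using assms by (simp add: F_def null_familyD)
  have ex: "\<exists>N. \<forall>n\<ge>N. 1 / real (Suc n) < \<epsilon>" if "0 < \<epsilon>" for \<epsilon>
  proof -
    obtain N where N: "1 / real (Suc N) < \<epsilon>"
      by (rule nat_approx_posE[OF \<open>0 < \<epsilon>\<close>])
    have "1 / real (Suc n) < \<epsilon>" if "N \<le> n" for n
      using N that by (intro order.strict_trans1[OF _ N]) (simp add: field_simps)
    then show ?thesis by blast
  qed
  have "\<exists>N. \<forall>m n. N \<le> m \<longrightarrow> N \<le> n \<longrightarrow> absv (sum s (F m) - sum s (F n)) < \<epsilon>" if "0 < \<epsilon>" for \<epsilon>
  proof -
    obtain N where N: "\<And>n. N \<le> n \<Longrightarrow> 1 / real (Suc n) < \<epsilon> / 2"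
      using ex[of "\<epsilon> / 2"] \<open>0 < \<epsilon>\<close> by auto
    have "absv (sum s (F m) - sum s (F n)) \<le> \<epsilon> / 2" if "N \<le> m" "N \<le> n" for m n
      using that N[of m] N[of n] \<open>0 < \<epsilon>\<close> fin
      by (intro absv_sum_diff_le) (auto simp: F_def simp del: of_nat_Suc)
    moreover have "\<epsilon> / 2 < \<epsilon>"
      using \<open>0 < \<epsilon>\<close> by simp
    ultimately show ?thesis
      by (meson order.strict_trans1)
  qed
  then obtain L where L: "\<And>\<epsilon>. 0 < \<epsilon> \<Longrightarrow> \<exists>N. \<forall>n\<ge>N. absv (sum s (F n) - L) < \<epsilon>"
    using absv_complete_exists[of "\<lambda>n. sum s (F n)"] by blast
  have "absv (sum s F' - L) \<le> \<epsilon>" if "0 < \<epsilon>" "finite F'" "{i. \<epsilon> \<le> absv (s i)} \<subseteq> F'" for \<epsilon> F'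
  proof -
    obtain N1 where N1: "\<And>n. N1 \<le> n \<Longrightarrow> absv (sum s (F n) - L) < \<epsilon>"
      using L \<open>0 < \<epsilon>\<close> by blast
    obtain N2 where N2: "\<And>n. N2 \<le> n \<Longrightarrow> 1 / real (Suc n) < \<epsilon>"
      using ex \<open>0 < \<epsilon>\<close> by blast
    let ?n = "max N1 N2"
    have "absv (sum s F' - sum s (F ?n)) \<le> \<epsilon>"
      using that fin N2[of ?n] by (intro absv_sum_diff_le) (auto simp: F_def simp del: of_nat_Suc)
    moreover have "absv (sum s (F ?n) - L) \<le> \<epsilon>"
      using N1[of ?n] by simp
    ultimately show ?thesis
      using absv_add_le[of "sum s F' - sum s (F ?n)" \<epsilon> "sum s (F ?n) - L"] by simp
  qed
  then show ?thesis
    unfolding is_nsum_def by blast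
qed

lemma nsum_is_nsum:
  assumes "null_family s"
  shows "is_nsum s (nsum s)"
proof -
  obtain L where L: "is_nsum s L"
    using is_nsum_exists[OF assms] ..
  then have "nsum s = L"
    unfolding nsum_def by (rule the_equality) (rule is_nsum_unique[OF assms _ L])
  with L show ?thesis by simp
qed

lemma nsum_approx:
  assumes "null_family s" "0 < \<epsilon>" "finite F" "\<And>i. \<epsilon> \<le> absv (s i) \<Longrightarrow> i \<in> F"
  shows "absv (sum s F - nsum s) \<le> \<epsilon>"
  using nsum_is_nsum[OF assms(1)] assms(2-4) unfolding is_nsum_def by blast

lemma nsum_eqI:
  assumes "null_family s"
    and "\<And>\<epsilon>. 0 < \<epsilon> \<Longrightarrow> \<exists>F. finite F \<and> {i. \<epsilon> \<le> absv (s i)} \<subseteq> F \<and> absv (sum s F - L) \<le> \<epsilon>"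
  shows "nsum s = L"
proof -
  have "absv (nsum s - L) \<le> \<epsilon>" if "0 < \<epsilon>" for \<epsilon>
  proof -
    obtain F where F: "finite F" "{i. \<epsilon> \<le> absv (s i)} \<subseteq> F" "absv (sum s F - L) \<le> \<epsilon>"
      using assms(2)[OF \<open>0 < \<epsilon>\<close>] by blast
    have "absv (sum s F - nsum s) \<le> \<epsilon>"
      using F assms(1) that by (intro nsum_approx) auto
    from absv_diff_le[OF F(3) this] show ?thesis
      by simp
  qed
  then show ?thesis
    using zero_of_absv_le[of "nsum s - L"] by simp
qed

lemma null_family_finite: "finite {i. s i \<noteq> 0} \<Longrightarrow> null_family s"
  unfolding null_family_def by (auto elim!: rev_finite_subset)

lemma null_family_le:
  assumes "null_family t" "\<And>i. absv (s i) \<le> absv (t i)"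
  shows "null_family s"
  unfolding null_family_def
proof (intro allI impI)
  fix \<epsilon> :: real assume "0 < \<epsilon>"
  have "{i. \<epsilon> \<le> absv (s i)} \<subseteq> {i. \<epsilon> \<le> absv (t i)}"
    using assms(2) order_trans by blast
  then show "finite {i. \<epsilon> \<le> absv (s i)}"
    using null_familyD[OF assms(1) \<open>0 < \<epsilon>\<close>] finite_subset by blast
qed

lemma nsum_finite:
  assumes "finite F" "\<And>i. i \<notin> F \<Longrightarrow> s i = 0"
  shows "nsum s = sum s F"
proof (rule nsum_eqI)
  show "null_family s"
    using assms by (intro null_family_finite finite_subset[OF _ assms(1)]) auto
  show "\<exists>G. finite G \<and> {i. \<epsilon> \<le> absv (s i)} \<subseteq> G \<and> absv (sum s G - sum s F) \<le> \<epsilon>" if "0 < \<epsilon>" for \<epsilon>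
    using assms that by (intro exI[of _ F]) force
qed

lemma nsum_single: "(\<And>i. i \<noteq> j \<Longrightarrow> s i = 0) \<Longrightarrow> nsum s = s j"
  using nsum_finite[of "{j}" s] by simp

lemma nsum_zero [simp]: "nsum (\<lambda>_. 0) = 0"
  using nsum_finite[of "{}" "\<lambda>_. 0"] by simp

lemma null_family_zero [simp]: "null_family (\<lambda>_. 0)"
  by (simp add: null_family_finite)

lemma null_family_add:
  assumes "null_family s" "null_family t"
  shows "null_family (\<lambda>i. s i + t i)"
  unfolding null_family_def
proof (intro allI impI)
  fix \<epsilon> :: real assume "0 < \<epsilon>"
  have "{i. \<epsilon> \<le> absv (s i + t i)} \<subseteq> {i. \<epsilon> \<le> absv (s i)} \<union> {i. \<epsilon> \<le> absv (t i)}"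
    using absv_add_less not_le by fastforce
  then show "finite {i. \<epsilon> \<le> absv (s i + t i)}"
    using null_familyD[OF assms(1) \<open>0 < \<epsilon>\<close>] null_familyD[OF assms(2) \<open>0 < \<epsilon>\<close>] finite_subset by blast
qed

lemma null_family_uminus: "null_family s \<Longrightarrow> null_family (\<lambda>i. - s i)"
  by (simp add: null_family_def)

lemma null_family_mult_bounded:
  assumes "null_family s" "\<And>i. absv (t i) \<le> B"
  shows "null_family (\<lambda>i. s i * t i)"
  unfolding null_family_def
proof (intro allI impI)
  fix \<epsilon> :: real assume "0 < \<epsilon>"
  define B' where "B' = max 1 B"
  have B': "0 < B'" "\<And>i. absv (t i) \<le> B'"
    using assms(2) by (auto simp: B'_def max.coboundedI2)
  have "{i. \<epsilon> \<le> absv (s i * t i)} \<subseteq> {i. \<epsilon> / B' \<le> absv (s i)}"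
  proof safe
    fix i assume "\<epsilon> \<le> absv (s i * t i)"
    also have "\<dots> \<le> absv (s i) * B'"
      by (simp add: absv_mult absv_nonneg B'(2) mult_left_mono)
    finally show "\<epsilon> / B' \<le> absv (s i)"
      using B'(1) by (simp add: divide_le_eq)
  qed
  then show "finite {i. \<epsilon> \<le> absv (s i * t i)}"
    using null_familyD[OF assms(1), of "\<epsilon> / B'"] \<open>0 < \<epsilon>\<close> B'(1) finite_subset by auto
qed

lemma null_family_cmult: "null_family s \<Longrightarrow> null_family (\<lambda>i. c * s i)"
  using null_family_mult_bounded[of s "\<lambda>_. c" "absv c"] by (simp add: mult.commute)

lemma null_family_sum:
  "(\<And>j. j \<in> A \<Longrightarrow> null_family (s j)) \<Longrightarrow> null_family (\<lambda>i. \<Sum>j\<in>A. s j i)"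
  by (induction A rule: infinite_finite_induct) (auto intro: null_family_add)

lemma nsum_add:
  assumes "null_family s" "null_family t"
  shows "nsum (\<lambda>i. s i + t i) = nsum s + nsum t"
proof (rule nsum_eqI)
  show "null_family (\<lambda>i. s i + t i)"
    using assms by (rule null_family_add)
  fix \<epsilon> :: real assume "0 < \<epsilon>"
  let ?F = "{i. \<epsilon> \<le> absv (s i)} \<union> {i. \<epsilon> \<le> absv (t i)}"
  have fin: "finite ?F"
    using null_familyD[OF assms(1) \<open>0 < \<epsilon>\<close>] null_familyD[OF assms(2) \<open>0 < \<epsilon>\<close>] by simp
  have "absv (sum s ?F - nsum s + (sum t ?F - nsum t)) \<le> \<epsilon>"
    using assms fin \<open>0 < \<epsilon>\<close> by (intro absv_add_le nsum_approx) auto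
  moreover have "{i. \<epsilon> \<le> absv (s i + t i)} \<subseteq> ?F"
    using absv_add_less not_le by fastforce
  ultimately show "\<exists>F. finite F \<and> {i. \<epsilon> \<le> absv (s i + t i)} \<subseteq> F \<and>
      absv ((\<Sum>i\<in>F. s i + t i) - (nsum s + nsum t)) \<le> \<epsilon>"
    using fin by (intro exI[of _ ?F]) (simp add: sum.distrib algebra_simps)
qed

lemma nsum_cmult: "null_family s \<Longrightarrow> nsum (\<lambda>i. c * s i) = c * nsum s"
proof (cases "c = 0")
  case False
  assume s: "null_family s"
  have c: "0 < absv c"
    using False absv_eq_0_iff[of c] absv_nonneg[of c] by linarith
  show ?thesis
  proof (rule nsum_eqI)
    show "null_family (\<lambda>i. c * s i)"
      using s by (rule null_family_cmult)
    fix \<epsilon> :: real assume "0 < \<epsilon>"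
    let ?F = "{i. \<epsilon> / absv c \<le> absv (s i)}"
    have fin: "finite ?F"
      using null_familyD[OF s, of "\<epsilon> / absv c"] \<open>0 < \<epsilon>\<close> c by simp
    have "absv (sum s ?F - nsum s) \<le> \<epsilon> / absv c"
      using s fin \<open>0 < \<epsilon>\<close> c by (intro nsum_approx) auto
    then have "absv (c * (sum s ?F - nsum s)) \<le> \<epsilon>"
      using c by (simp only: absv_mult pos_le_divide_eq mult.commute)
    then show "\<exists>F. finite F \<and> {i. \<epsilon> \<le> absv (c * s i)} \<subseteq> F \<and>
        absv ((\<Sum>i\<in>F. c * s i) - c * nsum s) \<le> \<epsilon>"
      using fin c
      by (intro exI[of _ ?F])
        (auto simp: sum_distrib_left right_diff_distrib absv_mult pos_divide_le_eq mult.commute)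
  qed
qed simp

lemma nsum_uminus: "null_family s \<Longrightarrow> nsum (\<lambda>i. - s i) = - nsum s"
  using nsum_cmult[of s "- 1"] by simp

lemma nsum_diff:
  "null_family s \<Longrightarrow> null_family t \<Longrightarrow> nsum (\<lambda>i. s i - t i) = nsum s - nsum t"
  using nsum_add[of s "\<lambda>i. - t i"] by (simp add: null_family_uminus nsum_uminus)

lemma nsum_sum:
  "(\<And>j. j \<in> A \<Longrightarrow> null_family (s j)) \<Longrightarrow> nsum (\<lambda>i. \<Sum>j\<in>A. s j i) = (\<Sum>j\<in>A. nsum (s j))"
  by (induction A rule: infinite_finite_induct) (auto simp: nsum_add null_family_sum)

lemma absv_nsum_le:
  assumes "null_family s" "0 \<le> r" "\<And>i. absv (s i) \<le> r"
  shows "absv (nsum s) \<le> r"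
proof (rule field_le_epsilon)
  fix \<epsilon> :: real assume "0 < \<epsilon>"
  let ?F = "{i. r + \<epsilon> \<le> absv (s i)}"
  have "absv (sum s ?F - nsum s) \<le> r + \<epsilon>"
    using assms \<open>0 < \<epsilon>\<close> by (intro nsum_approx) (auto intro!: null_familyD)
  moreover have "?F = {}"
  proof safe
    fix i assume "r + \<epsilon> \<le> absv (s i)"
    then show "i \<in> {}"
      using assms(3)[of i] \<open>0 < \<epsilon>\<close> by linarith
  qed
  ultimately show "absv (nsum s) \<le> r + \<epsilon>"
    by simp
qed

text \<open>A strict bound survives the limit because only finitely many terms reach r/2: the larger
  of r/2 and their maximum is still below r.\<close>

lemma absv_nsum_less:
  assumes "null_family s" "0 < r" "\<And>i. absv (s i) < r"
  shows "absv (nsum s) < r"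
proof -
  let ?F = "{i. r / 2 \<le> absv (s i)}"
  define m where "m = Max (insert (r / 2) ((\<lambda>i. absv (s i)) ` ?F))"
  have fin: "finite ?F"
    using assms by (intro null_familyD) auto
  have "m < r"
    unfolding m_def using assms fin by auto
  moreover have "absv (nsum s) \<le> m"
  proof (rule absv_nsum_le)
    show "0 \<le> m"
      unfolding m_def using fin assms(2) by (intro order_trans[OF _ Max_ge[of _ "r / 2"]]) auto
    show "absv (s i) \<le> m" for i
    proof (cases "i \<in> ?F")
      case True
      then show ?thesis
        unfolding m_def using fin by (intro Max_ge) auto
    next
      case False
      then show ?thesis
        unfolding m_def using fin by (intro order_trans[OF _ Max_ge[of _ "r / 2"]]) auto
    qed
  qed fact
  ultimately show ?thesis by simp
qed

lemma null_family_inj: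
  assumes "null_family s" "inj f"
  shows "null_family (\<lambda>i. s (f i))"
  unfolding null_family_def
proof (intro allI impI)
  fix \<epsilon> :: real assume "0 < \<epsilon>"
  show "finite {i. \<epsilon> \<le> absv (s (f i))}"
    using finite_vimageI[OF null_familyD[OF assms(1) \<open>0 < \<epsilon>\<close>] assms(2)] by (simp add: vimage_def)
qed

lemma nsum_reindex:
  assumes "inj f" "\<And>j. j \<notin> range f \<Longrightarrow> s j = 0" "null_family s"
  shows "nsum (\<lambda>i. s (f i)) = nsum s"
proof (rule nsum_eqI)
  show "null_family (\<lambda>i. s (f i))"
    by (rule null_family_inj[OF assms(3,1)])
  fix \<epsilon> :: real assume "0 < \<epsilon>"
  let ?F = "{i. \<epsilon> \<le> absv (s (f i))}"
  have fin: "finite ?F"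
    using null_familyD[OF \<open>null_family (\<lambda>i. s (f i))\<close> \<open>0 < \<epsilon>\<close>] .
  have "absv (sum s (f ` ?F) - nsum s) \<le> \<epsilon>"
  proof (rule nsum_approx)
    show "i \<in> f ` ?F" if "\<epsilon> \<le> absv (s i)" for i
      using that assms(2)[of i] \<open>0 < \<epsilon>\<close> by (cases "i \<in> range f") auto
  qed (use assms \<open>0 < \<epsilon>\<close> fin in auto)
  moreover have "sum s (f ` ?F) = (\<Sum>i\<in>?F. s (f i))"
    using assms(1) by (simp add: sum.reindex inj_on_subset[OF assms(1)])
  ultimately show "\<exists>F. finite F \<and> ?F \<subseteq> F \<and> absv ((\<Sum>i\<in>F. s (f i)) - nsum s) \<le> \<epsilon>"
    using fin by (intro exI[of _ ?F]) auto
qed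

lemma null_family_section: "null_family s \<Longrightarrow> null_family (\<lambda>j. s (i, j))"
  by (rule null_family_inj) (auto intro: injI)

lemma null_family_nsum_section:
  assumes "null_family s"
  shows "null_family (\<lambda>i. nsum (\<lambda>j. s (i, j)))"
  unfolding null_family_def
proof (intro allI impI)
  fix \<epsilon> :: real assume "0 < \<epsilon>"
  have "{i. \<epsilon> \<le> absv (nsum (\<lambda>j. s (i, j)))} \<subseteq> fst ` {p. \<epsilon> \<le> absv (s p)}"
  proof (rule subsetI, rule ccontr)
    fix i assume i: "i \<in> {i. \<epsilon> \<le> absv (nsum (\<lambda>j. s (i, j)))}" "i \<notin> fst ` {p. \<epsilon> \<le> absv (s p)}"
    have "absv (s (i, j)) < \<epsilon>" for j
    proof (rule ccontr)
      assume "\<not> absv (s (i, j)) < \<epsilon>"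
      then have "(i, j) \<in> {p. \<epsilon> \<le> absv (s p)}"
        by simp
      from imageI[OF this, of fst] show False
        using i(2) by simp
    qed
    then have "absv (nsum (\<lambda>j. s (i, j))) < \<epsilon>"
      using \<open>0 < \<epsilon>\<close> by (intro absv_nsum_less null_family_section[OF assms])
    then show False
      using i(1) by simp
  qed
  then show "finite {i. \<epsilon> \<le> absv (nsum (\<lambda>j. s (i, j)))}"
    using null_familyD[OF assms \<open>0 < \<epsilon>\<close>] finite_surj by blast
qed

text \<open>Fubini for null families. Outside the finite rectangle \<open>?I\<close> x
  \<open>?J\<close> all entries are below \<epsilon>, so the sum over the rectangle is
  \<epsilon>-close to both sides.\<close>

lemma nsum_Sigma:
  assumes "null_family s"
  shows "nsum (\<lambda>i. nsum (\<lambda>j. s (i, j))) = nsum s"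
proof (rule nsum_eqI)
  show "null_family (\<lambda>i. nsum (\<lambda>j. s (i, j)))"
    using assms by (rule null_family_nsum_section)
  fix \<epsilon> :: real assume "0 < \<epsilon>"
  let ?F = "{p. \<epsilon> \<le> absv (s p)}"
  let ?I = "fst ` ?F \<union> {i. \<epsilon> \<le> absv (nsum (\<lambda>j. s (i, j)))}" and ?J = "snd ` ?F"
  have fin: "finite ?I" "finite ?J"
    using null_familyD[OF assms \<open>0 < \<epsilon>\<close>]
      null_familyD[OF null_family_nsum_section[OF assms] \<open>0 < \<epsilon>\<close>] by auto
  have "absv ((\<Sum>i\<in>?I. (\<Sum>j\<in>?J. s (i, j)) - nsum (\<lambda>j. s (i, j)))) \<le> \<epsilon>"
    using fin \<open>0 < \<epsilon>\<close>
    by (intro absv_sum_le nsum_approx null_family_section[OF assms]) (auto intro: rev_image_eqI)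
  moreover have "absv (sum s (?I \<times> ?J) - nsum s) \<le> \<epsilon>"
    using fin \<open>0 < \<epsilon>\<close> assms by (intro nsum_approx) (auto intro: rev_image_eqI)
  moreover have "sum s (?I \<times> ?J) = (\<Sum>i\<in>?I. \<Sum>j\<in>?J. s (i, j))"
    by (simp add: sum.cartesian_product)
  ultimately have "absv ((\<Sum>i\<in>?I. nsum (\<lambda>j. s (i, j))) - nsum s) \<le> \<epsilon>"
    using absv_diff_le[of "sum s (?I \<times> ?J) - nsum s" \<epsilon>
        "\<Sum>i\<in>?I. (\<Sum>j\<in>?J. s (i, j)) - nsum (\<lambda>j. s (i, j))"]
    by (simp add: sum_subtractf algebra_simps)
  then show "\<exists>F. finite F \<and> {i. \<epsilon> \<le> absv (nsum (\<lambda>j. s (i, j)))} \<subseteq> F \<and>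
      absv ((\<Sum>i\<in>F. nsum (\<lambda>j. s (i, j))) - nsum s) \<le> \<epsilon>"
    using fin by (intro exI[of _ ?I]) auto
qed

lemma nsum_swap:
  assumes "null_family (\<lambda>(i, j). s i j)"
  shows "nsum (\<lambda>i. nsum (\<lambda>j. s i j)) = nsum (\<lambda>j. nsum (\<lambda>i. s i j))"
proof -
  have *: "null_family (\<lambda>(j, i). s i j)"
    using null_family_inj[OF assms, of prod.swap] by (simp add: case_prod_unfold prod.swap_def)
  have "nsum (\<lambda>i. nsum (\<lambda>j. s i j)) = nsum (\<lambda>(i, j). s i j)"
    using nsum_Sigma[OF assms] by simp
  also have "\<dots> = nsum (\<lambda>(j, i). s i j)"
    using nsum_reindex[OF inj_swap _ assms] by (simp add: case_prod_unfold)
  also have "\<dots> = nsum (\<lambda>j. nsum (\<lambda>i. s i j))"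
    using nsum_Sigma[OF *] by simp
  finally show ?thesis .
qed

lemma null_family_bounded:
  assumes "null_family s"
  obtains B where "0 < B" "\<And>i. absv (s i) \<le> B"
proof -
  have fin: "finite ((\<lambda>i. absv (s i)) ` {i. 1 \<le> absv (s i)})"
    using null_familyD[OF assms, of 1] by simp
  define B where "B = Max (insert 1 ((\<lambda>i. absv (s i)) ` {i. 1 \<le> absv (s i)}))"
  have "1 \<le> B"
    unfolding B_def using fin by simp
  moreover have "absv (s i) \<le> B" for i
  proof (cases "1 \<le> absv (s i)")
    case True
    then show ?thesis
      unfolding B_def using fin by (intro Max_ge) auto
  next
    case False
    then show ?thesis
      using \<open>1 \<le> B\<close> by simp
  qed
  ultimately show ?thesis
    using that[of B] by auto
qed

lemma null_family_prod:
  assumes "null_family s" "null_family t"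
  shows "null_family (\<lambda>(i, j). s i * t j)"
  unfolding null_family_def
proof (intro allI impI)
  fix \<epsilon> :: real assume "0 < \<epsilon>"
  obtain B where B: "0 < B" "\<And>i. absv (s i) \<le> B"
    using null_family_bounded[OF assms(1)] by blast
  obtain C where C: "0 < C" "\<And>i. absv (t i) \<le> C"
    using null_family_bounded[OF assms(2)] by blast
  have "i \<in> {i. \<epsilon> / C \<le> absv (s i)} \<and> j \<in> {j. \<epsilon> / B \<le> absv (t j)}"
    if "\<epsilon> \<le> absv (s i * t j)" for i j
  proof -
    have "absv (s i * t j) \<le> absv (s i) * C" "absv (s i * t j) \<le> B * absv (t j)"
      using B(2)[of i] C(2)[of j]
      by (simp_all add: absv_mult absv_nonneg mult_left_mono mult_right_mono)
    then show ?thesis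
      using that B(1) C(1) by (simp add: divide_le_eq mult.commute)
  qed
  then have "{p. \<epsilon> \<le> absv (case p of (i, j) \<Rightarrow> s i * t j)} \<subseteq>
      {i. \<epsilon> / C \<le> absv (s i)} \<times> {j. \<epsilon> / B \<le> absv (t j)}"
    by auto
  moreover have "finite ({i. \<epsilon> / C \<le> absv (s i)} \<times> {j. \<epsilon> / B \<le> absv (t j)})"
    using assms B(1) C(1) \<open>0 < \<epsilon>\<close> by (intro finite_cartesian_product null_familyD) auto
  ultimately show "finite {p. \<epsilon> \<le> absv (case p of (i, j) \<Rightarrow> s i * t j)}"
    by (rule finite_subset)
qed


section \<open>Power series with bounded coefficients, and uniformly convergent sums of them\<close>

definition bnd :: "real \<Rightarrow> 'k fps \<Rightarrow> bool" where
  "bnd r f \<longleftrightarrow> (\<forall>n. absv (f $ n) \<le> r)"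

lemma bndD: "bnd r f \<Longrightarrow> absv (f $ n) \<le> r"
  by (simp add: bnd_def)

lemma bnd_nonneg: "bnd r f \<Longrightarrow> 0 \<le> r"
  using bndD[of r f 0] absv_nonneg[of "f $ 0"] by simp

lemma bnd_mono: "bnd r f \<Longrightarrow> r \<le> s \<Longrightarrow> bnd s f"
  unfolding bnd_def using order_trans by blast

lemma bnd_add: "bnd r f \<Longrightarrow> bnd r g \<Longrightarrow> bnd r (f + g)"
  by (simp add: bnd_def absv_add_le)

lemma bnd_uminus [simp]: "bnd r (- f) = bnd r f"
  by (simp add: bnd_def)

lemma bnd_diff: "bnd r f \<Longrightarrow> bnd r g \<Longrightarrow> bnd r (f - g)"
  by (simp add: bnd_def absv_diff_le)

lemma bnd_zero: "0 \<le> r \<Longrightarrow> bnd r 0"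
  by (simp add: bnd_def)

lemma bnd_one: "bnd 1 1"
  by (simp add: bnd_def)

lemma bnd_const: "absv c \<le> r \<Longrightarrow> bnd r (fps_const c)"
  using absv_nonneg[of c] by (auto simp: bnd_def)

lemma bnd_X: "bnd 1 fps_X"
  by (auto simp: bnd_def fps_X_def)

lemma bnd_mult:
  assumes "bnd r f" "bnd s g"
  shows "bnd (r * s) (f * g)"
  unfolding bnd_def fps_mult_nth
  using bnd_nonneg[OF assms(1)] bnd_nonneg[OF assms(2)] assms
  by (auto intro!: absv_sum_le absv_mult_le bndD)

lemma bnd_mult_left: "bnd 1 f \<Longrightarrow> bnd r g \<Longrightarrow> bnd r (f * g)"
  using bnd_mult[of 1 f r g] by simp

lemma bnd_mult_right: "bnd r f \<Longrightarrow> bnd 1 g \<Longrightarrow> bnd r (f * g)"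
  using bnd_mult[of r f 1 g] by simp

lemma bnd_power: "bnd 1 f \<Longrightarrow> bnd 1 (f ^ n)"
  by (induction n) (auto intro: bnd_one bnd_mult_left)

lemma bnd_prod: "(\<And>i. i \<in> A \<Longrightarrow> bnd 1 (f i)) \<Longrightarrow> bnd 1 (prod f A)"
  by (induction A rule: infinite_finite_induct) (auto intro: bnd_one bnd_mult_left)

lemma bnd_sum: "0 \<le> r \<Longrightarrow> (\<And>i. i \<in> A \<Longrightarrow> bnd r (f i)) \<Longrightarrow> bnd r (sum f A)"
  by (induction A rule: infinite_finite_induct) (auto intro: bnd_zero bnd_add)

lemma bnd_deriv: "bnd r f \<Longrightarrow> bnd r (fps_deriv f)"
  unfolding bnd_def fps_deriv_nth
  using absv_mult_le[OF absv_of_nat_le] by (metis mult_1)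

lemma bnd_of_nat_mult: "bnd r f \<Longrightarrow> bnd r (of_nat n * f)"
  unfolding bnd_def using absv_mult_le[OF absv_of_nat_le]
  by (metis fps_mult_left_const_nth fps_of_nat mult_1)

lemma bnd_const_mult: "bnd r f \<Longrightarrow> bnd (absv c * r) (fps_const c * f)"
  unfolding bnd_def by (simp add: absv_mult absv_nonneg mult_left_mono)

lemma fps_deriv_funpow_nth: "(fps_deriv ^^ m) f $ n = of_nat (fact m * (n + m choose m)) * f $ (n + m)"
proof (induction m arbitrary: n)
  case (Suc m)
  have "fact (Suc m) * (n + Suc m choose Suc m) = (n + 1) * (fact m * (n + 1 + m choose m))"
  proof -
    have "Suc m * (n + Suc m choose Suc m) = (n + 1) * (n + 1 + m choose m)"
      using binomial_absorption[of m "n + Suc m"] binomial_absorb_comp[of "n + Suc m" m]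
      by (simp add: binomial_absorption algebra_simps)
    then show ?thesis
      by (metis (no_types, lifting) fact_Suc mult.assoc mult.left_commute of_nat_id)
  qed
  moreover have "(fps_deriv ^^ Suc m) f $ n =
      of_nat (n + 1) * (of_nat (fact m * (n + 1 + m choose m)) * f $ (n + 1 + m))"
    using Suc.IH[of "n + 1"] by (simp del: of_nat_mult of_nat_add of_nat_Suc)
  ultimately show ?case
    by (simp only: of_nat_mult mult.assoc) (simp add: add.commute add.left_commute)
qed simp

text \<open>The operator \<partial>^m / m! multiplies coefficients by binomial numbers, so m
  derivations gain the factor |m!|. This gain is the source of the critical radius
  \<open>varpi p\<close>.\<close>

lemma bnd_deriv_funpow: "bnd r f \<Longrightarrow> bnd (absv (of_nat (fact m)) * r) ((fps_deriv ^^ m) f)"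
  unfolding bnd_def fps_deriv_funpow_nth
proof
  fix n assume *: "\<forall>n. absv (f $ n) \<le> r"
  have "absv (of_nat (fact m * (n + m choose m)) * f $ (n + m)) =
      absv (of_nat (fact m)) * (absv (of_nat (n + m choose m)) * absv (f $ (n + m)))"
    by (simp add: absv_mult)
  also have "\<dots> \<le> absv (of_nat (fact m)) * (1 * r)"
    using * by (intro mult_left_mono mult_mono absv_of_nat_le absv_nonneg) auto
  finally show "absv (of_nat (fact m * (n + m choose m)) * f $ (n + m)) \<le> absv (of_nat (fact m)) * r"
    by simp
qed

text \<open>Smallness is uniform in the position of the coefficient, so that finite partial sums
  approximate \<open>fsum\<close> in the sense of \<open>bnd\<close> and not only coefficient by
  coefficient.\<close>

definition null_fps :: "('i \<Rightarrow> 'k fps) \<Rightarrow> bool" where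
  "null_fps s \<longleftrightarrow> (\<forall>\<epsilon>>0. finite {i. \<not> bnd \<epsilon> (s i)})"

definition fsum :: "('i \<Rightarrow> 'k fps) \<Rightarrow> 'k fps" where
  "fsum s = Abs_fps (\<lambda>n. nsum (\<lambda>i. s i $ n))"

lemma fsum_nth: "fsum s $ n = nsum (\<lambda>i. s i $ n)"
  by (simp add: fsum_def)

lemma null_fpsD: "null_fps s \<Longrightarrow> 0 < \<epsilon> \<Longrightarrow> finite {i. \<not> bnd \<epsilon> (s i)}"
  by (simp add: null_fps_def)

lemma null_fps_nth:
  assumes "null_fps s"
  shows "null_family (\<lambda>i. s i $ n)"
  unfolding null_family_def
proof (intro allI impI)
  fix \<epsilon> :: real assume "0 < \<epsilon>"
  have "{i. \<epsilon> \<le> absv (s i $ n)} \<subseteq> {i. \<not> bnd (\<epsilon> / 2) (s i)}"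
    using \<open>0 < \<epsilon>\<close> by (auto dest!: bndD[of _ _ n])
  then show "finite {i. \<epsilon> \<le> absv (s i $ n)}"
    using null_fpsD[OF assms, of "\<epsilon> / 2"] \<open>0 < \<epsilon>\<close> finite_subset by auto
qed

lemma bnd_fsum: "null_fps s \<Longrightarrow> 0 \<le> r \<Longrightarrow> (\<And>i. bnd r (s i)) \<Longrightarrow> bnd r (fsum s)"
  by (simp add: bnd_def fsum_nth absv_nsum_le null_fps_nth)

lemma fsum_approx:
  assumes "null_fps s" "0 < \<epsilon>" "finite F" "\<And>i. \<not> bnd \<epsilon> (s i) \<Longrightarrow> i \<in> F"
  shows "bnd \<epsilon> (sum s F - fsum s)"
  unfolding bnd_def
proof
  fix n
  let ?t = "\<lambda>i. if i \<in> F then 0 else s i $ n"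
  have null: "null_family (\<lambda>i. s i $ n)" "null_family ?t"
    by (rule null_fps_nth[OF assms(1)])
      (rule null_family_le[OF null_fps_nth[OF assms(1), of n]], simp add: absv_nonneg)
  have "nsum (\<lambda>i. s i $ n) = nsum (\<lambda>i. (if i \<in> F then s i $ n else 0) + ?t i)"
    by (intro arg_cong[of _ _ nsum]) auto
  also have "\<dots> = nsum (\<lambda>i. if i \<in> F then s i $ n else 0) + nsum ?t"
    by (rule nsum_add[OF null_family_le[OF null(1)] null(2)]) (simp add: absv_nonneg)
  also have "nsum (\<lambda>i. if i \<in> F then s i $ n else 0) = (\<Sum>i\<in>F. s i $ n)"
    using assms(3) by (subst nsum_finite[of F]) auto
  finally have "(sum s F - fsum s) $ n = - nsum ?t"
    by (simp add: fsum_nth fps_sum_nth)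
  moreover have "absv (nsum ?t) \<le> \<epsilon>"
    using assms by (intro absv_nsum_le null) (auto simp: bnd_def)
  ultimately show "absv ((sum s F - fsum s) $ n) \<le> \<epsilon>"
    by simp
qed

section \<open>Polynomials among the power series\<close>

definition fpoly :: "'k fps \<Rightarrow> bool" where
  "fpoly q \<longleftrightarrow> (\<exists>d. \<forall>n>d. q $ n = 0)"

lemma fpoly_const [intro]: "fpoly (fps_const c)"
  unfolding fpoly_def by (intro exI[of _ 0]) auto

lemma fpoly_zero [intro]: "fpoly 0" and fpoly_one [intro]: "fpoly 1"
  using fpoly_const[of 0] fpoly_const[of 1] by simp_all

lemma fpoly_X [intro]: "fpoly fps_X"
  unfolding fpoly_def by (intro exI[of _ 1]) (auto simp: fps_X_def)

lemma fpoly_add [intro]: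
  assumes "fpoly f" "fpoly g"
  shows "fpoly (f + g)"
proof -
  obtain d e where "\<forall>n>d. f $ n = 0" "\<forall>n>e. g $ n = 0"
    using assms unfolding fpoly_def by blast
  then show ?thesis
    unfolding fpoly_def by (intro exI[of _ "max d e"]) simp
qed

lemma fpoly_mult [intro]:
  assumes "fpoly f" "fpoly g"
  shows "fpoly (f * g)"
proof -
  obtain d e where de: "\<forall>n>d. f $ n = 0" "\<forall>n>e. g $ n = 0"
    using assms unfolding fpoly_def by blast
  have "f $ i * g $ (n - i) = 0" if "d + e < n" "i \<le> n" for n i
    using de that by (cases "d < i") auto
  then show ?thesis
    unfolding fpoly_def fps_mult_nth by (intro exI[of _ "d + e"] allI impI sum.neutral) auto
qed

lemma fpoly_uminus [intro]: "fpoly f \<Longrightarrow> fpoly (- f)"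
  by (simp add: fpoly_def)

lemma fpoly_diff [intro]: "fpoly f \<Longrightarrow> fpoly g \<Longrightarrow> fpoly (f - g)"
  using fpoly_add[of f "- g"] by auto

lemma fpoly_power [intro]: "fpoly f \<Longrightarrow> fpoly (f ^ n)"
  by (induction n) auto

lemma fpoly_prod [intro]: "(\<And>i. i \<in> A \<Longrightarrow> fpoly (f i)) \<Longrightarrow> fpoly (prod f A)"
  by (induction A rule: infinite_finite_induct) auto

lemma fpoly_sum [intro]: "(\<And>i. i \<in> A \<Longrightarrow> fpoly (f i)) \<Longrightarrow> fpoly (sum f A)"
  by (induction A rule: infinite_finite_induct) auto

lemma fpoly_deriv [intro]:
  assumes "fpoly f"
  shows "fpoly (fps_deriv f)"
proof -
  obtain d where "\<forall>n>d. f $ n = 0"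
    using assms unfolding fpoly_def by blast
  then show ?thesis
    unfolding fpoly_def by (intro exI[of _ d]) simp
qed

lemma fpoly_bnd:
  assumes "fpoly f"
  obtains B where "bnd B f"
proof -
  obtain d where d: "\<forall>n>d. f $ n = 0"
    using assms unfolding fpoly_def by blast
  have "absv (f $ n) \<le> (\<Sum>i\<le>d. absv (f $ i))" for n
  proof (cases "n \<le> d")
    case True
    then show ?thesis
      by (intro member_le_sum) (auto simp: absv_nonneg)
  next
    case False
    then show ?thesis
      using d by (simp add: sum_nonneg absv_nonneg)
  qed
  then show ?thesis
    using that unfolding bnd_def by blast
qed

end

section \<open>The affinoid algebra as a ring of power series\<close>

locale disc_complement = complete_discretely_valued_field absv p
  for absv :: "'k::field \<Rightarrow> real" and p :: nat +
  fixes v :: nat and \<alpha> :: "nat \<Rightarrow> 'k"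
  assumes absv_center: "i \<in> {1..v} \<Longrightarrow> absv (\<alpha> i) = 1"
begin

text \<open>The expansion at 0 of 1/(x - \<alpha> i). For a centre, every coefficient has absolute
  value 1.\<close>

definition pole :: "nat \<Rightarrow> 'k fps" where
  "pole i = Abs_fps (\<lambda>n. - (inverse (\<alpha> i) ^ Suc n))"

definition den :: "'k fps" where
  "den = (\<Prod>i\<in>{1..v}. fps_X - fps_const (\<alpha> i))"

definition iden :: "'k fps" where
  "iden = (\<Prod>i\<in>{1..v}. pole i)"

lemma bnd_pole: "i \<in> {1..v} \<Longrightarrow> bnd 1 (pole i)"
  by (simp add: bnd_def pole_def absv_mult absv_power absv_inverse absv_center)

lemma bnd_linear: "i \<in> {1..v} \<Longrightarrow> bnd 1 (fps_X - fps_const (\<alpha> i))"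
  by (intro bnd_diff bnd_X bnd_const) (simp add: absv_center)

lemma center_nonzero: "i \<in> {1..v} \<Longrightarrow> \<alpha> i \<noteq> 0"
  using absv_center[of i] by auto

lemma linear_pole: "i \<in> {1..v} \<Longrightarrow> (fps_X - fps_const (\<alpha> i)) * pole i = 1"
  using center_nonzero[of i]
  by (intro fps_ext) (auto simp: left_diff_distrib pole_def field_simps power_eq_if)

lemma den_iden: "den * iden = 1"
  unfolding den_def iden_def prod.distrib[symmetric] by (intro prod.neutral ballI linear_pole)

lemma den_iden_power: "den ^ n * iden ^ n = 1"
  by (simp add: den_iden flip: power_mult_distrib)

text \<open>As \<open>den\<close> and \<open>iden\<close> are inverse to each other and both bounded
  by 1, multiplication by a power of \<open>den\<close> preserves bounds of series in both
  directions.\<close>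

lemma bnd_den: "bnd 1 den" and bnd_iden: "bnd 1 iden"
  unfolding den_def iden_def by (auto intro!: bnd_prod bnd_pole bnd_linear)

lemma fpoly_den [intro]: "fpoly den"
  unfolding den_def by auto

text \<open>The unit constant term is what later preserves the size of a dominant coefficient under
  multiplication by a power of \<open>den\<close>.\<close>

lemma absv_den_0: "absv (den $ 0) = 1"
proof -
  have "prod f A $ 0 = (\<Prod>i\<in>A. f i $ 0)" for f :: "nat \<Rightarrow> 'k fps" and A
    by (induction A rule: infinite_finite_induct) auto
  then have "den $ 0 = (\<Prod>i\<in>{1..v}. (fps_X - fps_const (\<alpha> i)) $ 0)"
    unfolding den_def by blast
  then show ?thesis
    by (simp add: absv_prod absv_center)
qed

text \<open>Functions on \<open>X\<close> are the power series at \<open>0\<close> which are uniform limits of rational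
  functions whose denominator is a power of \<open>den\<close>.\<close>

definition afun :: "'k fps \<Rightarrow> bool" where
  "afun f \<longleftrightarrow> (\<forall>\<epsilon>>0. \<exists>N q. fpoly q \<and> bnd \<epsilon> (f * den ^ N - q))"

lemma bnd_diff_den_mult:
  assumes "bnd \<epsilon> (f * den ^ N - q)" "N \<le> M"
  shows "bnd \<epsilon> (f * den ^ M - q * den ^ (M - N))"
proof -
  have "f * den ^ M - q * den ^ (M - N) = (f * den ^ N - q) * den ^ (M - N)"
    using assms(2) by (simp add: left_diff_distrib mult.assoc flip: power_add)
  then show ?thesis
    using assms(1) by (simp add: bnd_mult_right bnd_power bnd_den)
qed

text \<open>A denominator exponent that works may be enlarged, so finitely many functions can be
  approximated with one common exponent.\<close>

lemma afun_eventually: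
  assumes "afun f" "0 < \<epsilon>"
  shows "eventually (\<lambda>N. \<exists>q. fpoly q \<and> bnd \<epsilon> (f * den ^ N - q)) sequentially"
proof -
  obtain N q where Nq: "fpoly q" "bnd \<epsilon> (f * den ^ N - q)"
    using assms unfolding afun_def by blast
  show ?thesis
    unfolding eventually_sequentially
    using Nq fpoly_den by (meson bnd_diff_den_mult fpoly_mult fpoly_power)
qed

lemma afun_bnd:
  assumes "afun f"
  obtains B where "0 < B" "bnd B f"
proof -
  obtain N q where Nq: "fpoly q" "bnd 1 (f * den ^ N - q)"
    using assms unfolding afun_def by (meson zero_less_one)
  obtain B where B: "bnd B q"
    using Nq(1) fpoly_bnd by blast
  have "bnd (max 1 B) ((f * den ^ N - q) + q)"
    using Nq B by (intro bnd_add) (auto elim: bnd_mono)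
  then have "bnd (max 1 B) (f * den ^ N)"
    by simp
  then have "bnd (max 1 B) (f * den ^ N * iden ^ N)"
    by (rule bnd_mult_right[OF _ bnd_power[OF bnd_iden]])
  then have "bnd (max 1 B) f"
    by (simp add: mult.assoc den_iden_power)
  then show ?thesis
    using that[of "max 1 B"] by simp
qed

lemma afun_fpoly: "fpoly q \<Longrightarrow> afun q"
  unfolding afun_def by (intro allI impI exI[of _ 0] exI[of _ q]) (simp add: bnd_zero)

lemma afun_zero [simp]: "afun 0" and afun_one [simp]: "afun 1" and afun_X [simp]: "afun fps_X"
  and afun_const [simp]: "afun (fps_const c)"
  by (auto intro: afun_fpoly)

lemma afun_add [intro]:
  assumes "afun f" "afun g"
  shows "afun (f + g)"
  unfolding afun_def
proof (intro allI impI)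
  fix \<epsilon> :: real assume "0 < \<epsilon>"
  have "eventually (\<lambda>N. (\<exists>q. fpoly q \<and> bnd \<epsilon> (f * den ^ N - q)) \<and>
      (\<exists>r. fpoly r \<and> bnd \<epsilon> (g * den ^ N - r))) sequentially"
    using assms \<open>0 < \<epsilon>\<close> by (intro eventually_conj afun_eventually)
  then obtain N q r where "fpoly q" "fpoly r" "bnd \<epsilon> (f * den ^ N - q)" "bnd \<epsilon> (g * den ^ N - r)"
    by (auto dest: eventually_happens)
  then show "\<exists>N q. fpoly q \<and> bnd \<epsilon> ((f + g) * den ^ N - q)"
    using bnd_add[of \<epsilon> "f * den ^ N - q" "g * den ^ N - r"]
    by (intro exI[of _ N] exI[of _ "q + r"]) (auto simp: algebra_simps)
qed

lemma afun_uminus [intro]: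
  assumes "afun f"
  shows "afun (- f)"
  unfolding afun_def
proof (intro allI impI)
  fix \<epsilon> :: real assume "0 < \<epsilon>"
  then obtain N q where "fpoly q" "bnd \<epsilon> (f * den ^ N - q)"
    using assms unfolding afun_def by blast
  then show "\<exists>N q. fpoly q \<and> bnd \<epsilon> (- f * den ^ N - q)"
    using bnd_uminus[of \<epsilon> "f * den ^ N - q"] by (intro exI[of _ N] exI[of _ "- q"]) auto
qed

lemma afun_diff [intro]: "afun f \<Longrightarrow> afun g \<Longrightarrow> afun (f - g)"
  using afun_add[of f "- g"] by auto

lemma afun_sum: "(\<And>i. i \<in> A \<Longrightarrow> afun (f i)) \<Longrightarrow> afun (sum f A)"
  by (induction A rule: infinite_finite_induct) auto

lemma afun_mult [intro]:
  assumes "afun f" "afun g"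
  shows "afun (f * g)"
  unfolding afun_def
proof (intro allI impI)
  fix \<epsilon> :: real assume "0 < \<epsilon>"
  obtain B where B: "0 < B" "bnd B g"
    using afun_bnd[OF assms(2)] by blast
  obtain N q where q: "fpoly q" "bnd (\<epsilon> / B) (f * den ^ N - q)"
    using assms(1) \<open>0 < \<epsilon>\<close> B(1) unfolding afun_def by (meson divide_pos_pos)
  obtain C0 where "bnd C0 q"
    using q(1) fpoly_bnd by blast
  then have C: "bnd (max 1 C0) q"
    by (rule bnd_mono) simp
  define C where "C = max 1 C0"
  have "0 < C"
    by (simp add: C_def)
  obtain M r where r: "fpoly r" "bnd (\<epsilon> / C) (g * den ^ M - r)"
    using assms(2) \<open>0 < \<epsilon>\<close> \<open>0 < C\<close> unfolding afun_def by (meson divide_pos_pos)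
  have "bnd (\<epsilon> / B * B) ((f * den ^ N - q) * (g * den ^ M))"
    using B q by (intro bnd_mult bnd_mult_right bnd_power bnd_den)
  moreover have "bnd (C * (\<epsilon> / C)) (q * (g * den ^ M - r))"
    using C r unfolding C_def by (intro bnd_mult)
  ultimately have "bnd \<epsilon> ((f * den ^ N - q) * (g * den ^ M) + q * (g * den ^ M - r))"
    using \<open>0 < B\<close> \<open>0 < C\<close> by (intro bnd_add) auto
  then show "\<exists>N q. fpoly q \<and> bnd \<epsilon> (f * g * den ^ N - q)"
    using q r by (intro exI[of _ "N + M"] exI[of _ "q * r"]) (auto simp: algebra_simps power_add)
qed

lemma afun_power: "afun f \<Longrightarrow> afun (f ^ n)"
  by (induction n) auto

lemma afun_prod: "(\<And>i. i \<in> A \<Longrightarrow> afun (f i)) \<Longrightarrow> afun (prod f A)"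
  by (induction A rule: infinite_finite_induct) auto

lemma afun_of_nat_mult: "afun f \<Longrightarrow> afun (of_nat n * f)"
  by (metis afun_const afun_mult fps_of_nat)

lemma afun_pole:
  assumes "i \<in> {1..v}"
  shows "afun (pole i)"
proof -
  have "pole i * den = (\<Prod>j\<in>{1..v} - {i}. fps_X - fps_const (\<alpha> j))"
    unfolding den_def using assms linear_pole[of i]
    by (subst prod.remove[of _ i]) (auto simp: mult_ac)
  then have "fpoly (pole i * den)"
    by auto
  then show ?thesis
    unfolding afun_def by (intro allI impI exI[of _ 1] exI[of _ "pole i * den"]) (simp add: bnd_zero)
qed

lemma afun_deriv [intro]:
  assumes "afun f"
  shows "afun (fps_deriv f)"
  unfolding afun_def
proof (intro allI impI)
  fix \<epsilon> :: real assume "0 < \<epsilon>"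
  then obtain N q where q: "fpoly q" "bnd \<epsilon> (f * den ^ N - q)"
    using assms unfolding afun_def by blast
  \<comment> \<open>The numerator given by the quotient rule for q / den^N over the denominator
    den^(N+1).\<close>
  define r where "r = fps_deriv q * den - of_nat N * (q * fps_deriv den)"
  have "fpoly (of_nat N :: 'k fps)"
    by (metis fpoly_const fps_of_nat)
  then have "fpoly r"
    unfolding r_def using q fpoly_den by (intro fpoly_diff fpoly_mult fpoly_deriv)
  define e where "e = f * den ^ N - q"
  have "fps_deriv (den ^ N) * den = of_nat N * den ^ N * fps_deriv den"
    by (induction N) (simp_all add: algebra_simps)
  moreover have "fps_deriv e * den =
      fps_deriv f * den ^ N * den + f * (fps_deriv (den ^ N) * den) - fps_deriv q * den"
    by (simp add: e_def algebra_simps)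
  ultimately have "fps_deriv f * den ^ (N + 1) - r =
      fps_deriv e * den - of_nat N * (e * fps_deriv den)"
    unfolding r_def e_def by (simp add: algebra_simps)
  moreover have "bnd \<epsilon> \<dots>"
    using q(2) unfolding e_def[symmetric]
    by (intro bnd_diff bnd_of_nat_mult bnd_mult_right bnd_deriv bnd_den)
  ultimately show "\<exists>N q. fpoly q \<and> bnd \<epsilon> (fps_deriv f * den ^ N - q)"
    using \<open>fpoly r\<close> by (intro exI[of _ "N + 1"] exI[of _ r]) simp
qed

lemma afun_deriv_funpow: "afun f \<Longrightarrow> afun ((fps_deriv ^^ m) f)"
  by (induction m) auto

lemma afun_closed:
  assumes "\<And>\<epsilon>. 0 < \<epsilon> \<Longrightarrow> \<exists>g. afun g \<and> bnd \<epsilon> (f - g)"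
  shows "afun f"
  unfolding afun_def
proof (intro allI impI)
  fix \<epsilon> :: real assume "0 < \<epsilon>"
  obtain g where g: "afun g" "bnd \<epsilon> (f - g)"
    using assms \<open>0 < \<epsilon>\<close> by blast
  obtain N q where q: "fpoly q" "bnd \<epsilon> (g * den ^ N - q)"
    using g(1) \<open>0 < \<epsilon>\<close> unfolding afun_def by blast
  have "bnd \<epsilon> ((f - g) * den ^ N + (g * den ^ N - q))"
    by (intro bnd_add bnd_mult_right bnd_power bnd_den g q)
  then show "\<exists>N q. fpoly q \<and> bnd \<epsilon> (f * den ^ N - q)"
    using q by (intro exI[of _ N] exI[of _ q]) (simp add: algebra_simps)
qed

lemma afun_fsum:
  assumes "null_fps s" "\<And>i. afun (s i)"
  shows "afun (fsum s)"
proof (rule afun_closed)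
  fix \<epsilon> :: real assume "0 < \<epsilon>"
  let ?F = "{i. \<not> bnd \<epsilon> (s i)}"
  have "bnd \<epsilon> (sum s ?F - fsum s)"
    using assms \<open>0 < \<epsilon>\<close> by (intro fsum_approx null_fpsD) auto
  then have "bnd \<epsilon> (fsum s - sum s ?F)"
    using bnd_uminus[of \<epsilon> "fsum s - sum s ?F"] by simp
  then show "\<exists>g. afun g \<and> bnd \<epsilon> (fsum s - g)"
    using assms by (intro exI[of _ "sum s ?F"]) (auto intro: afun_sum)
qed

text \<open>Multiplying the n-th coefficient by n - c is the operator x d/dx - c, which maps
  functions on X to functions on X.\<close>

lemma afun_multiplier:
  assumes "finite S" "afun f"
  shows "afun (Abs_fps (\<lambda>n. (\<Prod>i\<in>S. of_nat n - c i) * f $ n))"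
  using assms
proof (induction S rule: finite_induct)
  case empty
  then show ?case by (simp add: fps_nth_inverse)
next
  case (insert i S)
  let ?g = "Abs_fps (\<lambda>n. (\<Prod>i\<in>S. of_nat n - c i) * f $ n)"
  have "Abs_fps (\<lambda>n. (\<Prod>j\<in>insert i S. of_nat n - c j) * f $ n) =
      fps_X * fps_deriv ?g - fps_const (c i) * ?g"
    using insert.hyps by (intro fps_ext) (auto simp: algebra_simps)
  moreover have "afun ?g"
    using insert by blast
  ultimately show ?case
    by (simp add: afun_diff afun_mult afun_deriv)
qed

end

section \<open>Taylor expansion at the origin\<close>

type_synonym exponent = "nat \<Rightarrow>\<^sub>0 nat"

definition conv :: "(exponent \<Rightarrow> 'a::comm_ring_1) \<Rightarrow> (exponent \<Rightarrow> 'a) \<Rightarrow> exponent \<Rightarrow> 'a" where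
  "conv f g e = (\<Sum>(a, b) | a + b = e. f a * g b)"

definition delta :: "exponent \<Rightarrow> exponent \<Rightarrow> 'a::comm_ring_1" where
  "delta a e = (if e = a then 1 else 0)"

text \<open>A summand of e is bounded by e in every variable and vanishes outside the support of e,
  which leaves finitely many candidates.\<close>

lemma finite_decompositions: "finite {(a, b). a + b = (e :: exponent)}"
proof -
  let ?S = "{a :: exponent. \<exists>b. a + b = e}"
  let ?M = "Max (insert 0 (Poly_Mapping.lookup e ` Poly_Mapping.keys e))"
  have "Poly_Mapping.lookup a i \<le> ?M" "i \<notin> Poly_Mapping.keys e \<Longrightarrow> Poly_Mapping.lookup a i = 0"
    if "a \<in> ?S" for a i
  proof -
    have le: "Poly_Mapping.lookup a i \<le> Poly_Mapping.lookup e i"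
      using that by (auto simp: lookup_add)
    show zero: "i \<notin> Poly_Mapping.keys e \<Longrightarrow> Poly_Mapping.lookup a i = 0"
      using le by (simp add: in_keys_iff)
    show "Poly_Mapping.lookup a i \<le> ?M"
    proof (cases "i \<in> Poly_Mapping.keys e")
      case True
      then have "Poly_Mapping.lookup e i \<le> ?M"
        by (intro Max_ge) auto
      with le show ?thesis by simp
    qed (simp add: zero)
  qed
  then have "Poly_Mapping.lookup ` ?S \<subseteq>
      {f. \<forall>x. (x \<in> Poly_Mapping.keys e \<longrightarrow> f x \<in> {..?M}) \<and> (x \<notin> Poly_Mapping.keys e \<longrightarrow> f x = 0)}"
    by (intro subsetI CollectI allI conjI impI) (auto simp del: Max_insert)
  moreover have "finite \<dots>"
    by (intro finite_set_of_finite_funs) auto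
  ultimately have "finite (Poly_Mapping.lookup ` ?S)"
    by (rule finite_subset)
  then have "finite ?S"
    by (rule finite_imageD) (auto intro: injI poly_mapping_eqI simp: inj_on_def)
  moreover have "{(a, b). a + b = e} \<subseteq> (\<lambda>a. (a, e - a)) ` ?S"
    by auto
  ultimately show ?thesis
    using finite_surj by blast
qed

lemma conv_commute: "conv f g e = conv g f e"
  unfolding conv_def
  by (rule sum.reindex_bij_witness[of _ prod.swap prod.swap]) (auto simp: add.commute mult.commute)

text \<open>Both sides run over the triples of exponents with sum e; the bijection only rebrackets
  them.\<close>

lemma conv_assoc: "conv (conv f g) h e = conv f (conv g h) e"
proof -
  let ?A = "{(a, b). a + b = e}" and ?B = "\<lambda>a. {(b, c). b + c = (a :: exponent)}"
  have "conv (conv f g) h e = (\<Sum>x\<in>?A. \<Sum>y\<in>?B (fst x). f (fst y) * g (snd y) * h (snd x))"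
    by (simp add: conv_def sum_distrib_right case_prod_unfold)
  also have "\<dots> = (\<Sum>(x, y)\<in>Sigma ?A (\<lambda>x. ?B (fst x)). f (fst y) * g (snd y) * h (snd x))"
    using finite_decompositions by (intro sum.Sigma) auto
  also have "\<dots> = (\<Sum>(x, y)\<in>Sigma ?A (\<lambda>x. ?B (snd x)). f (fst x) * (g (fst y) * h (snd y)))"
    by (rule sum.reindex_bij_witness
        [of _ "\<lambda>((a, c), (b, d)). ((a + b, d), (a, b))" "\<lambda>((a, c), (b, d)). ((b, d + c), (d, c))"])
      (auto simp: add.assoc mult.assoc)
  also have "\<dots> = (\<Sum>x\<in>?A. \<Sum>y\<in>?B (snd x). f (fst x) * (g (fst y) * h (snd y)))"
    using finite_decompositions by (intro sum.Sigma[symmetric]) auto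
  also have "\<dots> = conv f (conv g h) e"
    by (simp add: conv_def sum_distrib_left case_prod_unfold)
  finally show ?thesis .
qed

lemma conv_delta_left: "conv (delta a) g (a + b) = g b"
proof -
  have "conv (delta a) g (a + b) = (\<Sum>(a', b')\<in>{(a, b)}. delta a a' * g b')"
    unfolding conv_def
    by (rule sum.mono_neutral_right) (auto simp: finite_decompositions delta_def split: if_splits)
  then show ?thesis
    by (simp add: delta_def)
qed

lemma conv_delta_delta: "conv (delta a) (delta b) = delta (a + b)"
proof
  fix e
  show "conv (delta a) (delta b) e = (delta (a + b) e :: 'a)"
  proof (cases "\<exists>c. e = a + c")
    case True
    then show ?thesis
      by (auto simp: conv_delta_left delta_def)
  next
    case False
    then have "conv (delta a) (delta b) e = (0 :: 'a)"
      unfolding conv_def by (intro sum.neutral) (auto simp: delta_def)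
    then show ?thesis
      using False by (auto simp: delta_def)
  qed
qed

lemma conv_one_left: "conv (delta 0) g e = g e"
  using conv_delta_left[of 0 g e] by simp

lemma conv_add_left: "conv (\<lambda>e. f e + g e) h e = conv f h e + conv g h e"
  by (simp add: conv_def distrib_right sum.distrib case_prod_unfold)

lemma conv_diff_left: "conv (\<lambda>e. f e - g e) h e = conv f h e - conv g h e"
  by (simp add: conv_def left_diff_distrib sum_subtractf case_prod_unfold)

lemma conv_diff_right: "conv h (\<lambda>e. f e - g e) e = conv h f e - conv h g e"
  by (simp add: conv_commute[of h] conv_diff_left)

lemma conv_cmult_left: "conv (\<lambda>e. c * f e) h e = c * conv f h e"
  by (simp add: conv_def sum_distrib_left mult.assoc case_prod_unfold)

lemma conv_cmult_right: "conv h (\<lambda>e. c * f e) e = c * conv h f e"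
  by (simp add: conv_commute[of h] conv_cmult_left)

lemma conv_sum_left: "conv (\<lambda>e. \<Sum>i\<in>A. f i e) h e = (\<Sum>i\<in>A. conv (f i) h e)"
  unfolding conv_def sum_distrib_right case_prod_unfold by (rule sum.swap)

lemma conv_nonzero:
  assumes "conv f g e \<noteq> 0"
  obtains a b where "e = a + b" "f a \<noteq> 0" "g b \<noteq> 0"
proof -
  have "\<exists>p\<in>{(a, b). a + b = e}. (\<lambda>(a, b). f a * g b) p \<noteq> 0"
    using assms unfolding conv_def by (meson sum.neutral)
  then show ?thesis
    using that by fastforce
qed

context complete_discretely_valued_field
begin

text \<open>Regrouping a sum by the value of \<open>h\<close>. Each p lies in one fibre only, so the
  family indexed by the pairs (e, p) is null as well and the two summations may be
  exchanged.\<close>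

lemma nsum_fibers:
  assumes "null_family w"
  shows "null_family (\<lambda>e. nsum (\<lambda>p. if h p = e then w p else 0))"
    and "nsum (\<lambda>e. nsum (\<lambda>p. if h p = e then w p else 0)) = nsum w"
proof -
  have null: "null_family (\<lambda>(e, p). if h p = e then w p else 0)"
    unfolding null_family_def
  proof (intro allI impI)
    fix \<epsilon> :: real assume "0 < \<epsilon>"
    have "{q. \<epsilon> \<le> absv (case q of (e, p) \<Rightarrow> if h p = e then w p else 0)} \<subseteq>
        (\<lambda>p. (h p, p)) ` {p. \<epsilon> \<le> absv (w p)}"
      using \<open>0 < \<epsilon>\<close> by (auto split: if_splits)
    then show "finite {q. \<epsilon> \<le> absv (case q of (e, p) \<Rightarrow> if h p = e then w p else 0)}"
      using null_familyD[OF assms \<open>0 < \<epsilon>\<close>] finite_surj by blast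
  qed
  show "null_family (\<lambda>e. nsum (\<lambda>p. if h p = e then w p else 0))"
    using null_family_nsum_section[OF null] by simp
  have "nsum (\<lambda>e. if h p = e then w p else 0) = w p" for p
    by (subst nsum_single[of "h p"]) auto
  then show "nsum (\<lambda>e. nsum (\<lambda>p. if h p = e then w p else 0)) = nsum w"
    by (subst nsum_swap[OF null]) simp
qed

lemma nsum_mult:
  assumes "null_family s" "null_family t"
  shows "nsum s * nsum t = nsum (\<lambda>(i, j). s i * t j)"
proof -
  have "nsum (\<lambda>(i, j). s i * t j) = nsum (\<lambda>i. nsum (\<lambda>j. s i * t j))"
    using nsum_Sigma[OF null_family_prod[OF assms]] by simp
  also have "\<dots> = nsum (\<lambda>i. nsum t * s i)"
    using assms by (simp add: nsum_cmult mult.commute)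
  also have "\<dots> = nsum t * nsum s"
    using assms by (simp add: nsum_cmult)
  also have "\<dots> = nsum s * nsum t"
    by (rule mult.commute)
  finally show ?thesis by simp
qed

lemma null_family_conv:
  assumes "null_family f" "null_family g"
  shows "null_family (conv f g)"
proof -
  have "conv f g e = nsum (\<lambda>p. if fst p + snd p = e then (case p of (a, b) \<Rightarrow> f a * g b) else 0)" for e
    unfolding conv_def using finite_decompositions[of e]
    by (subst nsum_finite[of "{(a, b). a + b = e}"]) (auto intro!: sum.cong)
  then have "conv f g = (\<lambda>e. nsum (\<lambda>p. if fst p + snd p = e then (case p of (a, b) \<Rightarrow> f a * g b) else 0))"
    by blast
  then show ?thesis
    using nsum_fibers(1)[OF null_family_prod[OF assms], of "\<lambda>p. fst p + snd p"] by simp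
qed

end

section \<open>The Tate algebra and its Taylor map\<close>

context disc_complement
begin

abbreviation T :: "'k series ring" where
  "T \<equiv> tate_algebra absv v"

lemma tate_carrier_iff:
  "f \<in> carrier T \<longleftrightarrow> (\<forall>e. f e \<noteq> 0 \<longrightarrow> Poly_Mapping.keys e \<subseteq> {0..v}) \<and> null_family f"
  by (simp add: tate_algebra_def null_family_def)

lemma tate_null: "f \<in> carrier T \<Longrightarrow> null_family f"
  by (simp add: tate_carrier_iff)

lemma tate_mult_eq: "f \<otimes>\<^bsub>T\<^esub> g = conv f g"
  by (simp add: tate_algebra_def conv_def fun_eq_iff)

lemma tate_add_eq: "f \<oplus>\<^bsub>T\<^esub> g = (\<lambda>e. f e + g e)"
  by (simp add: tate_algebra_def)

lemma tate_one_eq: "\<one>\<^bsub>T\<^esub> = delta 0"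
  by (simp add: tate_algebra_def delta_def fun_eq_iff)

lemma tate_zero_eq: "\<zero>\<^bsub>T\<^esub> = (\<lambda>e. 0)"
  by (simp add: tate_algebra_def)

lemma delta_carrier: "Poly_Mapping.keys a \<subseteq> {0..v} \<Longrightarrow> delta a \<in> carrier T"
  unfolding tate_carrier_iff by (auto simp: delta_def intro!: null_family_finite)

lemma tate_add_closed: "f \<in> carrier T \<Longrightarrow> g \<in> carrier T \<Longrightarrow> (\<lambda>e. f e + g e) \<in> carrier T"
  unfolding tate_carrier_iff by (auto intro: null_family_add) (metis add.right_neutral atLeastAtMost_iff subsetD)

lemma tate_uminus_closed: "f \<in> carrier T \<Longrightarrow> (\<lambda>e. - f e) \<in> carrier T"
  unfolding tate_carrier_iff by (auto intro: null_family_uminus)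

lemma tate_diff_closed: "f \<in> carrier T \<Longrightarrow> g \<in> carrier T \<Longrightarrow> (\<lambda>e. f e - g e) \<in> carrier T"
  using tate_add_closed[of f "\<lambda>e. - g e"] tate_uminus_closed[of g] by simp

lemma tate_cmult_closed: "f \<in> carrier T \<Longrightarrow> (\<lambda>e. c * f e) \<in> carrier T"
  unfolding tate_carrier_iff by (auto intro: null_family_cmult)

lemma tate_sum_closed:
  "(\<And>i. i \<in> A \<Longrightarrow> f i \<in> carrier T) \<Longrightarrow> (\<lambda>e. \<Sum>i\<in>A. f i e) \<in> carrier T"
proof (induction A rule: infinite_finite_induct)
  case (insert i A)
  then show ?case
    using tate_add_closed[of "f i" "\<lambda>e. \<Sum>i\<in>A. f i e"] by simp
qed (simp_all add: tate_carrier_iff)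

lemma tate_mult_closed:
  assumes "f \<in> carrier T" "g \<in> carrier T"
  shows "conv f g \<in> carrier T"
  unfolding tate_carrier_iff
proof (intro conjI allI impI)
  fix e assume "conv f g e \<noteq> 0"
  then obtain a b where "e = a + b" "f a \<noteq> 0" "g b \<noteq> 0"
    by (rule conv_nonzero)
  then show "Poly_Mapping.keys e \<subseteq> {0..v}"
    using assms keys_add[of a b] unfolding tate_carrier_iff by blast
qed (use assms in \<open>simp add: null_family_conv tate_carrier_iff\<close>)

lemma tate_cring: "cring T"
proof (rule cringI)
  show "abelian_group T"
  proof (rule abelian_groupI)
    fix f assume "f \<in> carrier T"
    then show "\<exists>g\<in>carrier T. g \<oplus>\<^bsub>T\<^esub> f = \<zero>\<^bsub>T\<^esub>"
      by (intro bexI[of _ "\<lambda>e. - f e"]) (auto simp: tate_add_eq tate_zero_eq tate_uminus_closed)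
  qed (auto simp: tate_add_eq tate_zero_eq tate_add_closed add_ac, simp add: tate_carrier_iff)
  show "comm_monoid T"
    by (rule comm_monoidI)
      (auto simp: tate_mult_eq tate_one_eq conv_assoc conv_one_left fun_eq_iff
        intro: tate_mult_closed delta_carrier conv_commute)
qed (simp add: tate_mult_eq tate_add_eq conv_add_left fun_eq_iff)

sublocale T: cring T
  by (rule tate_cring)

lemma tate_uminus_eq: "f \<in> carrier T \<Longrightarrow> \<ominus>\<^bsub>T\<^esub> f = (\<lambda>e. - f e)"
  by (rule T.minus_equality) (auto simp: tate_add_eq tate_zero_eq tate_uminus_closed)

lemma tate_minus_eq: "g \<in> carrier T \<Longrightarrow> f \<ominus>\<^bsub>T\<^esub> g = (\<lambda>e. f e - g e)"
  by (simp add: a_minus_def tate_uminus_eq tate_add_eq)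

text \<open>The value of a monomial when y_i is replaced by the expansion \<open>pole i\<close> of
  1/(x - \<alpha> i).\<close>

definition mono :: "exponent \<Rightarrow> 'k fps" where
  "mono e = fps_X ^ Poly_Mapping.lookup e 0 * (\<Prod>i\<in>{1..v}. pole i ^ Poly_Mapping.lookup e i)"

lemma mono_add: "mono (a + b) = mono a * mono b"
  by (simp add: mono_def lookup_add power_add prod.distrib mult_ac)

lemma mono_zero [simp]: "mono 0 = 1"
  by (simp add: mono_def)

lemma mono_single_0: "mono (Poly_Mapping.single 0 n) = fps_X ^ n"
  by (simp add: mono_def lookup_single)

lemma mono_single: "i \<in> {1..v} \<Longrightarrow> mono (Poly_Mapping.single i n) = pole i ^ n"
proof -
  assume i: "i \<in> {1..v}"
  have "(\<Prod>j\<in>{1..v}. pole j ^ Poly_Mapping.lookup (Poly_Mapping.single i n) j) =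
      (\<Prod>j\<in>{1..v}. if j = i then pole i ^ n else 1)"
    by (intro prod.cong) (auto simp: lookup_single)
  then show ?thesis
    using i by (simp add: mono_def lookup_single)
qed

lemma bnd_mono_fun: "bnd 1 (mono e)"
  unfolding mono_def by (intro bnd_mult_left bnd_power bnd_X bnd_prod bnd_pole)

lemma afun_mono: "afun (mono e)"
  unfolding mono_def by (intro afun_mult afun_power afun_X afun_prod afun_pole)

definition taylor :: "'k series \<Rightarrow> 'k fps" where
  "taylor f = fsum (\<lambda>e. fps_const (f e) * mono e)"

lemma null_fps_taylor:
  assumes "null_family f"
  shows "null_fps (\<lambda>e. fps_const (f e) * mono e)"
  unfolding null_fps_def
proof (intro allI impI)
  fix \<epsilon> :: real assume "0 < \<epsilon>"
  have "bnd \<epsilon> (fps_const (f e) * mono e)" if "absv (f e) \<le> \<epsilon>" for e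
    using bnd_mono[OF bnd_const_mult[OF bnd_mono_fun, of "f e" e]] that by simp
  then have "{e. \<not> bnd \<epsilon> (fps_const (f e) * mono e)} \<subseteq> {e. \<epsilon> \<le> absv (f e)}"
    using linear by blast
  then show "finite {e. \<not> bnd \<epsilon> (fps_const (f e) * mono e)}"
    using null_familyD[OF assms \<open>0 < \<epsilon>\<close>] finite_subset by blast
qed

lemma taylor_nth: "taylor f $ n = nsum (\<lambda>e. f e * mono e $ n)"
  by (simp add: taylor_def fsum_nth)

lemma null_taylor_nth: "null_family f \<Longrightarrow> null_family (\<lambda>e. f e * mono e $ n)"
  using null_fps_nth[OF null_fps_taylor] by simp

lemma afun_taylor: "f \<in> carrier T \<Longrightarrow> afun (taylor f)"
  unfolding taylor_def by (intro afun_fsum null_fps_taylor tate_null afun_mult afun_const afun_mono)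

lemma bnd_taylor:
  assumes "f \<in> carrier T" "\<And>e. absv (f e) \<le> r"
  shows "bnd r (taylor f)"
proof -
  have "0 \<le> r"
    using assms(2)[of 0] absv_nonneg[of "f 0"] by simp
  then show ?thesis
    unfolding taylor_def using assms bnd_mono[OF bnd_const_mult[OF bnd_mono_fun]]
    by (intro bnd_fsum null_fps_taylor tate_null) auto
qed

lemma taylor_add:
  "f \<in> carrier T \<Longrightarrow> g \<in> carrier T \<Longrightarrow> taylor (\<lambda>e. f e + g e) = taylor f + taylor g"
  by (intro fps_ext)
    (simp add: taylor_nth distrib_right nsum_add null_taylor_nth tate_null)

lemma taylor_cmult: "f \<in> carrier T \<Longrightarrow> taylor (\<lambda>e. c * f e) = fps_const c * taylor f"
  by (intro fps_ext)
    (simp add: taylor_nth mult.assoc nsum_cmult null_taylor_nth tate_null)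

lemma taylor_zero: "taylor (\<lambda>e. 0) = 0"
  by (intro fps_ext) (simp add: taylor_nth)

lemma taylor_diff:
  "f \<in> carrier T \<Longrightarrow> g \<in> carrier T \<Longrightarrow> taylor (\<lambda>e. f e - g e) = taylor f - taylor g"
  by (intro fps_ext)
    (simp add: taylor_nth left_diff_distrib nsum_diff null_taylor_nth tate_null)

lemma taylor_delta: "taylor (delta a) = mono a"
  by (intro fps_ext) (subst taylor_nth, subst nsum_single[of a], auto simp: delta_def)

text \<open>The pairs of exponents are grouped by their sum. The n-th coefficient of a product of
  two monomials is a finite convolution, which can be pulled out of the infinite sum.\<close>

lemma taylor_mult:
  assumes "f \<in> carrier T" "g \<in> carrier T"
  shows "taylor (conv f g) = taylor f * taylor g"
proof (rule fps_ext)
  fix n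
  let ?w = "\<lambda>(a, b). f a * g b * (mono a * mono b) $ n"
  have null: "null_family ?w"
    using null_family_mult_bounded[OF null_family_prod[OF tate_null[OF assms(1)] tate_null[OF assms(2)]],
        of "\<lambda>(a, b). (mono a * mono b) $ n" 1]
      bndD[OF bnd_mult_left[OF bnd_mono_fun bnd_mono_fun]]
    by (simp add: case_prod_unfold)
  have "conv f g e * mono e $ n = nsum (\<lambda>p. if fst p + snd p = e then ?w p else 0)" for e
    unfolding conv_def sum_distrib_right using finite_decompositions[of e]
    by (subst nsum_finite[of "{(a, b). a + b = e}"]) (auto intro!: sum.cong simp: mono_add)
  then have "taylor (conv f g) $ n = nsum ?w"
    unfolding taylor_nth using nsum_fibers(2)[OF null, of "\<lambda>p. fst p + snd p"] by simp
  also have "\<dots> = nsum (\<lambda>p. \<Sum>k=0..n. case p of (a, b) \<Rightarrow> (f a * mono a $ k) * (g b * mono b $ (n - k)))"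
    by (intro arg_cong[of _ _ nsum])
      (auto simp: fps_mult_nth sum_distrib_left mult_ac fun_eq_iff intro!: sum.cong)
  also have "\<dots> = (\<Sum>k=0..n. nsum (\<lambda>(a, b). (f a * mono a $ k) * (g b * mono b $ (n - k))))"
    by (intro nsum_sum null_family_prod null_taylor_nth tate_null assms)
  also have "\<dots> = (\<Sum>k=0..n. taylor f $ k * taylor g $ (n - k))"
    by (simp add: taylor_nth nsum_mult null_taylor_nth tate_null assms)
  finally show "taylor (conv f g) $ n = (taylor f * taylor g) $ n"
    by (simp add: fps_mult_nth)
qed

lemma tate_var_eq: "tate_var i = delta (Poly_Mapping.single i 1)"
  by (simp add: tate_var_def delta_def fun_eq_iff)

lemma tate_const_eq: "tate_const c = (\<lambda>e. c * delta 0 e)"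
  by (simp add: tate_const_def delta_def fun_eq_iff)

lemma tate_var_carrier: "i \<in> {0..v} \<Longrightarrow> tate_var i \<in> carrier T"
  by (simp add: tate_var_eq delta_carrier)

lemma tate_const_carrier: "tate_const c \<in> carrier T"
  by (simp add: tate_const_eq delta_carrier tate_cmult_closed)

lemma taylor_var_0: "taylor (tate_var 0) = fps_X"
  by (simp add: tate_var_eq taylor_delta mono_single_0)

lemma taylor_var: "i \<in> {1..v} \<Longrightarrow> taylor (tate_var i) = pole i"
  by (simp add: tate_var_eq taylor_delta mono_single)

lemma taylor_const: "taylor (tate_const c) = fps_const c"
  by (simp add: tate_const_eq taylor_cmult taylor_delta delta_carrier)

end

section \<open>Sums arising from successive approximation\<close>

context complete_discretely_valued_field
begin

lemma null_family_geometric: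
  fixes h :: "nat \<Rightarrow> 'i \<Rightarrow> 'k"
  assumes "\<And>n. null_family (h n)" "\<And>n i. absv (h n i) \<le> B / 2 ^ n"
  shows "null_family (\<lambda>(n, i). h n i)"
  unfolding null_family_def
proof (intro allI impI)
  fix \<epsilon> :: real assume "0 < \<epsilon>"
  obtain n0 where n0: "B / \<epsilon> < 2 ^ n0"
    using real_arch_pow[of 2 "B / \<epsilon>"] by auto
  have "n < n0" if "\<epsilon> \<le> absv (h n i)" for n i
  proof (rule ccontr)
    assume "\<not> n < n0"
    then have "(2 :: real) ^ n0 \<le> 2 ^ n"
      by (intro power_increasing) auto
    then have "B / \<epsilon> < 2 ^ n"
      using n0 by linarith
    then have "B / 2 ^ n < \<epsilon>"
      using \<open>0 < \<epsilon>\<close> by (simp add: field_simps)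
    then show False
      using that assms(2)[of n i] by linarith
  qed
  then have "{q. \<epsilon> \<le> absv (case q of (n, i) \<Rightarrow> h n i)} \<subseteq> Sigma {..<n0} (\<lambda>n. {i. \<epsilon> \<le> absv (h n i)})"
    by auto
  moreover have "finite \<dots>"
    using null_familyD[OF assms(1) \<open>0 < \<epsilon>\<close>] by auto
  ultimately show "finite {q. \<epsilon> \<le> absv (case q of (n, i) \<Rightarrow> h n i)}"
    by (rule finite_subset)
qed

lemma null_family_sequence:
  fixes s :: "nat \<Rightarrow> 'k"
  assumes "\<And>n. absv (s n) \<le> B / 2 ^ n"
  shows "null_family s"
proof -
  have "null_family (\<lambda>(n, i :: unit). s n)"
    using assms by (intro null_family_geometric[of _ B] null_family_finite) auto
  then show ?thesis
    using null_family_inj[of _ "\<lambda>n. (n, ())"] by (fastforce intro: injI)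
qed

lemma nsum_telescope:
  fixes s :: "nat \<Rightarrow> 'k"
  assumes "null_family s"
  shows "nsum (\<lambda>n. s n - s (Suc n)) = s 0"
proof -
  have null: "null_family (\<lambda>n. s (Suc n))"
    using null_family_inj[OF assms, of Suc] by simp
  have "nsum s = nsum (\<lambda>n. (if n = 0 then s 0 else 0) + (if n = 0 then 0 else s n))"
    by (intro arg_cong[of _ _ nsum]) auto
  also have "\<dots> = nsum (\<lambda>n :: nat. if n = 0 then s 0 else 0) + nsum (\<lambda>n. if n = 0 then 0 else s n)"
  proof (rule nsum_add)
    show "null_family (\<lambda>n :: nat. if n = 0 then s 0 else 0)"
      by (rule null_family_le[OF assms]) (auto simp: absv_nonneg)
    show "null_family (\<lambda>n. if n = 0 then 0 else s n)"
      by (rule null_family_le[OF assms]) (auto simp: absv_nonneg)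
  qed
  also have "nsum (\<lambda>n :: nat. if n = 0 then s 0 else 0) = s 0"
    by (subst nsum_single[of 0]) auto
  also have "nsum (\<lambda>n. if n = 0 then 0 else s n) = nsum (\<lambda>n. s (Suc n))"
  proof -
    have "null_family (\<lambda>n. if n = 0 then 0 else s n)"
      by (rule null_family_le[OF assms]) (simp add: absv_nonneg)
    from nsum_reindex[OF _ _ this, of Suc] show ?thesis
      by (simp add: image_def) (metis not0_implies_Suc)
  qed
  finally show ?thesis
    using assms null by (simp add: nsum_diff)
qed

end

context disc_complement
begin

lemma tate_nsum_closed:
  assumes "\<And>n. h n \<in> carrier T" "\<And>n e. absv (h n e) \<le> B / 2 ^ n"
  shows "(\<lambda>e. nsum (\<lambda>n :: nat. h n e)) \<in> carrier T"
  unfolding tate_carrier_iff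
proof (intro conjI allI impI)
  have null: "null_family (\<lambda>(n, e). h n e)"
    using assms by (intro null_family_geometric[of _ B] tate_null) auto
  from null_family_inj[OF this, of prod.swap] have "null_family (\<lambda>(e, n). h n e)"
    by (simp add: case_prod_unfold)
  then show "null_family (\<lambda>e. nsum (\<lambda>n. h n e))"
    using null_family_nsum_section by fastforce
  fix e assume "nsum (\<lambda>n. h n e) \<noteq> 0"
  then obtain n where "h n e \<noteq> 0"
    by (cases "\<forall>n. h n e = 0") auto
  then show "Poly_Mapping.keys e \<subseteq> {0..v}"
    using assms(1) tate_carrier_iff by blast
qed

section \<open>The ideal of relations as the kernel of the Taylor map\<close>

definition gen :: "nat \<Rightarrow> 'k series" where
  "gen i = (\<lambda>e. delta (Poly_Mapping.single 0 1 + Poly_Mapping.single i 1) e -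
     \<alpha> i * delta (Poly_Mapping.single i 1) e - delta 0 e)"

lemma gen_carrier:
  assumes "i \<in> {1..v}"
  shows "gen i \<in> carrier T"
proof -
  have "Poly_Mapping.keys (Poly_Mapping.single 0 1 + Poly_Mapping.single i 1 :: exponent) \<subseteq> {0..v}"
    using assms keys_add[of "Poly_Mapping.single 0 1 :: exponent" "Poly_Mapping.single i 1"] by auto
  then show ?thesis
    unfolding gen_def using assms
    by (intro tate_diff_closed tate_cmult_closed delta_carrier) auto
qed

lemma gen_eq:
  assumes "i \<in> {1..v}"
  shows "((tate_var 0 \<ominus>\<^bsub>T\<^esub> tate_const (\<alpha> i)) \<otimes>\<^bsub>T\<^esub> tate_var i) \<ominus>\<^bsub>T\<^esub> \<one>\<^bsub>T\<^esub> = gen i"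
proof -
  have *: "tate_var 0 \<ominus>\<^bsub>T\<^esub> tate_const (\<alpha> i) =
      (\<lambda>e. delta (Poly_Mapping.single 0 1) e - \<alpha> i * delta 0 e)"
    by (simp only: tate_minus_eq tate_const_carrier) (simp add: tate_var_eq tate_const_eq)
  have "delta 0 \<in> carrier T"
    by (rule delta_carrier) simp
  then show ?thesis
    unfolding tate_one_eq tate_minus_eq[OF \<open>delta 0 \<in> carrier T\<close>] tate_mult_eq *
    by (simp add: fun_eq_iff tate_var_eq conv_diff_left conv_cmult_left conv_delta_delta gen_def)
qed

lemma taylor_gen:
  assumes "i \<in> {1..v}"
  shows "taylor (gen i) = 0"
proof -
  have car: "delta (Poly_Mapping.single i 1) \<in> carrier T" "delta 0 \<in> carrier T"
    "delta (Poly_Mapping.single 0 1 + Poly_Mapping.single i 1) \<in> carrier T"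
    using assms keys_add[of "Poly_Mapping.single 0 1 :: exponent" "Poly_Mapping.single i 1"]
    by (auto intro!: delta_carrier)
  have "taylor (gen i) = fps_X * pole i - fps_const (\<alpha> i) * pole i - 1"
    unfolding gen_def using assms car
    by (simp add: taylor_diff taylor_cmult taylor_delta tate_diff_closed tate_cmult_closed mono_add
        mono_single_0 mono_single)
  then show ?thesis
    using linear_pole[OF assms] by (simp add: left_diff_distrib)
qed

abbreviation I :: "'k series set" where
  "I \<equiv> aff_ideal absv v \<alpha>"

lemma I_eq: "I = Idl\<^bsub>T\<^esub> (gen ` {1..v})"
proof -
  have "{((tate_var 0 \<ominus>\<^bsub>T\<^esub> tate_const (\<alpha> i)) \<otimes>\<^bsub>T\<^esub> tate_var i) \<ominus>\<^bsub>T\<^esub> \<one>\<^bsub>T\<^esub> | i. i \<in> {1..v}} = gen ` {1..v}"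
    using gen_eq by (force simp: image_def)
  then show ?thesis
    by (simp add: aff_ideal_def Let_def)
qed

lemma I_ideal: "ideal I T"
  unfolding I_eq using gen_carrier by (intro T.genideal_ideal) auto

sublocale I: ideal I T
  by (rule I_ideal)

definition comb :: "(nat \<Rightarrow> 'k series) \<Rightarrow> 'k series" where
  "comb h = (\<lambda>e. \<Sum>i\<in>{1..v}. conv (h i) (gen i) e)"

lemma comb_in_I:
  assumes "\<And>i. i \<in> {1..v} \<Longrightarrow> h i \<in> carrier T"
  shows "comb h \<in> I"
proof -
  have "(\<lambda>e. \<Sum>i\<in>A. conv (h i) (gen i) e) \<in> I" if "A \<subseteq> {1..v}" for A
    using finite_subset[OF that finite_atLeastAtMost] that
  proof (induction A rule: finite_induct)
    case empty
    then show ?case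
      using I.zero_closed by (simp add: tate_zero_eq)
  next
    case (insert i A)
    have "gen i \<in> I"
      unfolding I_eq using insert.prems gen_carrier
      by (intro subsetD[OF T.genideal_self] imageI) auto
    then have "h i \<otimes>\<^bsub>T\<^esub> gen i \<in> I"
      using assms insert.prems by (intro I.I_l_closed) auto
    from I.a_closed[OF this] insert show ?case
      by (simp add: tate_add_eq tate_mult_eq)
  qed
  then show ?thesis
    unfolding comb_def by blast
qed

text \<open>The kernel of the Taylor map is an ideal and contains the generators, hence also the
  ideal that they generate.\<close>

lemma taylor_ideal: "f \<in> I \<Longrightarrow> taylor f = 0"
proof -
  have "ideal {f \<in> carrier T. taylor f = 0} T"
  proof (rule idealI)
    show "subgroup {f \<in> carrier T. taylor f = 0} (add_monoid T)"
    proof (rule T.add.subgroupI)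
      fix f assume "f \<in> {f \<in> carrier T. taylor f = 0}"
      then show "\<ominus>\<^bsub>T\<^esub> f \<in> {f \<in> carrier T. taylor f = 0}"
        using taylor_cmult[of f "- 1"] by (simp add: tate_uminus_eq tate_uminus_closed)
    qed (auto simp: taylor_zero[folded tate_zero_eq] tate_add_eq taylor_add tate_add_closed)
  qed (auto simp: T.ring_axioms tate_mult_eq taylor_mult tate_mult_closed)
  moreover have "gen ` {1..v} \<subseteq> {f \<in> carrier T. taylor f = 0}"
    using gen_carrier taylor_gen by auto
  ultimately have "I \<subseteq> {f \<in> carrier T. taylor f = 0}"
    unfolding I_eq by (rule T.genideal_minimal)
  then show "f \<in> I \<Longrightarrow> taylor f = 0"
    by blast
qed

definition lift_exp :: "nat \<Rightarrow> nat \<Rightarrow> exponent" where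
  "lift_exp N n = Poly_Mapping.single 0 n + (\<Sum>i\<in>{1..v}. Poly_Mapping.single i N)"

text \<open>The element \<open>q(x) (y\<^sub>1 \<cdots> y\<^sub>v)\<^sup>N\<close> of the Tate algebra.\<close>

definition lift :: "nat \<Rightarrow> 'k fps \<Rightarrow> 'k series" where
  "lift N q e = (if e = lift_exp N (Poly_Mapping.lookup e 0) then q $ Poly_Mapping.lookup e 0 else 0)"

lemma lookup_lift_exp:
  "Poly_Mapping.lookup (lift_exp N n) i = (if i = 0 then n else if i \<le> v then N else 0)"
proof -
  have "(\<Sum>j\<in>{1..v}. Poly_Mapping.lookup (Poly_Mapping.single j N) i) =
      (\<Sum>j\<in>{1..v}. if j = i then N else 0)"
    by (intro sum.cong) (auto simp: lookup_single)
  then show ?thesis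
    by (simp add: lift_exp_def lookup_add lookup_sum lookup_single when_def)
qed

lemma keys_lift_exp: "Poly_Mapping.keys (lift_exp N n) \<subseteq> {0..v}"
  by (auto simp: in_keys_iff lookup_lift_exp split: if_splits)

lemma lift_lift_exp: "lift N q (lift_exp N n) = q $ n"
  by (simp add: lift_def lookup_lift_exp)

lemma mono_lift_exp: "mono (lift_exp N n) = fps_X ^ n * iden ^ N"
proof -
  have "mono (lift_exp N n) = fps_X ^ n * (\<Prod>i\<in>{1..v}. pole i ^ N)"
    unfolding mono_def by (intro arg_cong2[of _ _ _ _ "(*)"] prod.cong) (auto simp: lookup_lift_exp)
  then show ?thesis
    by (simp add: iden_def prod_power_distrib)
qed

lemma lift_carrier:
  assumes "fpoly q"
  shows "lift N q \<in> carrier T"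
proof -
  obtain d where d: "\<forall>n>d. q $ n = 0"
    using assms fpoly_def by blast
  have "e \<in> lift_exp N ` {..d}" if "lift N q e \<noteq> 0" for e
    using that d unfolding lift_def by (metis atMost_iff image_eqI leI)
  then have "{e. lift N q e \<noteq> 0} \<subseteq> lift_exp N ` {..d}"
    by blast
  then have "finite {e. lift N q e \<noteq> 0}"
    by (rule finite_subset) auto
  moreover have "Poly_Mapping.keys e \<subseteq> {0..v}" if "lift N q e \<noteq> 0" for e
    using that keys_lift_exp unfolding lift_def by metis
  ultimately show ?thesis
    unfolding tate_carrier_iff by (auto intro: null_family_finite)
qed

lemma absv_lift_le: "bnd r q \<Longrightarrow> absv (lift N q e) \<le> r"
  using bnd_nonneg[of r q] by (simp add: lift_def bndD)

lemma taylor_lift: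
  assumes "fpoly q"
  shows "taylor (lift N q) = q * iden ^ N"
proof (rule fps_ext)
  fix m
  have inj: "inj (lift_exp N)"
    by (rule injI) (metis lookup_lift_exp)
  have "taylor (lift N q) $ m = nsum (\<lambda>n. lift N q (lift_exp N n) * mono (lift_exp N n) $ m)"
    unfolding taylor_nth
  proof (rule nsum_reindex[symmetric, OF inj])
    show "lift N q e * mono e $ m = 0" if "e \<notin> range (lift_exp N)" for e
      using that by (auto simp: lift_def)
    show "null_family (\<lambda>e. lift N q e * mono e $ m)"
      using assms by (intro null_taylor_nth tate_null lift_carrier)
  qed
  also have "\<dots> = nsum (\<lambda>n. if n \<le> m then q $ n * (iden ^ N) $ (m - n) else 0)"
    by (intro arg_cong[of _ _ nsum])
      (auto simp: lift_lift_exp mono_lift_exp fun_eq_iff fps_X_power_mult_nth)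
  also have "\<dots> = (q * iden ^ N) $ m"
    unfolding fps_mult_nth by (subst nsum_finite[of "{0..m}"]) auto
  finally show "taylor (lift N q) $ m = (q * iden ^ N) $ m" .
qed

text \<open>Modulo the generators, \<open>1 = (x - \<alpha>\<^sub>i) y\<^sub>i\<close>, so the exponents of all \<open>y\<^sub>i\<close> can be raised to \<open>N\<close>.\<close>

lemma delta_reduce:
  assumes "Poly_Mapping.keys e \<subseteq> {0..v}" "\<And>i. i \<in> {1..v} \<Longrightarrow> Poly_Mapping.lookup e i \<le> N"
  shows "\<exists>q h. fpoly q \<and> (\<forall>i\<in>{1..v}. h i \<in> carrier T \<and> (\<forall>e. absv (h i e) \<le> 1)) \<and>
    delta e = (\<lambda>e'. lift N q e' + comb h e')"
  using assms
proof (induction "\<Sum>i\<in>{1..v}. N - Poly_Mapping.lookup e i" arbitrary: e rule: less_induct)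
  case less
  show ?case
  proof (cases "\<forall>i\<in>{1..v}. Poly_Mapping.lookup e i = N")
    case True
    define n where "n = Poly_Mapping.lookup e 0"
    have e: "e = lift_exp N n"
    proof (rule poly_mapping_eqI)
      fix i
      have "Poly_Mapping.lookup e i = 0" if "v < i"
        using less.prems(1) that by (meson atLeastAtMost_iff in_keys_iff not_le subsetD)
      then show "Poly_Mapping.lookup e i = Poly_Mapping.lookup (lift_exp N n) i"
        using True by (simp add: lookup_lift_exp n_def)
    qed
    have "delta e e' = lift N (fps_X ^ n) e' + comb (\<lambda>_ _. 0) e'" for e'
    proof (cases "e' = e")
      case True
      then show ?thesis
        unfolding e by (simp add: lift_lift_exp comb_def conv_def delta_def fps_X_power_nth)
    next
      case False
      then show ?thesis
        by (auto simp: lift_def comb_def conv_def delta_def fps_X_power_nth e)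
    qed
    then have "delta e = (\<lambda>e'. lift N (fps_X ^ n) e' + comb (\<lambda>_ _. 0) e')"
      by blast
    then show ?thesis
      by (intro exI[of _ "fps_X ^ n"] exI[of _ "\<lambda>_ _. 0"])
        (auto simp: tate_carrier_iff)
  next
    case False
    then obtain i where i: "i \<in> {1..v}" "Poly_Mapping.lookup e i < N"
      using less.prems(2) by (meson le_neq_implies_less)
    \<comment> \<open>The relation 1 = x y_i - \<alpha>_i y_i - \<open>gen i\<close>, multiplied by
      the monomial of e, leads to the exponents \<open>e1\<close> and \<open>e2\<close>. Both have
      one more y_i, so the total deficit to N decreases.\<close>
    define e2 where "e2 = e + Poly_Mapping.single i 1"
    define e1 where "e1 = e + (Poly_Mapping.single 0 1 + Poly_Mapping.single i 1)"
    have l: "Poly_Mapping.lookup e1 j = Poly_Mapping.lookup e j + (if j = i then 1 else 0)"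
      "Poly_Mapping.lookup e2 j = Poly_Mapping.lookup e j + (if j = i then 1 else 0)"
      if "j \<in> {1..v}" for j
      using that by (auto simp: e1_def e2_def lookup_add lookup_single)
    have "Poly_Mapping.keys e1 \<subseteq> Poly_Mapping.keys e \<union>
        (Poly_Mapping.keys (Poly_Mapping.single 0 1 :: exponent) \<union> Poly_Mapping.keys (Poly_Mapping.single i 1 :: exponent))"
      unfolding e1_def using keys_add[of e "Poly_Mapping.single 0 1 + Poly_Mapping.single i 1"]
        keys_add[of "Poly_Mapping.single 0 1 :: exponent" "Poly_Mapping.single i 1"] by blast
    moreover have "Poly_Mapping.keys e2 \<subseteq> Poly_Mapping.keys e \<union> Poly_Mapping.keys (Poly_Mapping.single i 1 :: exponent)"
      unfolding e2_def by (rule keys_add)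
    ultimately have keys: "Poly_Mapping.keys e1 \<subseteq> {0..v}" "Poly_Mapping.keys e2 \<subseteq> {0..v}"
      using less.prems(1) i(1) by auto
    have le: "Poly_Mapping.lookup e1 j \<le> N" "Poly_Mapping.lookup e2 j \<le> N" if "j \<in> {1..v}" for j
      using l[OF that] less.prems(2)[OF that] i(2) by auto
    have dec: "(\<Sum>j\<in>{1..v}. N - Poly_Mapping.lookup e1 j) < (\<Sum>j\<in>{1..v}. N - Poly_Mapping.lookup e j)"
      "(\<Sum>j\<in>{1..v}. N - Poly_Mapping.lookup e2 j) < (\<Sum>j\<in>{1..v}. N - Poly_Mapping.lookup e j)"
      using i by (auto intro!: sum_strict_mono_ex1 simp: l intro!: bexI[of _ i])
    obtain q1 h1 where 1: "fpoly q1" "\<And>i. i \<in> {1..v} \<Longrightarrow> h1 i \<in> carrier T"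
      "\<And>i e. i \<in> {1..v} \<Longrightarrow> absv (h1 i e) \<le> 1" "delta e1 = (\<lambda>e'. lift N q1 e' + comb h1 e')"
      using less.hyps[OF dec(1) keys(1) le(1)] by blast
    obtain q2 h2 where 2: "fpoly q2" "\<And>i. i \<in> {1..v} \<Longrightarrow> h2 i \<in> carrier T"
      "\<And>i e. i \<in> {1..v} \<Longrightarrow> absv (h2 i e) \<le> 1" "delta e2 = (\<lambda>e'. lift N q2 e' + comb h2 e')"
      using less.hyps[OF dec(2) keys(2) le(2)] by blast
    define q where "q = q1 - fps_const (\<alpha> i) * q2"
    \<comment> \<open>The multiple of \<open>gen i\<close> subtracted in this step: its factor is
      the monomial of e.\<close>
    define d :: "nat \<Rightarrow> 'k series" where "d j = (if j = i then delta e else (\<lambda>_. 0))" for j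
    define h where "h j = (\<lambda>e'. h1 j e' - \<alpha> i * h2 j e' - d j e')" for j
    have d: "d j \<in> carrier T" "absv (d j e') \<le> 1" for j e'
      using less.prems(1) delta_carrier[of e] by (auto simp: d_def tate_carrier_iff) (simp add: delta_def)
    have "fpoly q"
      unfolding q_def using 1(1) 2(1) by auto
    moreover have "h j \<in> carrier T" if "j \<in> {1..v}" for j
      unfolding h_def using 1(2) 2(2) d that by (intro tate_diff_closed tate_cmult_closed) auto
    moreover have "absv (h j e') \<le> 1" if "j \<in> {1..v}" for j e'
      unfolding h_def using 1(3) 2(3) d that absv_mult_le[of "\<alpha> i" 1 _ 1]
      by (intro absv_diff_le) (auto simp: absv_center[OF i(1)])
    moreover have "delta e e' = lift N q e' + comb h e'" for e'
    proof -
      have "comb d e' = conv (delta e) (gen i) e'"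
      proof -
        have "comb d e' = (\<Sum>j\<in>{1..v}. if j = i then conv (delta e) (gen i) e' else 0)"
          unfolding comb_def d_def by (intro sum.cong) (auto simp: conv_def)
        then show ?thesis
          using i(1) by simp
      qed
      also have "\<dots> = delta e1 e' - \<alpha> i * delta e2 e' - delta e e'"
        by (simp add: gen_def e1_def e2_def conv_diff_right conv_cmult_right conv_delta_delta)
      finally have *: "comb d e' = delta e1 e' - \<alpha> i * delta e2 e' - delta e e'" .
      have 3: "comb h e' = comb h1 e' - \<alpha> i * comb h2 e' - comb d e'"
        unfolding h_def comb_def
        by (simp add: conv_diff_left conv_cmult_left sum_subtractf sum_distrib_left)
      have 4: "lift N q e' = lift N q1 e' - \<alpha> i * lift N q2 e'"
        by (simp add: lift_def q_def)
      have 5: "delta e e' = (lift N q1 e' + comb h1 e') - \<alpha> i * (lift N q2 e' + comb h2 e') - comb d e'"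
        using * fun_cong[OF 1(4), of e'] fun_cong[OF 2(4), of e'] by simp
      show ?thesis
        unfolding 3 4 5 by (simp add: algebra_simps)
    qed
    ultimately show ?thesis
      by blast
  qed
qed

text \<open>The finitely many terms of size at least \<epsilon> are brought to the common form Q(x)
  (y_1 ... y_v)^N. As Q is recovered from Taylor series by multiplication with den^N, which does not
  enlarge them, it obeys the bound max r \<epsilon>. This is the isometry of Taylor expansion up to
  \<epsilon>; the bound on \<open>h\<close> allows the construction to be iterated.\<close>

lemma tate_approx:
  assumes f: "f \<in> carrier T" and B: "\<And>e. absv (f e) \<le> B" and r: "bnd r (taylor f)" and "0 < \<epsilon>"
  shows "\<exists>g h. g \<in> carrier T \<and> (\<forall>e. absv (g e) \<le> max r \<epsilon>) \<and>
    (\<forall>i\<in>{1..v}. h i \<in> carrier T \<and> (\<forall>e. absv (h i e) \<le> B)) \<and> (\<forall>e. f e = g e + comb h e)"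
proof -
  define F where "F = {e. \<epsilon> \<le> absv (f e)}"
  have fin: "finite F"
    unfolding F_def using null_familyD[OF tate_null[OF f] \<open>0 < \<epsilon>\<close>] .
  have keys: "Poly_Mapping.keys e \<subseteq> {0..v}" if "e \<in> F" for e
    using that f \<open>0 < \<epsilon>\<close> unfolding tate_carrier_iff F_def by (metis absv_zero mem_Collect_eq not_le)
  \<comment> \<open>The largest exponent of any y_i in the large terms, so that one N serves all of
    them.\<close>
  define N where "N = Max (insert 0 ((\<lambda>(e, i). Poly_Mapping.lookup e i) ` (F \<times> {1..v})))"
  have le_N: "Poly_Mapping.lookup e i \<le> N" if "e \<in> F" "i \<in> {1..v}" for e i
    unfolding N_def using fin that by (intro Max_ge) (auto intro!: rev_image_eqI[of "(e, i)"])
  have "\<forall>e\<in>F. \<exists>q h. fpoly q \<and> (\<forall>i\<in>{1..v}. h i \<in> carrier T \<and> (\<forall>e. absv (h i e) \<le> 1)) \<and>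
      delta e = (\<lambda>e'. lift N q e' + comb h e')"
    by (intro ballI delta_reduce keys le_N)
  from bchoice[OF this] obtain q where q: "\<forall>e\<in>F. \<exists>h. fpoly (q e) \<and>
      (\<forall>i\<in>{1..v}. h i \<in> carrier T \<and> (\<forall>e. absv (h i e) \<le> 1)) \<and>
      delta e = (\<lambda>e'. lift N (q e) e' + comb h e')"
    by blast
  from bchoice[OF q] obtain h where "\<forall>e\<in>F. fpoly (q e) \<and>
      (\<forall>i\<in>{1..v}. h e i \<in> carrier T \<and> (\<forall>e'. absv (h e i e') \<le> 1)) \<and>
      delta e = (\<lambda>e'. lift N (q e) e' + comb (h e) e')"
    by blast
  then have qh: "\<And>e. e \<in> F \<Longrightarrow> fpoly (q e)"
    "\<And>e i. e \<in> F \<Longrightarrow> i \<in> {1..v} \<Longrightarrow> h e i \<in> carrier T"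
    "\<And>e i e'. e \<in> F \<Longrightarrow> i \<in> {1..v} \<Longrightarrow> absv (h e i e') \<le> 1"
    "\<And>e. e \<in> F \<Longrightarrow> delta e = (\<lambda>e'. lift N (q e) e' + comb (h e) e')"
    by simp_all
  define Q where "Q = (\<Sum>e\<in>F. fps_const (f e) * q e)"
  define H where "H i = (\<lambda>e'. \<Sum>e\<in>F. f e * h e i e')" for i
  define g where "g = (\<lambda>e. f e - (\<Sum>e'\<in>F. f e' * delta e' e))"
  have delta_sum: "(\<Sum>e'\<in>F. f e' * delta e' e) = (if e \<in> F then f e else 0)" for e
    using fin by (simp add: delta_def if_distrib[of "\<lambda>x. _ * x"] cong: if_cong)
  have B0: "0 \<le> B"
    using B[of 0] absv_nonneg[of "f 0"] by simp
  have "fpoly Q"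
    unfolding Q_def using qh(1) by (intro fpoly_sum fpoly_mult fpoly_const)
  have H: "H i \<in> carrier T" "absv (H i e') \<le> B" if "i \<in> {1..v}" for i e'
    unfolding H_def using qh(2,3) that B B0
    by (auto intro!: tate_sum_closed tate_cmult_closed absv_sum_le
        order_trans[OF absv_mult_le[of _ B _ 1]])
  have g: "g \<in> carrier T"
    unfolding g_def using f keys
    by (intro tate_diff_closed tate_sum_closed tate_cmult_closed delta_carrier) auto
  have g_le: "absv (g e) \<le> \<epsilon>" for e
    unfolding g_def delta_sum using \<open>0 < \<epsilon>\<close> by (auto simp: F_def)
  have "(\<Sum>e'\<in>F. f e' * delta e' e) = lift N Q e + comb H e" for e
  proof -
    have "(\<Sum>e'\<in>F. f e' * delta e' e) = (\<Sum>e'\<in>F. f e' * lift N (q e') e + f e' * comb (h e') e)"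
      by (intro sum.cong refl) (simp add: qh(4) distrib_left)
    also have "\<dots> = (\<Sum>e'\<in>F. f e' * lift N (q e') e) + (\<Sum>e'\<in>F. f e' * comb (h e') e)"
      by (rule sum.distrib)
    also have "(\<Sum>e'\<in>F. f e' * lift N (q e') e) = lift N Q e"
      by (simp add: lift_def Q_def fps_sum_nth)
    also have "(\<Sum>e'\<in>F. f e' * comb (h e') e) = comb H e"
      unfolding comb_def H_def conv_sum_left conv_cmult_left sum_distrib_left by (rule sum.swap)
    finally show ?thesis .
  qed
  then have f_eq: "f e = g e + (lift N Q e + comb H e)" for e
    by (simp add: g_def)
  have comb: "comb H \<in> I"
    using H(1) by (rule comb_in_I)
  have "taylor f = taylor g + taylor (\<lambda>e. lift N Q e + comb H e)"
  proof -
    have "f = (\<lambda>e. g e + (lift N Q e + comb H e))"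
      using f_eq by blast
    then show ?thesis
      using taylor_add[OF g tate_add_closed[OF lift_carrier[OF \<open>fpoly Q\<close>] I.Icarr[OF comb]]] by metis
  qed
  also have "taylor (\<lambda>e. lift N Q e + comb H e) = Q * iden ^ N"
    using lift_carrier[OF \<open>fpoly Q\<close>] comb taylor_ideal[OF comb] I.Icarr
    by (simp add: taylor_add taylor_lift \<open>fpoly Q\<close>)
  finally have "Q * (iden ^ N * den ^ N) = (taylor f - taylor g) * den ^ N"
    by (simp add: mult.assoc)
  then have "Q = (taylor f - taylor g) * den ^ N"
    using den_iden_power[of N] by (simp add: mult.commute)
  moreover have "bnd (max r \<epsilon>) (taylor f - taylor g)"
    using bnd_mono[OF r] bnd_mono[OF bnd_taylor[OF g g_le]] by (intro bnd_diff) auto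
  ultimately have "bnd (max r \<epsilon>) Q"
    using bnd_mult_right bnd_power bnd_den by blast
  show ?thesis
  proof (intro exI conjI)
    show "(\<lambda>e. g e + lift N Q e) \<in> carrier T"
      using g lift_carrier[OF \<open>fpoly Q\<close>] by (rule tate_add_closed)
    show "\<forall>e. absv (g e + lift N Q e) \<le> max r \<epsilon>"
      using absv_lift_le[OF \<open>bnd (max r \<epsilon>) Q\<close>] g_le
      by (intro allI absv_add_le) (auto intro: max.coboundedI2)
    show "\<forall>i\<in>{1..v}. H i \<in> carrier T \<and> (\<forall>e. absv (H i e) \<le> B)"
      using H by blast
    show "\<forall>e. f e = g e + lift N Q e + comb H e"
      using f_eq by (simp add: add.assoc)
  qed
qed

text \<open>Closedness of the ideal: successive approximation expresses an element with vanishing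
  Taylor expansion as a convergent combination of the generators.\<close>

lemma taylor_eq_0_imp_ideal:
  assumes f: "f \<in> carrier T" and zero: "taylor f = 0"
  shows "f \<in> I"
proof -
  obtain B where B: "0 < B" "\<And>e. absv (f e) \<le> B"
    using null_family_bounded[OF tate_null[OF f]] by blast
  \<comment> \<open>\<open>P n\<close> bounds the n-th remainder, and \<open>R n\<close> says that
    consecutive remainders differ by a combination of the generators whose coefficients shrink at
    the same rate. The bound halves because the Taylor series of the remainder is 0, so that
    \<epsilon> alone limits the next one.\<close>
  define P where "P n g \<longleftrightarrow> g \<in> carrier T \<and> taylor g = 0 \<and> (\<forall>e. absv (g e) \<le> B / 2 ^ n)" for n :: nat and g
  define R where "R n g g' \<longleftrightarrow> (\<exists>h. (\<forall>i\<in>{1..v}. h i \<in> carrier T \<and> (\<forall>e. absv (h i e) \<le> B / 2 ^ n)) \<and>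
      (\<forall>e. g e = g' e + comb h e))" for n :: nat and g g'
  have step: "\<exists>g'. P (Suc n) g' \<and> R n g g'" if "P n g" for n g
  proof -
    have g: "g \<in> carrier T" "taylor g = 0" "\<And>e. absv (g e) \<le> B / 2 ^ n"
      using that by (auto simp: P_def)
    obtain g' h where g': "g' \<in> carrier T" "\<forall>e. absv (g' e) \<le> max 0 (B / 2 ^ Suc n)"
      "\<forall>i\<in>{1..v}. h i \<in> carrier T \<and> (\<forall>e. absv (h i e) \<le> B / 2 ^ n)"
      "\<forall>e. g e = g' e + comb h e"
      using tate_approx[OF g(1,3), of 0 "B / 2 ^ Suc n"] g(2) bnd_zero[of 0] B(1) by auto
    have comb: "comb h \<in> I"
      using g'(3) by (intro comb_in_I) auto
    have "taylor g = taylor g' + taylor (comb h)"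
      using taylor_add[OF g'(1) I.Icarr[OF comb]] g'(4) by (metis (no_types, lifting) ext)
    then have "taylor g' = 0"
      using g(2) taylor_ideal[OF comb] by simp
    then show ?thesis
      unfolding P_def R_def using g' B(1) by (intro exI[of _ g']) auto
  qed
  have "\<exists>G. G 0 = f \<and> (\<forall>n. P n (G n) \<and> R n (G n) (G (Suc n)))"
  proof (rule exE[OF dependent_nat_choice[of "\<lambda>n g. P n g \<and> (n = 0 \<longrightarrow> g = f)" R]])
    show "\<exists>x. P 0 x \<and> (0 = 0 \<longrightarrow> x = f)"
      using f zero B by (auto simp: P_def)
  qed (use step in blast)+
  then obtain G where G: "G 0 = f" "\<And>n. P n (G n)" "\<And>n. R n (G n) (G (Suc n))"
    by blast
  obtain h where h: "\<And>n i. i \<in> {1..v} \<Longrightarrow> h n i \<in> carrier T"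
    "\<And>n i e. i \<in> {1..v} \<Longrightarrow> absv (h n i e) \<le> B / 2 ^ n"
    "\<And>n e. G n e = G (Suc n) e + comb (h n) e"
    using G(3) unfolding R_def by metis
  define H where "H i = (\<lambda>e. nsum (\<lambda>n. h n i e))" for i
  have "H i \<in> carrier T" if "i \<in> {1..v}" for i
    unfolding H_def using h that by (intro tate_nsum_closed[of _ B]) auto
  then have "comb H \<in> I"
    by (rule comb_in_I)
  moreover have "comb H e = f e" for e
  proof -
    have null: "null_family (\<lambda>n. h n i e')" if "i \<in> {1..v}" for i e'
      using h(2)[OF that] by (rule null_family_sequence)
    have "comb H e = (\<Sum>i\<in>{1..v}. \<Sum>(a, b) | a + b = e. nsum (\<lambda>n. h n i a * gen i b))"
      unfolding comb_def conv_def H_def using null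
      by (intro sum.cong refl) (auto simp: mult.commute nsum_cmult)
    also have "\<dots> = nsum (\<lambda>n. \<Sum>i\<in>{1..v}. \<Sum>(a, b) | a + b = e. h n i a * gen i b)"
      using null null_family_cmult[OF null]
      by (subst nsum_sum) (auto intro!: null_family_sum sum.cong nsum_sum[symmetric] simp: case_prod_unfold mult.commute)
    also have "\<dots> = nsum (\<lambda>n. G n e - G (Suc n) e)"
    proof -
      have "G n e - G (Suc n) e = comb (h n) e" for n
        using h(3)[of n e] by simp
      then show ?thesis
        by (simp add: comb_def conv_def)
    qed
    also have "\<dots> = G 0 e"
      using G(2) unfolding P_def by (intro nsum_telescope null_family_sequence[of _ B]) auto
    finally show ?thesis
      by (simp add: G(1))
  qed
  ultimately show ?thesis
    by (metis ext)
qed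

text \<open>A remainder \<phi> is close to q / den^N, and q is no larger than the bound of \<phi>,
  since multiplication by \<open>den\<close> does not enlarge \<phi>. Lifting q to the Tate algebra
  keeps this bound, so the lifts of all steps can be summed.\<close>

lemma taylor_surj:
  assumes "afun f"
  shows "\<exists>g\<in>carrier T. taylor g = f"
proof -
  obtain B where B: "0 < B" "bnd B f"
    using afun_bnd[OF assms] by blast
  define P where "P n \<phi> \<longleftrightarrow> afun \<phi> \<and> bnd (B / 2 ^ n) \<phi>" for n :: nat and \<phi>
  define R where "R n \<phi> \<phi>' \<longleftrightarrow> (\<exists>g. g \<in> carrier T \<and> (\<forall>e. absv (g e) \<le> B / 2 ^ n) \<and> \<phi> = \<phi>' + taylor g)"
    for n :: nat and \<phi> \<phi>'
  have step: "\<exists>\<phi>'. P (Suc n) \<phi>' \<and> R n \<phi> \<phi>'" if "P n \<phi>" for n \<phi>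
  proof -
    have \<phi>: "afun \<phi>" "bnd (B / 2 ^ n) \<phi>"
      using that by (auto simp: P_def)
    have "0 < B / 2 ^ Suc n"
      using B(1) by simp
    then obtain N q where q: "fpoly q" "bnd (B / 2 ^ Suc n) (\<phi> * den ^ N - q)"
      using \<phi>(1) unfolding afun_def by blast
    have "B / 2 ^ Suc n \<le> B / 2 ^ n"
      using B(1) by (simp add: field_simps)
    then have "bnd (B / 2 ^ n) (\<phi> * den ^ N - q)"
      using bnd_mono[OF q(2)] by blast
    with bnd_mult_right[OF \<phi>(2) bnd_power[OF bnd_den]]
    have "bnd (B / 2 ^ n) (\<phi> * den ^ N - (\<phi> * den ^ N - q))"
      by (rule bnd_diff)
    then have "bnd (B / 2 ^ n) q"
      by simp
    have "\<phi> - q * iden ^ N = (\<phi> * den ^ N - q) * iden ^ N"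
      by (simp add: left_diff_distrib mult.assoc den_iden_power)
    then have "bnd (B / 2 ^ Suc n) (\<phi> - taylor (lift N q))"
      using q by (simp only: taylor_lift) (intro bnd_mult_right bnd_power bnd_iden)
    then show ?thesis
      unfolding P_def R_def using lift_carrier[OF q(1)] absv_lift_le[OF \<open>bnd (B / 2 ^ n) q\<close>] \<phi>(1)
      by (intro exI[of _ "\<phi> - taylor (lift N q)"]) (auto intro: afun_taylor)
  qed
  have "\<exists>G. G 0 = f \<and> (\<forall>n. P n (G n) \<and> R n (G n) (G (Suc n)))"
  proof (rule exE[OF dependent_nat_choice[of "\<lambda>n g. P n g \<and> (n = 0 \<longrightarrow> g = f)" R]])
    show "\<exists>x. P 0 x \<and> (0 = 0 \<longrightarrow> x = f)"
      using assms B by (auto simp: P_def)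
  qed (use step in blast)+
  then obtain G where G: "G 0 = f" "\<And>n. P n (G n)" "\<And>n. R n (G n) (G (Suc n))"
    by blast
  obtain g where g: "\<And>n. g n \<in> carrier T" "\<And>n e. absv (g n e) \<le> B / 2 ^ n"
    "\<And>n. G n = G (Suc n) + taylor (g n)"
    using G(3) unfolding R_def by metis
  define H where "H = (\<lambda>e. nsum (\<lambda>n. g n e))"
  have "H \<in> carrier T"
    unfolding H_def using g by (intro tate_nsum_closed[of _ B]) auto
  moreover have "taylor H $ m = f $ m" for m
  proof -
    have null: "null_family (\<lambda>n. g n e)" for e
      using g(2) by (rule null_family_sequence)
    have "null_family (\<lambda>(n, e). g n e * mono e $ m)"
    proof (rule null_family_geometric[of _ B])
      show "null_family (\<lambda>e. g n e * mono e $ m)" for n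
        by (intro null_taylor_nth tate_null g)
      show "absv (g n e * mono e $ m) \<le> B / 2 ^ n" for n e
        using absv_mult_le[OF g(2) bndD[OF bnd_mono_fun]] by fastforce
    qed
    then have "nsum (\<lambda>n. nsum (\<lambda>e. g n e * mono e $ m)) = nsum (\<lambda>e. nsum (\<lambda>n. g n e * mono e $ m))"
      by (rule nsum_swap)
    also have "\<dots> = taylor H $ m"
    proof -
      have "nsum (\<lambda>n. g n e * mono e $ m) = nsum (\<lambda>n. g n e) * mono e $ m" for e
        using nsum_cmult[OF null, of "mono e $ m" e] by (simp add: mult.commute)
      then show ?thesis
        by (simp add: taylor_nth H_def)
    qed
    finally have "taylor H $ m = nsum (\<lambda>n. taylor (g n) $ m)"
      by (simp add: taylor_nth)
    also have "\<dots> = nsum (\<lambda>n. G n $ m - G (Suc n) $ m)"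
    proof -
      have "taylor (g n) $ m = G n $ m - G (Suc n) $ m" for n
        using arg_cong[OF g(3)[of n], of "\<lambda>f. f $ m"] by simp
      then show ?thesis
        by simp
    qed
    also have "\<dots> = G 0 $ m"
      using G(2) unfolding P_def by (intro nsum_telescope null_family_sequence[of _ B]) (auto simp: bnd_def)
    finally show ?thesis
      by (simp add: G(1))
  qed
  ultimately show ?thesis
    by (intro bexI[of _ H]) (auto intro: fps_ext)
qed


section \<open>Residue classes, the residue norm and convergent sums\<close>

abbreviation A :: "'k series set ring" where
  "A \<equiv> aff_ring absv v \<alpha>"

abbreviation cls :: "'k series \<Rightarrow> 'k series set" where
  "cls \<equiv> aff_class absv v \<alpha>"

lemma cls_eq: "cls f = I +>\<^bsub>T\<^esub> f"
  by (simp add: aff_class_def)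

lemma aff_cring: "cring A"
  unfolding aff_ring_def by (rule I.quotient_is_cring[OF tate_cring])

sublocale A: cring A
  by (rule aff_cring)

lemma cls_hom: "cls \<in> ring_hom T A"
  using I.rcos_ring_hom unfolding aff_ring_def cls_eq[abs_def] by simp

lemma cls_closed: "f \<in> carrier T \<Longrightarrow> cls f \<in> carrier A"
  using cls_hom by (auto simp: ring_hom_def)

lemma aff_carrierE:
  assumes "C \<in> carrier A"
  obtains f where "f \<in> carrier T" "C = cls f"
  using assms unfolding aff_ring_def FactRing_def A_RCOSETS_def' cls_eq by auto

lemma taylor_coset:
  assumes "f \<in> carrier T" "g \<in> cls f"
  shows "g \<in> carrier T" "taylor g = taylor f"
proof -
  obtain h where h: "h \<in> I" "g = (\<lambda>e. h e + f e)"
    using assms unfolding cls_eq a_r_coset_def' tate_add_eq by auto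
  show "g \<in> carrier T"
    using h assms(1) I.Icarr tate_add_closed by blast
  show "taylor g = taylor f"
    using h assms(1) taylor_ideal[OF h(1)] by (simp add: taylor_add I.Icarr)
qed

lemma coset_self: "f \<in> carrier T \<Longrightarrow> f \<in> cls f"
  unfolding cls_eq by (rule I.a_rcos_self)

text \<open>The Taylor series of a residue class. The choice of representative is immaterial because
  the ideal lies in the kernel of the Taylor map.\<close>

definition aval :: "'k series set \<Rightarrow> 'k fps" where
  "aval C = taylor (SOME f. f \<in> C)"

lemma aval_cls:
  assumes "f \<in> carrier T"
  shows "aval (cls f) = taylor f"
proof -
  have "(SOME g. g \<in> cls f) \<in> cls f"
    by (rule someI[of "\<lambda>g. g \<in> cls f", OF coset_self[OF assms]])
  then show ?thesis
    unfolding aval_def by (rule taylor_coset(2)[OF assms])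
qed

lemma cls_eqI:
  assumes "f \<in> carrier T" "g \<in> carrier T" "taylor f = taylor g"
  shows "cls f = cls g"
proof -
  have "f \<ominus>\<^bsub>T\<^esub> g \<in> I"
    using assms by (intro taylor_eq_0_imp_ideal) (auto simp: tate_minus_eq tate_diff_closed taylor_diff)
  then show ?thesis
    using T.quotient_eq_iff_same_a_r_cos[OF I_ideal assms(1,2)] by (simp add: cls_eq)
qed

text \<open>Rests on the closedness of the ideal: the kernel of the Taylor map is no larger than the
  ideal.\<close>

lemma aval_inj:
  assumes "C \<in> carrier A" "D \<in> carrier A" "aval C = aval D"
  shows "C = D"
proof -
  obtain f g where "f \<in> carrier T" "C = cls f" "g \<in> carrier T" "D = cls g"
    using assms(1,2) by (elim aff_carrierE)
  then show ?thesis
    using assms(3) cls_eqI[of f g] by (simp add: aval_cls)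
qed

lemma afun_aval: "C \<in> carrier A \<Longrightarrow> afun (aval C)"
  by (auto elim!: aff_carrierE simp: aval_cls afun_taylor)

lemma aval_surj:
  assumes "afun f"
  obtains C where "C \<in> carrier A" "aval C = f"
  using taylor_surj[OF assms] aval_cls cls_closed by blast

lemma aval_add:
  "C \<in> carrier A \<Longrightarrow> D \<in> carrier A \<Longrightarrow> aval (C \<oplus>\<^bsub>A\<^esub> D) = aval C + aval D"
  by (auto elim!: aff_carrierE
      simp: ring_hom_add[OF cls_hom, symmetric] aval_cls tate_add_closed tate_add_eq taylor_add)

lemma aval_mult:
  "C \<in> carrier A \<Longrightarrow> D \<in> carrier A \<Longrightarrow> aval (C \<otimes>\<^bsub>A\<^esub> D) = aval C * aval D"
  by (auto elim!: aff_carrierE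
      simp: ring_hom_mult[OF cls_hom, symmetric] aval_cls tate_mult_closed tate_mult_eq taylor_mult)

lemma aval_one: "aval \<one>\<^bsub>A\<^esub> = 1"
  by (simp add: ring_hom_one[OF cls_hom, symmetric] aval_cls tate_one_eq delta_carrier taylor_delta)

lemma aval_zero: "aval \<zero>\<^bsub>A\<^esub> = 0"
  by (metis A.l_zero A.zero_closed add_cancel_right_right aval_add)

lemma aval_uminus: "C \<in> carrier A \<Longrightarrow> aval (\<ominus>\<^bsub>A\<^esub> C) = - aval C"
  by (metis A.a_inv_closed A.r_neg aval_add aval_zero neg_eq_iff_add_eq_0)

lemma aval_minus:
  "C \<in> carrier A \<Longrightarrow> D \<in> carrier A \<Longrightarrow> aval (C \<ominus>\<^bsub>A\<^esub> D) = aval C - aval D"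
  by (simp add: a_minus_def aval_add aval_uminus)

lemma aval_finsum:
  "(\<And>i. i \<in> S \<Longrightarrow> s i \<in> carrier A) \<Longrightarrow> finite S \<Longrightarrow> aval (finsum A s S) = (\<Sum>i\<in>S. aval (s i))"
  by (induction S rule: infinite_finite_induct) (auto simp: aval_zero aval_add Pi_def)

lemma aval_add_pow: "C \<in> carrier A \<Longrightarrow> aval (add_pow A (n :: nat) C) = of_nat n * aval C"
  by (induction n) (auto simp: aval_zero aval_add A.add.nat_pow_Suc algebra_simps)

lemma gauss_norm_bdd: "f \<in> carrier T \<Longrightarrow> bdd_above (range (\<lambda>e. absv (f e)))"
  using null_family_bounded[OF tate_null] by (metis (no_types, lifting) bdd_above.I2)

lemma absv_le_gauss_norm: "f \<in> carrier T \<Longrightarrow> absv (f e) \<le> gauss_norm absv f"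
  unfolding gauss_norm_def by (rule cSUP_upper[OF UNIV_I gauss_norm_bdd])

lemma gauss_norm_le: "(\<And>e. absv (f e) \<le> r) \<Longrightarrow> gauss_norm absv f \<le> r"
  unfolding gauss_norm_def by (rule cSUP_least) auto

lemma gauss_norm_nonneg: "f \<in> carrier T \<Longrightarrow> 0 \<le> gauss_norm absv f"
  using absv_le_gauss_norm[of f 0] absv_nonneg[of "f 0"] by simp

lemma coset_carrier: "C \<in> carrier A \<Longrightarrow> f \<in> C \<Longrightarrow> f \<in> carrier T"
  by (auto elim!: aff_carrierE dest: taylor_coset(1))

lemma aval_coset: "C \<in> carrier A \<Longrightarrow> f \<in> C \<Longrightarrow> aval C = taylor f"
  by (auto elim!: aff_carrierE simp: aval_cls taylor_coset(2))

lemma coset_nonempty: "C \<in> carrier A \<Longrightarrow> C \<noteq> {}"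
  by (auto elim!: aff_carrierE dest: coset_self)

lemma aff_norm_bdd: "C \<in> carrier A \<Longrightarrow> bdd_below (gauss_norm absv ` C)"
  by (rule bdd_belowI[of _ 0]) (auto intro: gauss_norm_nonneg coset_carrier)

lemma bnd_aff_norm:
  assumes "C \<in> carrier A"
  shows "bnd (aff_norm absv C) (aval C)"
  unfolding bnd_def
proof
  fix n
  show "absv (aval C $ n) \<le> aff_norm absv C"
    unfolding aff_norm_def
  proof (rule cINF_greatest[OF coset_nonempty[OF assms]])
    fix f assume "f \<in> C"
    then have f: "f \<in> carrier T"
      using assms coset_carrier by blast
    have "bnd (gauss_norm absv f) (taylor f)"
      by (rule bnd_taylor[OF f]) (rule absv_le_gauss_norm[OF f])
    then show "absv (aval C $ n) \<le> gauss_norm absv f"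
      using aval_coset[OF assms \<open>f \<in> C\<close>] by (simp add: bndD)
  qed
qed

lemma aff_norm_nonneg: "C \<in> carrier A \<Longrightarrow> 0 \<le> aff_norm absv C"
  using bnd_nonneg[OF bnd_aff_norm] .

text \<open>For every \<epsilon> > 0 the class has a representative of norm at most max r
  \<epsilon>. Together with \<open>bnd_aff_norm\<close> this makes Taylor expansion isometric, so
  residue norms can be read off the coefficients.\<close>

lemma aff_norm_le:
  assumes "C \<in> carrier A" "bnd r (aval C)"
  shows "aff_norm absv C \<le> r"
proof -
  obtain f where f: "f \<in> carrier T" "C = cls f"
    using assms(1) by (rule aff_carrierE)
  obtain B where B: "\<And>e. absv (f e) \<le> B"
    using null_family_bounded[OF tate_null[OF f(1)]] by blast
  have *: "aff_norm absv C \<le> max r \<epsilon>" if "0 < \<epsilon>" for \<epsilon>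
  proof -
    have "bnd r (taylor f)"
      using assms(2) f by (simp add: aval_cls)
    from tate_approx[OF f(1) B this \<open>0 < \<epsilon>\<close>] obtain g h
      where g: "g \<in> carrier T" "\<forall>e. absv (g e) \<le> max r \<epsilon>"
        and h: "\<forall>i\<in>{1..v}. h i \<in> carrier T \<and> (\<forall>e. absv (h i e) \<le> B)"
          "\<forall>e. f e = g e + comb h e"
      by (elim exE conjE)
    have comb: "comb h \<in> I"
      using h(1) by (intro comb_in_I) auto
    have "f = (\<lambda>e. g e + comb h e)"
      using h(2) by blast
    then have "taylor f = taylor g"
      using taylor_add[OF g(1) I.Icarr[OF comb]] taylor_ideal[OF comb] by simp
    then have "g \<in> C"
      using cls_eqI[OF f(1) g(1)] coset_self[OF g(1)] f(2) by simp
    then have "aff_norm absv C \<le> gauss_norm absv g"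
      unfolding aff_norm_def by (rule cINF_lower[OF aff_norm_bdd[OF assms(1)]])
    also have "\<dots> \<le> max r \<epsilon>"
      using g(2) by (intro gauss_norm_le) auto
    finally show ?thesis .
  qed
  have "0 \<le> r"
    using assms(2) by (rule bnd_nonneg)
  show ?thesis
  proof (rule field_le_epsilon)
    fix \<epsilon> :: real assume "0 < \<epsilon>"
    then show "aff_norm absv C \<le> r + \<epsilon>"
      using *[of "r + \<epsilon>"] \<open>0 \<le> r\<close> by simp
  qed
qed

lemma aff_norm_le_iff: "C \<in> carrier A \<Longrightarrow> aff_norm absv C \<le> r \<longleftrightarrow> bnd r (aval C)"
  using aff_norm_le bnd_mono[OF bnd_aff_norm] by blast

lemma bnd_all_imp_zero:
  assumes "\<And>\<epsilon>. 0 < \<epsilon> \<Longrightarrow> bnd \<epsilon> f"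
  shows "f = 0"
  by (rule fps_ext) (use assms bndD zero_of_absv_le in fastforce)

text \<open>By isometry, uniform convergence of the Taylor series to \<open>fsum\<close> is
  convergence in the residue norm. A second limit would have the same expansion, hence be the same
  class, which justifies the definite description.\<close>

lemma aff_suminf:
  assumes s: "\<And>i. s i \<in> carrier A" and null: "null_fps (\<lambda>i. aval (s i))"
  shows "aff_suminf absv v \<alpha> s \<in> carrier A"
    and "aval (aff_suminf absv v \<alpha> s) = fsum (\<lambda>i. aval (s i))"
proof -
  let ?lim = "\<lambda>L. L \<in> carrier A \<and> (\<lambda>n. aff_norm absv (finsum A s {..<n} \<ominus>\<^bsub>A\<^esub> L)) \<longlonglongrightarrow> 0"
  have "afun (fsum (\<lambda>i. aval (s i)))"
    using null s by (intro afun_fsum afun_aval)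
  then obtain L where L: "L \<in> carrier A" "aval L = fsum (\<lambda>i. aval (s i))"
    by (rule aval_surj)
  have fs: "finsum A s {..<n} \<in> carrier A" for n
    using s by (intro A.finsum_closed) auto
  have av: "aval (finsum A s {..<n} \<ominus>\<^bsub>A\<^esub> M) = (\<Sum>i<n. aval (s i)) - aval M" if "M \<in> carrier A" for n M
    using s fs that by (simp add: aval_minus aval_finsum)
  have ev: "eventually (\<lambda>n. bnd \<epsilon> ((\<Sum>i<n. aval (s i)) - aval L)) sequentially" if "0 < \<epsilon>" for \<epsilon>
  proof -
    have "finite {i. \<not> bnd \<epsilon> (aval (s i))}"
      using null that by (rule null_fpsD)
    then obtain N where N: "{i. \<not> bnd \<epsilon> (aval (s i))} \<subseteq> {..<N}"
      by (meson finite_nat_iff_bounded)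
    have "bnd \<epsilon> ((\<Sum>i<n. aval (s i)) - aval L)" if "N \<le> n" for n
      unfolding L(2) using null \<open>0 < \<epsilon>\<close> N that
      by (intro fsum_approx) (auto dest!: subsetD)
    then show ?thesis
      unfolding eventually_sequentially by blast
  qed
  have lim: "?lim L"
  proof (intro conjI L(1) LIMSEQ_I)
    fix \<epsilon> :: real assume "0 < \<epsilon>"
    then obtain N where N: "\<And>n. N \<le> n \<Longrightarrow> bnd (\<epsilon> / 2) ((\<Sum>i<n. aval (s i)) - aval L)"
      using ev[of "\<epsilon> / 2"] unfolding eventually_sequentially by auto
    have "norm (aff_norm absv (finsum A s {..<n} \<ominus>\<^bsub>A\<^esub> L) - 0) < \<epsilon>" if "N \<le> n" for n
    proof -
      have "aff_norm absv (finsum A s {..<n} \<ominus>\<^bsub>A\<^esub> L) \<le> \<epsilon> / 2"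
        using N[OF that] L(1) fs by (intro aff_norm_le) (auto simp: av)
      moreover have "0 \<le> aff_norm absv (finsum A s {..<n} \<ominus>\<^bsub>A\<^esub> L)"
        using L(1) fs by (intro aff_norm_nonneg) auto
      ultimately show ?thesis
        using \<open>0 < \<epsilon>\<close> by simp
    qed
    then show "\<exists>N. \<forall>n\<ge>N. norm (aff_norm absv (finsum A s {..<n} \<ominus>\<^bsub>A\<^esub> L) - 0) < \<epsilon>"
      by blast
  qed
  have uniq: "M = L" if M: "?lim M" for M
  proof -
    have "bnd \<epsilon> (aval M - aval L)" if "0 < \<epsilon>" for \<epsilon>
    proof -
      have "eventually (\<lambda>n. aff_norm absv (finsum A s {..<n} \<ominus>\<^bsub>A\<^esub> M) < \<epsilon>) sequentially"
        by (rule order_tendstoD(2)[OF conjunct2[OF M] \<open>0 < \<epsilon>\<close>])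
      then have "eventually (\<lambda>n. aff_norm absv (finsum A s {..<n} \<ominus>\<^bsub>A\<^esub> M) < \<epsilon> \<and>
          bnd \<epsilon> ((\<Sum>i<n. aval (s i)) - aval L)) sequentially"
        using ev[OF \<open>0 < \<epsilon>\<close>] by (rule eventually_conj)
      then obtain n where n: "aff_norm absv (finsum A s {..<n} \<ominus>\<^bsub>A\<^esub> M) < \<epsilon>"
        "bnd \<epsilon> ((\<Sum>i<n. aval (s i)) - aval L)"
        by (auto dest: eventually_happens)
      have "bnd \<epsilon> (aval (finsum A s {..<n} \<ominus>\<^bsub>A\<^esub> M))"
        using n(1) M fs by (subst aff_norm_le_iff[symmetric]) auto
      then have "bnd \<epsilon> ((\<Sum>i<n. aval (s i)) - aval M)"
        using M by (simp add: av)
      from bnd_diff[OF n(2) this] show ?thesis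
        by simp
    qed
    then have "aval M - aval L = 0"
      by (rule bnd_all_imp_zero)
    then show ?thesis
      using M L(1) aval_inj by simp
  qed
  have "aff_suminf absv v \<alpha> s = L"
    unfolding aff_suminf_def Let_def by (rule the_equality[of ?lim, OF lim]) (rule uniq)
  then show "aff_suminf absv v \<alpha> s \<in> carrier A"
    and "aval (aff_suminf absv v \<alpha> s) = fsum (\<lambda>i. aval (s i))"
    using L by simp_all
qed


section \<open>The derivation on the affinoid algebra\<close>

lemma tate_pderiv_carrier:
  assumes "f \<in> carrier T"
  shows "tate_pderiv i f \<in> carrier T"
  unfolding tate_carrier_iff
proof (intro conjI allI impI)
  have null: "null_family (\<lambda>e. f (e + Poly_Mapping.single i 1))"
    by (rule null_family_inj[OF tate_null[OF assms]]) (auto intro: injI)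
  have "null_family (\<lambda>e. f (e + Poly_Mapping.single i 1) * of_nat (Poly_Mapping.lookup e i + 1))"
    by (rule null_family_mult_bounded[OF null absv_of_nat_le])
  then show "null_family (tate_pderiv i f)"
    by (simp add: tate_pderiv_def mult.commute)
  fix e assume "tate_pderiv i f e \<noteq> 0"
  then have "f (e + Poly_Mapping.single i 1) \<noteq> 0"
    by (auto simp: tate_pderiv_def)
  then have "Poly_Mapping.keys (e + Poly_Mapping.single i 1) \<subseteq> {0..v}"
    using assms by (simp add: tate_carrier_iff)
  then show "Poly_Mapping.keys e \<subseteq> {0..v}"
    by (auto simp: in_keys_iff lookup_add)
qed

lemma pole_deriv:
  assumes "i \<in> {1..v}"
  shows "fps_deriv (pole i) = - (pole i * pole i)"
proof -
  let ?l = "fps_X - fps_const (\<alpha> i)"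
  have "fps_deriv (?l * pole i) = 0"
    by (simp add: linear_pole[OF assms])
  then have "pole i * (pole i + ?l * fps_deriv (pole i)) = 0"
    by (simp add: add.commute)
  then have "pole i * pole i + (?l * pole i) * fps_deriv (pole i) = 0"
    by (simp add: algebra_simps)
  then show ?thesis
    by (simp add: linear_pole[OF assms] eq_neg_iff_add_eq_0 add.commute)
qed

text \<open>The product rule, with - \<open>pole i\<close>^2 as the derivative of
  \<open>pole i\<close>. If x has exponent 0, the truncated exponent is harmless because its factor
  is 0.\<close>

lemma mono_deriv:
  "fps_deriv (mono e) = of_nat (Poly_Mapping.lookup e 0) *
      (fps_X ^ (Poly_Mapping.lookup e 0 - 1) * (\<Prod>i\<in>{1..v}. pole i ^ Poly_Mapping.lookup e i)) -
    (\<Sum>i\<in>{1..v}. of_nat (Poly_Mapping.lookup e i) * (pole i * mono e))"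
proof -
  have pow: "fps_deriv (pole i ^ n) = - (of_nat n * (pole i * pole i ^ n))" if "i \<in> {1..v}" for i n
    by (induction n) (simp_all add: pole_deriv[OF that] algebra_simps)
  have X: "fps_deriv (fps_X ^ n :: 'k fps) = of_nat n * fps_X ^ (n - 1)" for n
  proof (induction n)
    case (Suc n)
    then show ?case
      by (cases n) (simp_all add: algebra_simps)
  qed simp
  have "fps_deriv (\<Prod>i\<in>S. pole i ^ Poly_Mapping.lookup e i) =
      - (\<Sum>i\<in>S. of_nat (Poly_Mapping.lookup e i) * (pole i * (\<Prod>i\<in>S. pole i ^ Poly_Mapping.lookup e i)))"
    if "S \<subseteq> {1..v}" for S
    using finite_subset[OF that finite_atLeastAtMost] that
  proof (induction S rule: finite_induct)
    case (insert i S)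
    let ?P = "\<Prod>i\<in>S. pole i ^ Poly_Mapping.lookup e i" and ?n = "Poly_Mapping.lookup e i"
    have "fps_deriv (pole i ^ ?n * ?P) = pole i ^ ?n * fps_deriv ?P + fps_deriv (pole i ^ ?n) * ?P"
      by simp
    also have "\<dots> = - (\<Sum>j\<in>S. of_nat (Poly_Mapping.lookup e j) * (pole j * (pole i ^ ?n * ?P)))
        - of_nat ?n * (pole i * (pole i ^ ?n * ?P))"
      using insert.IH insert.prems pow[of i ?n]
      by (simp add: sum_distrib_left mult_ac)
    finally show ?case
      using insert.hyps by simp
  qed simp
  from this[OF order.refl] show ?thesis
    unfolding mono_def by (simp add: X sum_distrib_left mult_ac)
qed

text \<open>Differentiation term by term. Raising the exponent at index i by one turns the
  coefficients of the i-th partial derivative into e_i f_e, and the exponents missed by this shift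
  have e_i = 0.\<close>

lemma taylor_deriv:
  assumes "f \<in> carrier T"
  shows "fps_deriv (taylor f) = taylor (tate_pderiv 0 f) -
    (\<Sum>i\<in>{1..v}. pole i * pole i * taylor (tate_pderiv i f))"
proof (rule fps_ext)
  fix n
  define M0 where "M0 e = of_nat (Poly_Mapping.lookup e 0) *
      (fps_X ^ (Poly_Mapping.lookup e 0 - 1) * (\<Prod>i\<in>{1..v}. pole i ^ Poly_Mapping.lookup e i))" for e
  define Mi where "Mi i e = of_nat (Poly_Mapping.lookup e i) * (pole i * mono e)" for i e
  have b0: "bnd 1 (M0 e)" for e
    unfolding M0_def by (intro bnd_of_nat_mult bnd_mult_left bnd_power bnd_X bnd_prod bnd_pole)
  have bi: "bnd 1 (Mi i e)" if "i \<in> {1..v}" for i e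
    unfolding Mi_def using that by (intro bnd_of_nat_mult bnd_mult_left bnd_pole bnd_mono_fun)
  have n0: "null_family (\<lambda>e. f e * M0 e $ n)"
    by (rule null_family_mult_bounded[OF tate_null[OF assms] bndD[OF b0]])
  have ni: "null_family (\<lambda>e. f e * Mi i e $ n)" if "i \<in> {1..v}" for i
    by (rule null_family_mult_bounded[OF tate_null[OF assms] bndD[OF bi[OF that]]])
  have shift: "nsum (\<lambda>e. f (e + Poly_Mapping.single i 1) * w (e + Poly_Mapping.single i 1)) = nsum (\<lambda>e. f e * w e)"
    if "\<And>e. Poly_Mapping.lookup e i = 0 \<Longrightarrow> w e = 0" "null_family (\<lambda>e. f e * w e)" for i and w :: "exponent \<Rightarrow> 'k"
  proof (rule nsum_reindex[of "\<lambda>e. e + Poly_Mapping.single i 1" "\<lambda>e. f e * w e"])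
    fix e :: exponent assume e: "e \<notin> range (\<lambda>e. e + Poly_Mapping.single i 1)"
    have "Poly_Mapping.lookup e i = 0"
    proof (rule ccontr)
      assume "Poly_Mapping.lookup e i \<noteq> 0"
      then have "e = (e - Poly_Mapping.single i 1) + Poly_Mapping.single i 1"
        by (intro poly_mapping_eqI) (auto simp: lookup_add lookup_minus lookup_single when_def)
      then show False
        using e by blast
    qed
    then show "f e * w e = 0"
      using that(1) by simp
  qed (use that in \<open>auto intro: injI\<close>)
  have t0: "taylor (tate_pderiv 0 f) $ n = nsum (\<lambda>e. f e * M0 e $ n)"
  proof -
    have t: "tate_pderiv 0 f e * mono e $ n =
        f (e + Poly_Mapping.single 0 1) * M0 (e + Poly_Mapping.single 0 1) $ n" for e
    proof -
      have "M0 (e + Poly_Mapping.single 0 1) = of_nat (Poly_Mapping.lookup e 0 + 1) * mono e"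
        unfolding M0_def mono_def
        by (intro arg_cong2[of _ _ _ _ "(*)"] prod.cong) (auto simp: lookup_add lookup_single)
      then show ?thesis
        by (simp add: tate_pderiv_def fps_of_nat[symmetric] del: fps_of_nat of_nat_add of_nat_Suc)
    qed
    show ?thesis
      unfolding taylor_nth t by (rule shift[OF _ n0]) (simp add: M0_def)
  qed
  have ti: "(pole i * pole i * taylor (tate_pderiv i f)) $ n = nsum (\<lambda>e. f e * Mi i e $ n)"
    if i: "i \<in> {1..v}" for i
  proof -
    have null: "null_family (tate_pderiv i f)"
      by (rule tate_null[OF tate_pderiv_carrier[OF assms]])
    have "(pole i * pole i * taylor (tate_pderiv i f)) $ n =
        (\<Sum>k=0..n. (pole i * pole i) $ k * nsum (\<lambda>e. tate_pderiv i f e * mono e $ (n - k)))"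
      by (simp add: fps_mult_nth[of "pole i * pole i"] taylor_nth)
    also have "\<dots> = (\<Sum>k=0..n. nsum (\<lambda>e. (pole i * pole i) $ k * (tate_pderiv i f e * mono e $ (n - k))))"
      by (intro sum.cong refl nsum_cmult[symmetric] null_taylor_nth null)
    also have "\<dots> = nsum (\<lambda>e. \<Sum>k=0..n. (pole i * pole i) $ k * (tate_pderiv i f e * mono e $ (n - k)))"
      by (intro nsum_sum[symmetric] null_family_cmult null_taylor_nth null)
    also have "\<dots> = nsum (\<lambda>e. tate_pderiv i f e * (pole i * pole i * mono e) $ n)"
      unfolding fps_mult_nth[of "pole i * pole i"] sum_distrib_left
      by (simp only: mult.left_commute)
    also have "\<dots> = nsum (\<lambda>e. f (e + Poly_Mapping.single i 1) * Mi i (e + Poly_Mapping.single i 1) $ n)"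
    proof (intro arg_cong[of _ _ nsum] ext)
      fix e
      have "Mi i (e + Poly_Mapping.single i 1) = of_nat (Poly_Mapping.lookup e i + 1) * (pole i * pole i * mono e)"
        unfolding Mi_def mono_add mono_single[OF i] by (simp add: lookup_add mult_ac)
      then show "tate_pderiv i f e * (pole i * pole i * mono e) $ n =
          f (e + Poly_Mapping.single i 1) * Mi i (e + Poly_Mapping.single i 1) $ n"
        by (simp add: tate_pderiv_def fps_of_nat[symmetric] del: fps_of_nat of_nat_add of_nat_Suc)
    qed
    also have "\<dots> = nsum (\<lambda>e. f e * Mi i e $ n)"
      by (rule shift[OF _ ni[OF i]]) (simp add: Mi_def)
    finally show ?thesis .
  qed
  have "fps_deriv (taylor f) $ n = nsum (\<lambda>e. of_nat (n + 1) * (f e * mono e $ (n + 1)))"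
    unfolding fps_deriv_nth taylor_nth
    by (rule nsum_cmult[symmetric, OF null_taylor_nth[OF tate_null[OF assms]]])
  also have "\<dots> = nsum (\<lambda>e. f e * M0 e $ n - (\<Sum>i\<in>{1..v}. f e * Mi i e $ n))"
  proof (intro arg_cong[of _ _ nsum] ext)
    fix e
    have "of_nat (n + 1) * (f e * mono e $ (n + 1)) = f e * fps_deriv (mono e) $ n"
      by simp
    also have "fps_deriv (mono e) = M0 e - (\<Sum>i\<in>{1..v}. Mi i e)"
      unfolding mono_deriv M0_def Mi_def ..
    finally show "of_nat (n + 1) * (f e * mono e $ (n + 1)) = f e * M0 e $ n - (\<Sum>i\<in>{1..v}. f e * Mi i e $ n)"
      by (simp add: fps_sum_nth right_diff_distrib sum_distrib_left)
  qed
  also have "\<dots> = nsum (\<lambda>e. f e * M0 e $ n) - (\<Sum>i\<in>{1..v}. nsum (\<lambda>e. f e * Mi i e $ n))"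
  proof -
    have "nsum (\<lambda>e. \<Sum>i\<in>{1..v}. f e * Mi i e $ n) = (\<Sum>i\<in>{1..v}. nsum (\<lambda>e. f e * Mi i e $ n))"
      by (rule nsum_sum) (rule ni)
    moreover have "null_family (\<lambda>e. \<Sum>i\<in>{1..v}. f e * Mi i e $ n)"
      by (rule null_family_sum) (rule ni)
    ultimately show ?thesis
      using nsum_diff[OF n0] by simp
  qed
  finally show "fps_deriv (taylor f) $ n = (taylor (tate_pderiv 0 f) -
      (\<Sum>i\<in>{1..v}. pole i * pole i * taylor (tate_pderiv i f))) $ n"
    using ti by (simp add: t0 fps_sum_nth)
qed

lemma taylor_finsum:
  assumes "finite S" "\<And>i. i \<in> S \<Longrightarrow> s i \<in> carrier T"
  shows "taylor (finsum T s S) = (\<Sum>i\<in>S. taylor (s i))"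
  using assms
proof (induction S rule: finite_induct)
  case empty
  then show ?case by (simp add: tate_zero_eq taylor_zero)
next
  case (insert i S)
  then have "finsum T s S \<in> carrier T" "finsum T s (insert i S) = s i \<oplus>\<^bsub>T\<^esub> finsum T s S"
    by (auto intro!: T.finsum_closed T.finsum_insert)
  then show ?case
    using insert by (simp add: tate_add_eq taylor_add)
qed

lemma tate_deriv:
  assumes "f \<in> carrier T"
  shows "tate_deriv absv v f \<in> carrier T" "taylor (tate_deriv absv v f) = fps_deriv (taylor f)"
proof -
  have car: "(tate_var i \<otimes>\<^bsub>T\<^esub> tate_var i) \<otimes>\<^bsub>T\<^esub> tate_pderiv i f \<in> carrier T" if "i \<in> {1..v}" for i
    using that tate_var_carrier[of i] tate_pderiv_carrier[OF assms] by auto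
  have tay: "taylor ((tate_var i \<otimes>\<^bsub>T\<^esub> tate_var i) \<otimes>\<^bsub>T\<^esub> tate_pderiv i f) =
      pole i * pole i * taylor (tate_pderiv i f)" if "i \<in> {1..v}" for i
    using that tate_var_carrier[of i] tate_pderiv_carrier[OF assms, of i]
    by (simp add: tate_mult_eq taylor_mult tate_mult_closed taylor_var)
  let ?S = "finsum T (\<lambda>i. (tate_var i \<otimes>\<^bsub>T\<^esub> tate_var i) \<otimes>\<^bsub>T\<^esub> tate_pderiv i f) {1..v}"
  have S: "?S \<in> carrier T"
    using car by (intro T.finsum_closed) auto
  show "tate_deriv absv v f \<in> carrier T"
    unfolding tate_deriv_def Let_def using S tate_pderiv_carrier[OF assms, of 0] by (rule T.minus_closed[rotated])
  have "taylor (tate_deriv absv v f) = taylor (tate_pderiv 0 f) - taylor ?S"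
    unfolding tate_deriv_def Let_def tate_minus_eq[OF S]
    by (rule taylor_diff[OF tate_pderiv_carrier[OF assms] S])
  also have "taylor ?S = (\<Sum>i\<in>{1..v}. pole i * pole i * taylor (tate_pderiv i f))"
    using car tay by (subst taylor_finsum) (auto intro!: sum.cong)
  finally show "taylor (tate_deriv absv v f) = fps_deriv (taylor f)"
    by (simp add: taylor_deriv[OF assms])
qed

text \<open>The derivatives of all representatives have the same expansion, so the union in the
  definition is a single class.\<close>

lemma aff_deriv:
  assumes "C \<in> carrier A"
  shows "aff_deriv absv v \<alpha> C \<in> carrier A" "aval (aff_deriv absv v \<alpha> C) = fps_deriv (aval C)"
proof -
  obtain f where f: "f \<in> carrier T" "C = cls f"
    using assms by (rule aff_carrierE)
  have "cls (tate_deriv absv v g) = cls (tate_deriv absv v f)" if "g \<in> C" for g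
    using taylor_coset[OF f(1)] that f by (intro cls_eqI) (auto simp: tate_deriv)
  then have "aff_deriv absv v \<alpha> C = cls (tate_deriv absv v f)"
    unfolding aff_deriv_def using coset_nonempty[OF assms] by auto
  then show "aff_deriv absv v \<alpha> C \<in> carrier A" "aval (aff_deriv absv v \<alpha> C) = fps_deriv (aval C)"
    using f by (simp_all add: cls_closed aval_cls tate_deriv)
qed

lemma aff_deriv_funpow:
  assumes "C \<in> carrier A"
  shows "(aff_deriv absv v \<alpha> ^^ m) C \<in> carrier A"
    "aval ((aff_deriv absv v \<alpha> ^^ m) C) = (fps_deriv ^^ m) (aval C)"
  using assms by (induction m) (auto simp: aff_deriv)

end

section \<open>Falling factorials and the absolute values of factorials\<close>

text \<open>The falling factorial, occurring as \<partial>^j x^t = \<open>ff t j\<close> x^(t-j) for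
  a scalar t.\<close>

definition ff :: "'a::comm_ring_1 \<Rightarrow> nat \<Rightarrow> 'a" where
  "ff t j = (\<Prod>i<j. t - of_nat i)"

lemma ff_0 [simp]: "ff t 0 = 1"
  by (simp add: ff_def)

lemma ff_Suc: "ff t (Suc j) = ff t j * (t - of_nat j)"
  by (simp add: ff_def mult.commute)

lemma ff_1 [simp]: "ff t (Suc 0) = t"
  by (simp add: ff_Suc)

lemma ff_add: "ff t (i + j) = ff t i * ff (t - of_nat i) j"
  by (induction j) (simp_all add: ff_Suc algebra_simps)

lemma ff_pochhammer: "ff t j = (- 1) ^ j * pochhammer (- t) j"
  by (induction j) (simp_all add: ff_Suc pochhammer_Suc algebra_simps)

text \<open>The Chu-Vandermonde identity. For powers of the coordinate it is the Leibniz rule, x and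
  y being the exponents of the two factors.\<close>

lemma ff_Vandermonde: "ff (x + y) i = (\<Sum>m\<le>i. of_nat (i choose m) * ff x m * ff y (i - m))"
proof -
  have "ff (x + y) i = (- 1) ^ i * (\<Sum>m\<le>i. of_nat (i choose m) * pochhammer (- x) m * pochhammer (- y) (i - m))"
    unfolding ff_pochhammer by (simp add: pochhammer_binomial_sum[symmetric])
  also have "\<dots> = (\<Sum>m\<le>i. of_nat (i choose m) * ff x m * ff y (i - m))"
    unfolding sum_distrib_left
  proof (intro sum.cong refl)
    fix m assume "m \<in> {..i}"
    then have "(- 1 :: 'a) ^ i = (- 1) ^ m * (- 1) ^ (i - m)"
      by (simp flip: power_add)
    then show "(- 1) ^ i * (of_nat (i choose m) * pochhammer (- x) m * pochhammer (- y) (i - m)) =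
        of_nat (i choose m) * ff x m * ff y (i - m)"
      by (simp add: ff_pochhammer mult_ac)
  qed
  finally show ?thesis .
qed

lemma ff_of_nat: "ff (of_nat n) m = of_nat (fact m * (n choose m))"
proof (induction m)
  case (Suc m)
  have "fact (Suc m) * (n choose Suc m) = fact m * (n choose m) * (n - m)"
    using binomial_absorb_comp[of n m] binomial_absorption[of m n]
    by (metis (no_types, lifting) fact_Suc mult.assoc mult.commute of_nat_id Suc_times_binomial_eq binomial_eq_0 binomial_absorb_comp)
  moreover have "(of_nat (n choose m) :: 'a) * (of_nat n - of_nat m) = of_nat ((n choose m) * (n - m))"
    by (cases "m \<le> n") (simp_all add: of_nat_diff binomial_eq_0)
  ultimately show ?case
    using Suc by (simp add: ff_Suc mult.assoc)
qed simp

lemma ff_of_int: "\<exists>w. ff (of_int z) j = of_int (int (fact j) * w)"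
proof -
  have "int (fact j) dvd ff z j"
    unfolding ff_pochhammer of_nat_fact by (intro dvd_mult fact_dvd_pochhammer)
  then obtain w where "ff z j = int (fact j) * w" ..
  moreover have "ff (of_int z) j = (of_int (ff z j) :: 'a)"
    by (simp add: ff_def)
  ultimately show ?thesis
    by auto
qed

lemma fact_add_prod: "fact (n + j) = fact n * (\<Prod>i\<in>{1..j}. n + i :: nat)"
  by (induction j) (simp_all add: algebra_simps)

context complete_discretely_valued_field
begin

abbreviation afact :: "nat \<Rightarrow> real" where
  "afact m \<equiv> absv (of_nat (fact m))"

lemma p_ge_2: "2 \<le> p"
  using prime_p by (rule prime_ge_2_nat)

lemma varpi_pos: "0 < varpi p"
  using p_ge_2 by (simp add: varpi_def)

lemma varpi_less_1: "varpi p < 1"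
  using p_ge_2 unfolding varpi_def by (intro powr_less_one) (auto simp: divide_simps)

lemma varpi_power: "varpi p ^ (p - 1) = 1 / real p"
proof -
  have "varpi p ^ (p - 1) = real p powr ((- 1 / (real p - 1)) * real (p - 1))"
    using powr_realpow[OF varpi_pos, of "p - 1"] unfolding varpi_def powr_powr by simp
  also have "(- 1 / (real p - 1)) * real (p - 1) = - 1"
    using p_ge_2 by (simp add: of_nat_diff)
  finally show ?thesis
    using p_ge_2 by (simp add: powr_minus inverse_eq_divide)
qed

lemma absv_of_nat_coprime:
  assumes "\<not> p dvd n"
  shows "absv (of_nat n) = 1"
proof -
  have "coprime (int n) (int p)"
    using prime_imp_coprime[OF prime_p assms] by (simp add: coprime_commute)
  then obtain u w where "u * int n + w * int p = 1"
    by (metis bezout_int coprime_imp_gcd_eq_1)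
  then have "(of_int (u * int n + w * int p) :: 'k) = 1"
    by simp
  then have *: "of_int u * of_nat n + of_int w * of_nat p = (1 :: 'k)"
    by simp
  have w: "absv (of_int w * of_nat p) < 1"
  proof -
    have "absv (of_int w * of_nat p) \<le> 1 * (1 / real p)"
      by (intro absv_mult_le absv_of_int_le) (simp add: absv_p)
    also have "\<dots> < 1"
      using p_ge_2 by simp
    finally show ?thesis .
  qed
  have "\<not> absv (of_nat n) < 1"
  proof
    assume n: "absv (of_nat n) < 1"
    have "absv (of_int u * of_nat n) \<le> 1 * absv (of_nat n)"
      by (intro absv_mult_le absv_of_int_le) simp
    with n w have "absv (of_int u * of_nat n + of_int w * of_nat p) < 1"
      by (intro absv_add_less) auto
    then show False
      unfolding * by simp
  qed
  then show ?thesis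
    using absv_of_nat_le[of n] by simp
qed

lemma absv_of_nat_mult_p: "absv (of_nat (p * n)) = absv (of_nat n) / real p"
  by (simp add: absv_mult absv_p)

lemma absv_of_nat_pos:
  assumes "0 < n"
  shows "0 < absv (of_nat n)"
  using assms
proof (induction n rule: less_induct)
  case (less n)
  show ?case
  proof (cases "p dvd n")
    case True
    then obtain k where k: "n = p * k" ..
    then have "0 < k" "k < n"
      using less.prems p_ge_2 by auto
    then show ?thesis
      unfolding k absv_of_nat_mult_p using less.IH[OF \<open>k < n\<close>] p_ge_2 by simp
  next
    case False
    then show ?thesis
      by (simp add: absv_of_nat_coprime)
  qed
qed

lemma afact_pos: "0 < afact m"
  by (rule absv_of_nat_pos) simp

lemma absv_of_nat_dvd_le: "m dvd n \<Longrightarrow> absv (of_nat n) \<le> absv (of_nat m)"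
proof (elim dvdE)
  fix k assume "n = m * k"
  then show "absv (of_nat n) \<le> absv (of_nat m)"
    using absv_mult_le[of "of_nat m" "absv (of_nat m)" "of_nat k" 1] absv_of_nat_le by simp
qed

lemma afact_Suc: "afact (Suc k) = absv (of_nat (Suc k)) * afact k"
  by (simp only: fact_Suc of_nat_mult absv_mult of_nat_id)

text \<open>The factors of (pk)! prime to p are units, and the multiples of p contribute p^k
  k!.\<close>

lemma afact_mult_p: "afact (p * k) = (1 / real p) ^ k * afact k"
proof (induction k)
  case (Suc k)
  obtain r where r: "p = Suc r"
    using p_ge_2 by (cases p) auto
  have "absv (of_nat (p * k + i)) = 1" if "i \<in> {1..r}" for i
  proof (rule absv_of_nat_coprime)
    have "\<not> p dvd i"
      using that r by (auto dest: dvd_imp_le)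
    then show "\<not> p dvd p * k + i"
      by (simp add: dvd_add_right_iff)
  qed
  then have *: "(\<Prod>i\<in>{1..r}. absv (of_nat (p * k + i))) = 1"
    by (intro prod.neutral) blast
  have "(\<Prod>i\<in>{1..p}. p * k + i) = (\<Prod>i\<in>{1..r}. p * k + i) * (p * Suc k)"
  proof -
    have "{1..p} = insert p {1..r}" "p \<notin> {1..r}"
      using r by auto
    then have "(\<Prod>i\<in>{1..p}. p * k + i) = (p * k + p) * (\<Prod>i\<in>{1..r}. p * k + i)"
      by (metis finite_atLeastAtMost prod.insert)
    then show ?thesis
      by (simp only: mult_Suc_right mult.commute add.commute)
  qed
  then have "fact (p * Suc k) = fact (p * k) * ((\<Prod>i\<in>{1..r}. p * k + i) * (p * Suc k) :: nat)"
    using fact_add_prod[of "p * k" p] by (simp only: mult_Suc_right add.commute of_nat_id)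
  then have "afact (p * Suc k) =
      afact (p * k) * ((\<Prod>i\<in>{1..r}. absv (of_nat (p * k + i))) * absv (of_nat (p * Suc k)))"
    by (simp only: of_nat_mult absv_mult of_nat_prod absv_prod)
  also have "\<dots> = afact (p * k) * (absv (of_nat (Suc k)) / real p)"
    unfolding * absv_of_nat_mult_p by simp
  also have "\<dots> = (1 / real p) ^ Suc k * afact (Suc k)"
    by (simp add: Suc afact_Suc del: fact_Suc of_nat_Suc)
  finally show ?case .
qed simp

text \<open>Legendre's formula up to a linear factor. With k = m div p one has |m!| \<le> |(pk)!| =
  p^(-k) |k!|, where p^(-k) = \<open>varpi p\<close>^((p-1)k). Rounding m down to pk costs at most
  one factor p, which the linear factor absorbs because pk \<le> m.\<close>

lemma afact_le: "afact m \<le> real p * max 1 (real m) * varpi p ^ m"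
proof (induction m rule: less_induct)
  case (less m)
  show ?case
  proof (cases "m < p")
    case True
    have "1 / real p \<le> varpi p ^ m"
      unfolding varpi_power[symmetric] using True varpi_pos varpi_less_1
      by (intro power_decreasing) auto
    then have "1 \<le> real p * varpi p ^ m"
      using p_ge_2 by (simp add: divide_le_eq mult.commute)
    also have "\<dots> \<le> real p * max 1 (real m) * varpi p ^ m"
      using varpi_pos by (intro mult_right_mono) (auto simp: mult_le_cancel_left1)
    finally show ?thesis
      using absv_of_nat_le order_trans by blast
  next
    case False
    define k r where "k = m div p" and "r = m mod p"
    have m: "m = p * k + r" and "r < p"
      using p_ge_2 by (auto simp: k_def r_def)
    have "0 < k"
      using False p_ge_2 by (simp add: k_def div_greater_zero_iff)
    then have "1 * k < p * k"
      using p_ge_2 by (intro mult_strict_right_mono) auto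
    then have "k < m"
      unfolding m by (simp only: mult_1 trans_less_add1)
    have "afact m \<le> afact (p * k)"
      unfolding m by (intro absv_of_nat_dvd_le fact_dvd) simp
    also have "\<dots> \<le> (1 / real p) ^ k * (real p * real k * varpi p ^ k)"
      unfolding afact_mult_p using less.IH[OF \<open>k < m\<close>] \<open>0 < k\<close>
      by (intro mult_left_mono) (auto simp: max_def)
    also have "\<dots> = real p * real k * varpi p ^ (p * k)"
    proof -
      have "varpi p ^ (p * k) = varpi p ^ ((p - 1) * k) * varpi p ^ k"
        using p_ge_2 by (simp flip: power_add) (simp add: algebra_simps)
      also have "varpi p ^ ((p - 1) * k) = (1 / real p) ^ k"
        unfolding power_mult varpi_power ..
      finally show ?thesis
        by (simp only: mult_ac)
    qed
    also have "\<dots> \<le> real p * real k * (real p * varpi p ^ m)"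
    proof -
      have "1 \<le> real p * varpi p ^ r"
      proof -
        have "1 / real p \<le> varpi p ^ r"
          unfolding varpi_power[symmetric] using \<open>r < p\<close> varpi_pos varpi_less_1
          by (intro power_decreasing) auto
        then show ?thesis
          using p_ge_2 by (simp add: divide_le_eq mult.commute)
      qed
      then have "varpi p ^ (p * k) * 1 \<le> varpi p ^ (p * k) * (real p * varpi p ^ r)"
        using varpi_pos by (intro mult_left_mono) auto
      then show ?thesis
        unfolding m by (intro mult_left_mono) (auto simp: power_add mult_ac)
    qed
    also have "\<dots> = real p * real (p * k) * varpi p ^ m"
      by simp
    also have "\<dots> \<le> real p * max 1 (real m) * varpi p ^ m"
      using varpi_pos unfolding m by (intro mult_right_mono mult_left_mono) auto
    finally show ?thesis .
  qed
qed

text \<open>The linear factor in the estimate of |m!| is absorbed by (\<open>varpi p\<close> / c)^m,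
  which decreases geometrically.\<close>

lemma afact_bound:
  assumes "varpi p < c"
  obtains C where "1 \<le> C" "\<And>m. afact m \<le> C * c ^ m"
proof -
  have c: "0 < c"
    using assms varpi_pos by linarith
  define x where "x = varpi p / c"
  have x: "0 < x" "x < 1"
    using assms varpi_pos c by (auto simp: x_def)
  have "(\<lambda>n. real n * x ^ n) \<longlonglongrightarrow> 0"
    using powser_times_n_limit_0[of x] x by simp
  then have "Bseq (\<lambda>n. real n * x ^ n)"
    by (intro convergent_imp_Bseq convergentI)
  then obtain K where K: "0 < K" "\<And>n. norm (real n * x ^ n) \<le> K"
    by (auto elim: BseqE)
  define C where "C = max 1 (real p * max 1 K)"
  have "afact m \<le> C * c ^ m" for m
  proof -
    have "max 1 (real m) * x ^ m \<le> max 1 K"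
    proof (cases "m = 0")
      case False
      then show ?thesis
        using K(2)[of m] x by (simp add: max_def)
    qed simp
    then have "real p * (max 1 (real m) * x ^ m) \<le> real p * max 1 K"
      by (rule mult_left_mono) simp
    also have "\<dots> \<le> C"
      unfolding C_def by simp
    finally have "real p * (max 1 (real m) * x ^ m) \<le> C" .
    then have "real p * (max 1 (real m) * x ^ m) * c ^ m \<le> C * c ^ m"
      using c by (intro mult_right_mono) auto
    moreover have "x ^ m * c ^ m = varpi p ^ m"
      using c by (simp add: x_def flip: power_mult_distrib)
    ultimately show ?thesis
      using afact_le[of m] by (simp add: mult.assoc)
  qed
  then show ?thesis
    using that[of C] by (simp add: C_def)
qed

text \<open>The exact value at prime powers calibrates the lower bound for falling factorials over
  blocks of length p^h.\<close>

lemma afact_prime_power: "afact (p ^ h) = varpi p ^ (p ^ h - 1)"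
proof (induction h)
  case (Suc h)
  have "1 \<le> p ^ h"
    using p_ge_2 by simp
  then have "(p - 1) * p ^ h + (p ^ h - 1) = p ^ Suc h - 1"
    using p_ge_2 by (simp add: diff_mult_distrib)
  then show ?case
    using afact_mult_p[of "p ^ h"] by (simp add: Suc varpi_power[symmetric] flip: power_mult power_add)
qed simp

lemma absv_p_power: "absv (of_nat (p ^ h)) = 1 / real p ^ h"
  by (simp add: absv_power absv_p power_one_over)

text \<open>\<open>Zlike\<close> holds exactly for the \<open>p\<close>-adic integers; it is the only property of them that is used.\<close>

definition Zlike :: "'k \<Rightarrow> bool" where
  "Zlike t \<longleftrightarrow> (\<forall>(m :: int) j. absv (ff (t + of_int m) j) \<le> afact j)"

lemma Zlike_shift: "Zlike t \<Longrightarrow> Zlike (t + of_int m)"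
  unfolding Zlike_def
proof (intro allI)
  fix k j assume "\<forall>(m :: int) j. absv (ff (t + of_int m) j) \<le> afact j"
  then have "absv (ff (t + of_int (m + k)) j) \<le> afact j"
    by blast
  then show "absv (ff (t + of_int m + of_int k) j) \<le> afact j"
    by (simp add: add.assoc)
qed

lemma ZlikeD: "Zlike t \<Longrightarrow> absv (ff t j) \<le> afact j"
  unfolding Zlike_def by (metis add.right_neutral of_int_0)

lemma absv_ff_of_int: "absv (ff (of_int z) j) \<le> afact j"
proof -
  obtain w :: int where "ff (of_int z) j = (of_int (int (fact j) * w) :: 'k)"
    using ff_of_int by blast
  then have "ff (of_int z) j = (of_nat (fact j) * of_int w :: 'k)"
    by (simp only: of_int_mult of_int_of_nat_eq)
  then show ?thesis
    using absv_mult_le[of "of_nat (fact j)" "afact j" "of_int w" 1] absv_of_int_le by simp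
qed

lemma Zlike_of_nat: "Zlike (of_nat n)"
  unfolding Zlike_def using absv_ff_of_int[of "int n + _"] by simp

text \<open>Falling factorials are polynomials with integer coefficients, hence 1-Lipschitz on the
  unit ball. The difference for j + 1 is (ff x j - ff y j) (x - j) + ff y j (x - y).\<close>

lemma absv_ff_diff_le:
  assumes "absv x \<le> 1" "absv y \<le> 1" "absv (x - y) \<le> \<epsilon>"
  shows "absv (ff x j - ff y j) \<le> \<epsilon>"
proof (induction j)
  case 0
  then show ?case
    using order_trans[OF absv_nonneg assms(3)] by simp
next
  case (Suc j)
  have "absv (ff y j) \<le> 1" for j
    using assms(2) absv_of_nat_le unfolding ff_def absv_prod
    by (intro prod_le_1) (auto intro: absv_diff_le absv_nonneg)
  then have "absv (ff y j * (x - y)) \<le> 1 * \<epsilon>"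
    using assms(3) by (intro absv_mult_le)
  moreover have "absv ((ff x j - ff y j) * (x - of_nat j)) \<le> \<epsilon> * 1"
    by (rule absv_mult_le[OF Suc absv_diff_le[OF assms(1) absv_of_nat_le]])
  ultimately have "absv ((ff x j - ff y j) * (x - of_nat j) + ff y j * (x - y)) \<le> \<epsilon>"
    by (intro absv_add_le) auto
  then show ?case
    by (simp add: ff_Suc algebra_simps)
qed

lemma padic_integers_iff: "t \<in> padic_integers absv \<longleftrightarrow> (\<forall>\<epsilon>>0. \<exists>z :: int. absv (t - of_int z) < \<epsilon>)"
proof -
  interpret M: Metric_space UNIV "\<lambda>a b. absv (a - b)"
    by (rule absv_Metric_space)
  show ?thesis
    unfolding padic_integers_def M.metric_closure_of by (auto simp: Ints_def)
qed

text \<open>At an integer z the falling factorial is divisible by j!. If z is closer to t than |j!|,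
  the Lipschitz bound carries the estimate over to t.\<close>

lemma Zlike_padic_integer:
  assumes "t \<in> padic_integers absv"
  shows "Zlike t"
  unfolding Zlike_def
proof (intro allI)
  fix m :: int and j
  obtain z :: int where z: "absv (t - of_int z) < afact j"
    using assms afact_pos padic_integers_iff by blast
  have le1: "afact j \<le> 1"
    by (rule absv_of_nat_le)
  have "absv (t - of_int z + of_int (z + m)) \<le> 1"
    using z le1 by (intro absv_add_le absv_of_int_le) auto
  then have 1: "absv (t + of_int m) \<le> 1"
    by simp
  have 2: "absv (of_int (z + m)) \<le> 1"
    by (rule absv_of_int_le)
  have "absv (ff (t + of_int m) j - ff (of_int (z + m)) j) \<le> afact j"
    using z by (intro absv_ff_diff_le 1 2) simp
  from absv_add_le[OF this absv_ff_of_int[of "z + m" j]]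
  show "absv (ff (t + of_int m) j) \<le> afact j"
    by simp
qed

text \<open>Let s be a point of the block nearest to t. Then |t - i| \<ge> |s - i| for all i in the
  block, and the product of |s - i| over i \<noteq> s is |s!| |(q-1-s)!|. This is at least |(q-1)!|,
  since s! (q-1-s)! divides (q-1)!.\<close>

lemma prod_block_ge:
  assumes "0 < q"
  obtains s where "s < q" "absv (t - of_nat s) * afact (q - 1) \<le> (\<Prod>i<q. absv (t - of_nat i))"
proof -
  have "finite ((\<lambda>i. absv (t - of_nat i)) ` {..<q})" "(\<lambda>i. absv (t - of_nat i)) ` {..<q} \<noteq> {}"
    using assms by auto
  from Min_in[OF this] obtain s where s: "s < q"
    "Min ((\<lambda>i. absv (t - of_nat i)) ` {..<q}) = absv (t - of_nat s)"
    by auto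
  have min: "absv (t - of_nat s) \<le> absv (t - of_nat i)" if "i < q" for i
    unfolding s(2)[symmetric] using that by (intro Min_le) auto
  have dist: "absv (of_nat i - of_nat s) \<le> absv (t - of_nat i)" if "i < q" for i
    using absv_diff_le[OF min[OF that] order.refl] by (simp add: algebra_simps)
  have "afact (q - 1) \<le> afact s * afact (q - 1 - s)"
  proof -
    have "s \<le> q - 1"
      using s(1) by simp
    from binomial_fact_lemma[OF this]
    have "fact s * fact (q - 1 - s) dvd (fact (q - 1) :: nat)"
      by (metis dvd_triv_left)
    from absv_of_nat_dvd_le[OF this] show ?thesis
      by (simp add: absv_mult)
  qed
  also have "afact s = (\<Prod>i<s. absv (of_nat i - of_nat s))"
  proof -
    have "afact s = absv (\<Prod>i<s. of_nat (s - i))"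
      by (simp add: fact_prod_rev atLeast0LessThan)
    also have "\<dots> = (\<Prod>i<s. absv (of_nat s - of_nat i))"
      unfolding absv_prod by (intro prod.cong) (auto simp: of_nat_diff)
    finally show ?thesis
      by (simp add: absv_diff_commute)
  qed
  also have "afact (q - 1 - s) = (\<Prod>i\<in>{s<..<q}. absv (of_nat i - of_nat s))"
  proof -
    have "afact (q - 1 - s) = (\<Prod>i\<in>{1..q - 1 - s}. absv (of_nat i))"
      by (simp add: fact_prod absv_prod)
    also have "\<dots> = (\<Prod>i\<in>{s<..<q}. absv (of_nat i - of_nat s))"
      by (rule prod.reindex_bij_witness[of _ "\<lambda>i. i - s" "\<lambda>i. i + s"]) (auto simp: of_nat_diff)
    finally show ?thesis .
  qed
  also have "(\<Prod>i<s. absv (of_nat i - of_nat s)) * (\<Prod>i\<in>{s<..<q}. absv (of_nat i - of_nat s)) =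
      (\<Prod>i\<in>{..<q} - {s}. absv (of_nat i - of_nat s))"
    using s(1) by (subst prod.union_disjoint[symmetric]) (auto intro!: prod.cong)
  also have "\<dots> \<le> (\<Prod>i\<in>{..<q} - {s}. absv (t - of_nat i))"
    using dist by (intro prod_mono) (auto simp: absv_nonneg)
  finally have "absv (t - of_nat s) * afact (q - 1) \<le>
      absv (t - of_nat s) * (\<Prod>i\<in>{..<q} - {s}. absv (t - of_nat i))"
    by (intro mult_left_mono absv_nonneg)
  also have "\<dots> = (\<Prod>i<q. absv (t - of_nat i))"
    using s(1) by (subst (2) prod.remove[of _ s]) auto
  finally show ?thesis
    using that s(1) by blast
qed

text \<open>Away from the \<open>p\<close>-adic integers, the average of \<open>log \<bar>t - i\<bar>\<close> over a block of \<open>p\<^sup>h\<close>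
  consecutive integers \<open>i\<close> exceeds that of \<open>log \<bar>i\<bar>\<close>.\<close>

lemma absv_ff_ge:
  assumes "t \<notin> padic_integers absv"
  obtains c B where "varpi p < c" "c < 1" "0 < B" "\<And>n. c ^ n \<le> B * absv (ff t n)"
proof -
  obtain \<delta>0 where \<delta>0: "0 < \<delta>0" "\<And>z :: int. \<delta>0 \<le> absv (t - of_int z)"
    using assms unfolding padic_integers_iff by (meson not_less)
  define \<delta> where "\<delta> = min 1 \<delta>0"
  have \<delta>: "0 < \<delta>" "\<delta> \<le> 1" "\<And>z :: int. \<delta> \<le> absv (t - of_int z)"
    using \<delta>0 by (auto simp: \<delta>_def min_le_iff_disj)
  have \<delta>n: "\<delta> \<le> absv (t - of_nat i)" for i
    using \<delta>(3)[of "int i"] by simp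
  \<comment> \<open>\<open>\<delta>\<close> is a lower bound for the distance from t to the
    integers, and q = p^h is chosen with \<delta> p^h > 1. As |q!| = p^(-h) |(q-1)!| =
    \<open>varpi p\<close>^(q-1), a product over a block is at least \<delta> |(q-1)!| = \<delta>
    p^h \<open>varpi p\<close>^(q-1), so q factors cost at most q - 1 powers of
    \<open>varpi p\<close>.\<close>
  obtain h where h: "1 / \<delta> < real p ^ h"
    using real_arch_pow[of "real p" "1 / \<delta>"] p_ge_2 by auto
  define q where "q = p ^ h"
  have "0 < q"
    using p_ge_2 by (simp add: q_def)
  have q1: "varpi p ^ (q - 1) \<le> \<delta> * afact (q - 1)"
  proof -
    have "afact q = absv (of_nat q) * afact (q - 1)"
      using \<open>0 < q\<close> by (cases q) (simp_all add: afact_Suc del: fact_Suc of_nat_Suc)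
    then have "varpi p ^ (q - 1) * real p ^ h = afact (q - 1)"
      using afact_prime_power[of h] absv_p_power[of h] p_ge_2 unfolding q_def by (simp add: field_simps)
    moreover have "varpi p ^ (q - 1) * 1 \<le> varpi p ^ (q - 1) * (\<delta> * real p ^ h)"
      using h \<delta>(1) varpi_pos by (intro mult_left_mono) (auto simp: field_simps)
    ultimately show ?thesis
      by (simp add: mult_ac)
  qed
  have block: "varpi p ^ (q - 1) \<le> (\<Prod>i<q. absv (t - of_nat m - of_nat i))" for m
  proof -
    obtain s where s: "absv (t - of_nat m - of_nat s) * afact (q - 1) \<le> (\<Prod>i<q. absv (t - of_nat m - of_nat i))"
      using prod_block_ge[OF \<open>0 < q\<close>, of "t - of_nat m"] by blast
    have "\<delta> * afact (q - 1) \<le> absv (t - of_nat m - of_nat s) * afact (q - 1)"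
      using \<delta>n[of "m + s"] by (intro mult_right_mono absv_nonneg) (simp add: algebra_simps)
    then show ?thesis
      using q1 s by linarith
  qed
  have blocks: "(varpi p ^ (q - 1)) ^ k \<le> absv (ff t (q * k))" for k
  proof (induction k)
    case (Suc k)
    have "(varpi p ^ (q - 1)) ^ k * varpi p ^ (q - 1) \<le>
        absv (ff t (q * k)) * (\<Prod>i<q. absv (t - of_nat (q * k) - of_nat i))"
      using Suc block[of "q * k"] varpi_pos
      by (intro mult_mono) (auto simp: absv_nonneg simp del: of_nat_mult)
    also have "\<dots> = absv (ff t (q * Suc k))"
      using ff_add[of t "q * k" q] by (simp add: absv_mult ff_def absv_prod add.commute)
    finally show ?case
      by (simp add: mult.commute)
  qed simp
  \<comment> \<open>Spreading q - 1 powers of \<open>varpi p\<close> over q factors gives a rate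
    above \<open>varpi p\<close>.\<close>
  define c where "c = varpi p powr (real (q - 1) / real q)"
  have "0 < c"
    using varpi_pos by (simp add: c_def)
  have exp: "real (q - 1) / real q < 1"
    using \<open>0 < q\<close> by (simp add: of_nat_diff divide_simps)
  have "varpi p powr 1 < c"
    unfolding c_def using varpi_pos varpi_less_1 exp by (intro powr_less_mono') auto
  then have c1: "varpi p < c"
    using varpi_pos by simp
  have cq: "c ^ q = varpi p ^ (q - 1)"
    using \<open>0 < q\<close> varpi_pos \<open>0 < c\<close> unfolding c_def
    by (simp add: powr_realpow[symmetric] powr_powr)
  have "c \<le> 1"
    unfolding c_def using varpi_pos varpi_less_1 by (intro powr_le1) auto
  have main: "c ^ n \<le> (1 / \<delta> ^ q) * absv (ff t n)" for n
  proof -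
    define k r where "k = n div q" and "r = n mod q"
    have n: "n = q * k + r" and "r < q"
      using \<open>0 < q\<close> by (auto simp: k_def r_def)
    have "\<delta> ^ q \<le> \<delta> ^ r"
      using \<delta>(1,2) \<open>r < q\<close> by (intro power_decreasing) auto
    also have "\<dots> = (\<Prod>i<r. \<delta>)"
      by simp
    also have "\<dots> \<le> absv (ff (t - of_nat (q * k)) r)"
      unfolding ff_def absv_prod using \<delta>(1) \<delta>n[of "q * k + _"]
      by (intro prod_mono) (auto simp: algebra_simps)
    finally have "(varpi p ^ (q - 1)) ^ k * \<delta> ^ q \<le> absv (ff t (q * k)) * absv (ff (t - of_nat (q * k)) r)"
      using blocks[of k] \<delta>(1) by (intro mult_mono) (auto simp: absv_nonneg)
    also have "\<dots> = absv (ff t n)"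
      unfolding n ff_add absv_mult ..
    finally have "c ^ (q * k) * \<delta> ^ q \<le> absv (ff t n)"
      by (simp add: power_mult cq)
    moreover have "c ^ n * \<delta> ^ q \<le> c ^ (q * k) * \<delta> ^ q"
      unfolding n using \<open>0 < c\<close> \<open>c \<le> 1\<close> \<delta>(1) by (intro mult_right_mono power_decreasing) auto
    ultimately have "c ^ n * \<delta> ^ q \<le> absv (ff t n)"
      by linarith
    then show ?thesis
      using \<delta>(1) by (simp add: field_simps)
  qed
  \<comment> \<open>Passing to the midpoint makes the rate strictly smaller than 1 and keeps it
    above \<open>varpi p\<close>.\<close>
  define c' where "c' = (varpi p + c) / 2"
  have "varpi p < c'" "c' < c"
    using c1 by (auto simp: c'_def)
  have "c' ^ n \<le> (1 / \<delta> ^ q) * absv (ff t n)" for n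
    using main[of n] power_mono[of c' c n] \<open>varpi p < c'\<close> \<open>c' < c\<close> varpi_pos by linarith
  then show ?thesis
    using that[of c' "1 / \<delta> ^ q"] \<open>varpi p < c'\<close> \<open>c' < c\<close> \<open>c \<le> 1\<close> \<delta>(1) by simp
qed

section \<open>Differential operators of infinite order and their symbols\<close>

lemma power_small:
  fixes \<rho> D \<epsilon> :: real
  assumes "0 \<le> \<rho>" "\<rho> < 1" "0 < \<epsilon>"
  obtains N where "\<And>n. N \<le> n \<Longrightarrow> D * \<rho> ^ n < \<epsilon>"
proof -
  have "(\<lambda>n. D * \<rho> ^ n) \<longlonglongrightarrow> D * 0"
    using assms by (intro tendsto_mult LIMSEQ_power_zero) auto
  then have "eventually (\<lambda>n. D * \<rho> ^ n < \<epsilon>) sequentially"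
    using assms(3) by (intro order_tendstoD(2)) auto
  then show ?thesis
    using that by (auto simp: eventually_sequentially)
qed

lemma null_fps_geometric:
  fixes s :: "nat \<Rightarrow> 'k fps"
  assumes "0 \<le> \<rho>" "\<rho> < 1" "\<And>i. bnd (D * \<rho> ^ (i - k)) (s i)"
  shows "null_fps s"
  unfolding null_fps_def
proof (intro allI impI)
  fix \<epsilon> :: real assume "0 < \<epsilon>"
  obtain N where N: "\<And>n. N \<le> n \<Longrightarrow> D * \<rho> ^ n < \<epsilon>"
    using power_small[OF assms(1,2) \<open>0 < \<epsilon>\<close>, where D = D] by blast
  have "i < N + k" if "\<not> bnd \<epsilon> (s i)" for i
  proof (rule ccontr)
    assume "\<not> i < N + k"
    then have "N \<le> i - k"
      by linarith
    then have "D * \<rho> ^ (i - k) \<le> \<epsilon>"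
      using N[of "i - k"] by simp
    then show False
      using bnd_mono[OF assms(3)] that by blast
  qed
  then have "{i. \<not> bnd \<epsilon> (s i)} \<subseteq> {..<N + k}"
    by auto
  then show "finite {i. \<not> bnd \<epsilon> (s i)}"
    using finite_subset by blast
qed

text \<open>Made for the sums behind the product formula: i and l are orders of differentiation,
  along which there is geometric decay, and x runs over finitely many relevant values for each
  pair.\<close>

lemma null_family_box:
  fixes f :: "(nat \<times> nat) \<times> 'x \<Rightarrow> 'k"
  assumes "0 \<le> \<rho>" "\<rho> < 1" "\<And>i l x. absv (f ((i, l), x)) \<le> D * \<rho> ^ (i + l)"
    and "\<And>i l. finite {x. f ((i, l), x) \<noteq> 0}"
  shows "null_family f"
  unfolding null_family_def
proof (intro allI impI)
  fix \<epsilon> :: real assume "0 < \<epsilon>"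
  obtain N where N: "\<And>n. N \<le> n \<Longrightarrow> D * \<rho> ^ n < \<epsilon>"
    using power_small[OF assms(1,2) \<open>0 < \<epsilon>\<close>, where D = D] by blast
  have "i + l < N" "f ((i, l), x) \<noteq> 0" if "\<epsilon> \<le> absv (f ((i, l), x))" for i l x
  proof -
    show "i + l < N"
    proof (rule ccontr)
      assume "\<not> i + l < N"
      then show False
        using N[of "i + l"] assms(3)[of i l x] that by simp
    qed
    show "f ((i, l), x) \<noteq> 0"
      using that \<open>0 < \<epsilon>\<close> by auto
  qed
  then have "{q. \<epsilon> \<le> absv (f q)} \<subseteq> Sigma ({..<N} \<times> {..<N}) (\<lambda>(i, l). {x. f ((i, l), x) \<noteq> 0})"
    by fastforce
  moreover have "finite \<dots>"
    using assms(4) by auto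
  ultimately show "finite {q. \<epsilon> \<le> absv (f q)}"
    by (rule finite_subset)
qed

text \<open>Boundedness of |a_j| c^j in place of convergence to 0. In the union over c >
  \<open>varpi p\<close> both conditions give the same operators, and an explicit bound is easier to
  carry through estimates.\<close>

definition nb :: "real \<Rightarrow> real \<Rightarrow> (nat \<Rightarrow> 'k fps) \<Rightarrow> bool" where
  "nb c B a \<longleftrightarrow> (\<forall>j. bnd (B / c ^ j) (a j))"

lemma nbD: "nb c B a \<Longrightarrow> bnd (B / c ^ j) (a j)"
  by (simp add: nb_def)

lemma nb_nonneg: "nb c B a \<Longrightarrow> 0 \<le> B"
  by (metis bnd_nonneg nbD div_by_1 power_0)

lemma nb_mono: "nb c B a \<Longrightarrow> B \<le> B' \<Longrightarrow> 0 < c' \<Longrightarrow> c' \<le> c \<Longrightarrow> nb c' B' a"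
  unfolding nb_def
proof
  fix j assume *: "\<forall>j. bnd (B / c ^ j) (a j)" "B \<le> B'" "0 < c'" "c' \<le> c"
  then have "0 \<le> B"
    using nb_nonneg nb_def by blast
  then have "B / c ^ j \<le> B' / c' ^ j"
    using * by (intro frac_le power_mono) auto
  then show "bnd (B' / c' ^ j) (a j)"
    using * bnd_mono by blast
qed

definition pterm :: "(nat \<Rightarrow> 'k fps) \<Rightarrow> (nat \<Rightarrow> 'k fps) \<Rightarrow> nat \<Rightarrow> nat \<Rightarrow> 'k fps" where
  "pterm a b k i =
    a i * (\<Sum>m | m \<le> i \<and> i \<le> k + m. of_nat (i choose m) * (fps_deriv ^^ m) (b (k + m - i)))"

definition pmul :: "(nat \<Rightarrow> 'k fps) \<Rightarrow> (nat \<Rightarrow> 'k fps) \<Rightarrow> nat \<Rightarrow> 'k fps" where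
  "pmul a b k = fsum (pterm a b k)"

definition pone :: "nat \<Rightarrow> 'k fps" where
  "pone j = (if j = 0 then 1 else 0)"

text \<open>The m derivations on b gain |m!| = O(c1^m), while the orders of the two coefficients
  contribute c^(-i) and c^(-(k+m-i)), together c^(-k-m). Since m \<ge> i - k, the factor (c1 / c)^m
  decays geometrically in i.\<close>

lemma bnd_pterm:
  assumes a: "nb c B a" and b: "nb c B' b" and c: "0 < c1" "c1 \<le> c"
    and C: "\<And>m. afact m \<le> C * c1 ^ m"
  shows "bnd (C * B * B' / c ^ k * (c1 / c) ^ (i - k)) (pterm a b k i)"
proof -
  have C0: "0 \<le> C"
    using C[of 0] by simp
  have c0: "0 < c"
    using c by simp
  have B0: "0 \<le> B" "0 \<le> B'"
    using a b nb_nonneg by blast+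
  have "bnd (C * B * B' / c ^ k * (c1 / c) ^ (i - k))
      (a i * (of_nat (i choose m) * (fps_deriv ^^ m) (b (k + m - i))))"
    if m: "m \<le> i" "i \<le> k + m" for m
  proof (rule bnd_mono)
    show "bnd (B / c ^ i * (C * c1 ^ m * (B' / c ^ (k + m - i))))
        (a i * (of_nat (i choose m) * (fps_deriv ^^ m) (b (k + m - i))))"
      using B0 c0 C[of m]
      by (intro bnd_mult nbD[OF a] bnd_of_nat_mult bnd_mono[OF bnd_deriv_funpow[OF nbD[OF b]]]
          mult_right_mono) auto
    have "c ^ k * c ^ m = c ^ i * c ^ (k + m - i)"
      using m by (simp flip: power_add)
    then have "B / c ^ i * (C * c1 ^ m * (B' / c ^ (k + m - i))) = C * B * B' / c ^ k * (c1 / c) ^ m"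
      using c0 by (simp add: field_simps power_divide)
    also have "\<dots> \<le> C * B * B' / c ^ k * (c1 / c) ^ (i - k)"
      using m c c0 B0 C0 by (intro mult_left_mono power_decreasing) auto
    finally show "B / c ^ i * (C * c1 ^ m * (B' / c ^ (k + m - i))) \<le>
        C * B * B' / c ^ k * (c1 / c) ^ (i - k)" .
  qed
  then show ?thesis
    unfolding pterm_def sum_distrib_left using B0 C0 c0 c(1) by (intro bnd_sum) auto
qed

text \<open>\<open>C\<close> depends on c alone. Bounds are submultiplicative only up to this
  factor, which the Neumann series has to take into account.\<close>

lemma pmul_bound:
  assumes "varpi p < c"
  obtains C where "1 \<le> C"
    "\<And>a b B B'. nb c B a \<Longrightarrow> nb c B' b \<Longrightarrow> nb c (C * B * B') (pmul a b)"
    "\<And>a b B B' k. nb c B a \<Longrightarrow> nb c B' b \<Longrightarrow> null_fps (pterm a b k)"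
proof -
  define c1 where "c1 = (varpi p + c) / 2"
  have c1: "varpi p < c1" "c1 < c" "0 < c1"
    using assms varpi_pos by (auto simp: c1_def)
  obtain C where C: "1 \<le> C" "\<And>m. afact m \<le> C * c1 ^ m"
    using afact_bound[OF c1(1)] by blast
  have null: "null_fps (pterm a b k)" if "nb c B a" "nb c B' b" for a b B B' k
    using c1 bnd_pterm[OF that c1(3) less_imp_le[OF c1(2)] C(2)]
    by (intro null_fps_geometric[of "c1 / c" "C * B * B' / c ^ k" k]) auto
  have "nb c (C * B * B') (pmul a b)" if "nb c B a" "nb c B' b" for a b B B'
    unfolding nb_def
  proof
    fix k
    have 0: "0 \<le> C * B * B' / c ^ k"
      using C(1) c1 nb_nonneg[OF that(1)] nb_nonneg[OF that(2)] by simp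
    have "C * B * B' / c ^ k * (c1 / c) ^ (i - k) \<le> C * B * B' / c ^ k * 1" for i
      using c1 0 by (intro mult_left_mono power_le_one) auto
    then show "bnd (C * B * B' / c ^ k) (pmul a b k)"
      unfolding pmul_def using bnd_pterm[OF that c1(3) less_imp_le[OF c1(2)] C(2)] 0 bnd_mono
      by (intro bnd_fsum null[OF that]) (metis mult.right_neutral)+
  qed
  then show ?thesis
    using that[of C] C(1) null by blast
qed

text \<open>Coefficients at integer positions, extended by 0, so that a shift of exponents may be
  negative.\<close>

definition cf :: "'k fps \<Rightarrow> int \<Rightarrow> 'k" where
  "cf f z = (if z < 0 then 0 else f $ nat z)"

lemma absv_cf_le: "bnd r f \<Longrightarrow> absv (cf f z) \<le> r"
  using bnd_nonneg[of r f] by (simp add: cf_def bndD)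

lemma cf_add: "cf (f + g) z = cf f z + cf g z"
  by (simp add: cf_def)

lemma cf_diff: "cf (f - g) z = cf f z - cf g z"
  by (simp add: cf_def)

lemma cf_zero [simp]: "cf 0 z = 0"
  by (simp add: cf_def)

text \<open>The symbol records the action on powers: \<open>a x\<^sup>t = \<Sum>\<^sub>n sym a t n x\<^bsup>t+n\<^esup>\<close>.\<close>

definition sym :: "(nat \<Rightarrow> 'k fps) \<Rightarrow> 'k \<Rightarrow> int \<Rightarrow> 'k" where
  "sym a t n = nsum (\<lambda>j. ff t j * cf (a j) (n + int j))"

lemma sym_term_le:
  assumes "nb c B a" "Zlike t" "0 < c1" "c1 \<le> c" "\<And>m. afact m \<le> C * c1 ^ m"
  shows "absv (ff t j * cf (a j) n) \<le> C * B * (c1 / c) ^ j"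
proof -
  have "absv (ff t j * cf (a j) n) \<le> (C * c1 ^ j) * (B / c ^ j)"
    using order_trans[OF ZlikeD[OF assms(2)] assms(5)] absv_cf_le[OF nbD[OF assms(1)]]
    by (rule absv_mult_le)
  then show ?thesis
    by (simp add: power_divide mult_ac)
qed

text \<open>An intermediate radius: |m!| is O(c1^m) for c1 between \<open>varpi p\<close> and c, and
  \<rho> = c1 / c remains as the rate of convergence.\<close>

lemma nb_split:
  assumes "varpi p < c"
  obtains c1 C \<rho> where "0 < c1" "c1 \<le> c" "\<And>m. afact m \<le> C * c1 ^ m" "1 \<le> C" "\<rho> = c1 / c" "0 \<le> \<rho>" "\<rho> < 1"
proof -
  define c1 where "c1 = (varpi p + c) / 2"
  have c1: "varpi p < c1" "c1 < c" "0 < c1"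
    using assms varpi_pos by (auto simp: c1_def)
  obtain C where C: "1 \<le> C" "\<And>m. afact m \<le> C * c1 ^ m"
    using afact_bound[OF c1(1)] by blast
  show ?thesis
    using that[of c1 C "c1 / c"] c1 C by auto
qed

lemma null_sym:
  assumes "nb c B a" "varpi p < c" "Zlike t"
  shows "null_family (\<lambda>j. ff t j * cf (a j) (n + int j))"
proof -
  obtain c1 C \<rho> where *: "0 < c1" "c1 \<le> c" "\<And>m. afact m \<le> C * c1 ^ m" "1 \<le> C" "\<rho> = c1 / c" "0 \<le> \<rho>" "\<rho> < 1"
    using nb_split[OF assms(2)] by blast
  have "null_fps (\<lambda>j. fps_const (ff t j * cf (a j) (n + int j)))"
    using * sym_term_le[OF assms(1,3) *(1,2,3)]
    by (intro null_fps_geometric[of \<rho> "C * B" 0] bnd_const) auto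
  from null_fps_nth[OF this, of 0] show ?thesis
    by simp
qed

text \<open>For negative n only the orders j \<ge> -n contribute, because the coefficient series
  have nothing at negative positions. Hence the geometric decay towards negative shifts.\<close>

lemma sym_bound:
  assumes "nb c B a" "varpi p < c"
  obtains K \<rho> where "0 \<le> K" "0 \<le> \<rho>" "\<rho> < 1"
    "\<And>t n. Zlike t \<Longrightarrow> absv (sym a t n) \<le> K * \<rho> ^ nat (- n)"
    "\<And>t n. Zlike t \<Longrightarrow> absv (sym a t n) \<le> K"
proof -
  obtain c1 C \<rho> where *: "0 < c1" "c1 \<le> c" "\<And>m. afact m \<le> C * c1 ^ m" "1 \<le> C" "\<rho> = c1 / c" "0 \<le> \<rho>" "\<rho> < 1"
    using nb_split[OF assms(2)] by blast
  have B0: "0 \<le> C * B"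
    using nb_nonneg[OF assms(1)] *(4) by simp
  have main: "absv (sym a t n) \<le> C * B * \<rho> ^ nat (- n)" if "Zlike t" for t n
    unfolding sym_def
  proof (rule absv_nsum_le[OF null_sym[OF assms that]])
    show "0 \<le> C * B * \<rho> ^ nat (- n)"
      using B0 *(6) by simp
    fix j
    show "absv (ff t j * cf (a j) (n + int j)) \<le> C * B * \<rho> ^ nat (- n)"
    proof (cases "n + int j < 0")
      case True
      then show ?thesis
        using B0 *(6) by (simp add: cf_def)
    next
      case False
      then have "nat (- n) \<le> j"
        by simp
      then have "C * B * \<rho> ^ j \<le> C * B * \<rho> ^ nat (- n)"
        using B0 *(6,7) by (intro mult_left_mono power_decreasing) auto
      then show ?thesis
        using sym_term_le[OF assms(1) that *(1,2,3), of j "n + int j"] *(5) by simp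
    qed
  qed
  have "C * B * \<rho> ^ nat (- n) \<le> C * B" for n
    using B0 *(6,7) mult_left_mono[OF power_le_one[of \<rho> "nat (- n)"] B0] by simp
  then have "absv (sym a t n) \<le> C * B" if "Zlike t" for t n
    using main[OF that, of n] order_trans by blast
  then show ?thesis
    using that[of "C * B" \<rho>] B0 *(6,7) main by blast
qed

text \<open>Unlike in \<open>sym_bound\<close>, the constant is the same for all operators, so it
  can be fixed before an error term is chosen.\<close>

lemma sym_bound_nb:
  assumes "varpi p < c"
  obtains C where "1 \<le> C" "\<And>a B t n. nb c B a \<Longrightarrow> Zlike t \<Longrightarrow> absv (sym a t n) \<le> C * B"
proof -
  obtain C where C: "1 \<le> C" "\<And>m. afact m \<le> C * c ^ m"
    using afact_bound[OF assms] by blast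
  have c: "0 < c"
    using assms varpi_pos by linarith
  have "absv (sym a t n) \<le> C * B" if "nb c B a" "Zlike t" for a B t n
    unfolding sym_def
  proof (rule absv_nsum_le[OF null_sym[OF that(1) assms that(2)]])
    show "0 \<le> C * B"
      using C(1) nb_nonneg[OF that(1)] by simp
    show "absv (ff t j * cf (a j) (n + int j)) \<le> C * B" for j
      using sym_term_le[OF that c order.refl C(2), of j "n + int j"] c by simp
  qed
  then show ?thesis
    using that[of C] C(1) by blast
qed

lemma sym_add:
  assumes "nb c B a" "nb c B' b" "varpi p < c" "Zlike t"
  shows "sym (\<lambda>j. a j + b j) t n = sym a t n + sym b t n"
  unfolding sym_def cf_add distrib_left using assms by (intro nsum_add null_sym)

lemma sym_diff:
  assumes "nb c B a" "nb c B' b" "varpi p < c" "Zlike t"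
  shows "sym (\<lambda>j. a j - b j) t n = sym a t n - sym b t n"
  unfolding sym_def cf_diff right_diff_distrib using assms by (intro nsum_diff null_sym)

text \<open>On x^k only the orders up to k act, and order k acts with the factor k! \<noteq> 0, so
  the symbols form a triangular system in the coefficients.\<close>

lemma sym_faithful:
  assumes "\<And>k n. sym a (of_nat k) n = sym b (of_nat k) n"
  shows "a = b"
proof -
  have fin: "sym d (of_nat k) n = (\<Sum>j\<le>k. ff (of_nat k) j * cf (d j) (n + int j))" for d k n
    unfolding sym_def by (rule nsum_finite) (auto simp: ff_of_nat binomial_eq_0)
  have "a k = b k" for k
  proof (induction k rule: less_induct)
    case (less k)
    have "a k $ m = b k $ m" for m
    proof -
      let ?n = "int m - int k"
      have split: "(\<Sum>j\<le>k. g j) = (\<Sum>j<k. g j) + g k" for g :: "nat \<Rightarrow> 'k"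
        by (simp add: lessThan_Suc_atMost[symmetric])
      have "ff (of_nat k) k * cf (a k) (?n + int k) = ff (of_nat k) k * cf (b k) (?n + int k)"
        using assms[of k ?n] less unfolding fin split by simp
      moreover have "ff (of_nat k) k \<noteq> (0 :: 'k)"
        using afact_pos[of k] by (auto simp: ff_of_nat)
      ultimately show ?thesis
        by (simp add: cf_def)
    qed
    then show ?case
      by (rule fps_ext)
  qed
  then show ?thesis
    by blast
qed

text \<open>The operator a is applied term by term to b x^t, the sum of the \<open>sym b t m\<close>
  x^(t+m). Both sides regroup the same sum of \<open>w\<close>: the right side through Vandermonde,
  that is, the Leibniz rule, and the left side by collecting the terms of equal order.\<close>

lemma sym_pmul:
  assumes a: "nb c B a" and b: "nb c B' b" and c: "varpi p < c" and t: "Zlike t"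
  shows "sym (pmul a b) t n = nsum (\<lambda>m :: int. sym a (t + of_int m) (n - m) * sym b t m)"
proof -
  obtain c1 C \<rho> where C: "0 < c1" "c1 \<le> c" "\<And>m. afact m \<le> C * c1 ^ m" "1 \<le> C" "\<rho> = c1 / c" "0 \<le> \<rho>" "\<rho> < 1"
    using nb_split[OF c] by blast
  have B0: "0 \<le> B" "0 \<le> B'"
    using a b nb_nonneg by blast+
  \<comment> \<open>The term of order l in b followed by the term of order i in a, where m is the
    shift of the exponent caused by the former.\<close>
  define u :: "(nat \<times> nat) \<times> int \<Rightarrow> 'k" where
    "u = (\<lambda>((i, l), m). (ff (t + of_int m) i * cf (a i) (n - m + int i)) * (ff t l * cf (b l) (m + int l)))"
  \<comment> \<open>Here r is the power of x taken from the coefficient of \<partial>^l in b, and m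
    is no longer a shift: it counts those of the i derivations that fall on x^r. The other l + i - m
    derivations fall on x^t.\<close>
  define w :: "(nat \<times> nat) \<times> nat \<times> nat \<Rightarrow> 'k" where
    "w = (\<lambda>((i, l), (m, r)). if m \<le> i then ff t (l + i - m) * cf (a i) (n + int l + int i - int r) *
      (of_nat (i choose m) * (ff (of_nat r) m * b l $ r)) else 0)"
  have null_u: "null_family u"
  proof (rule null_family_box[OF C(6,7), of _ "(C * B) * (C * B')"])
    fix i l :: nat and m :: int
    have "absv (u ((i, l), m)) \<le> (C * B * \<rho> ^ i) * (C * B' * \<rho> ^ l)"
      unfolding u_def case_prod_conv C(5)
      by (intro absv_mult_le sym_term_le[OF a Zlike_shift[OF t] C(1,2,3)] sym_term_le[OF b t C(1,2,3)])
    then show "absv (u ((i, l), m)) \<le> (C * B) * (C * B') * \<rho> ^ (i + l)"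
      by (simp add: power_add mult_ac)
    have "{m. u ((i, l), m) \<noteq> 0} \<subseteq> {- int l..n + int i}"
      by (auto simp: u_def cf_def split: if_splits)
    then show "finite {m. u ((i, l), m) \<noteq> 0}"
      using finite_subset by blast
  qed
  have null_w: "null_family w"
  proof (rule null_family_box[OF C(6,7), of _ "(C * C) * (B * B')"])
    fix i l :: nat and x :: "nat \<times> nat"
    obtain m r where x: "x = (m, r)" by fastforce
    show "absv (w ((i, l), x)) \<le> (C * C) * (B * B') * \<rho> ^ (i + l)"
    proof (cases "m \<le> i")
      case True
      have "absv (ff (of_nat r) m * b l $ r) \<le> (C * c1 ^ m) * (B' / c ^ l)"
        by (intro absv_mult_le order_trans[OF ZlikeD[OF Zlike_of_nat] C(3)] bndD[OF nbD[OF b]])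
      then have "absv (of_nat (i choose m) * (ff (of_nat r) m * b l $ r)) \<le> 1 * ((C * c1 ^ m) * (B' / c ^ l))"
        by (rule absv_mult_le[OF absv_of_nat_le])
      moreover have "absv (ff t (l + i - m) * cf (a i) (n + int l + int i - int r)) \<le>
          (C * c1 ^ (l + i - m)) * (B / c ^ i)"
        by (intro absv_mult_le order_trans[OF ZlikeD[OF t] C(3)] absv_cf_le[OF nbD[OF a]])
      ultimately have "absv (w ((i, l), x)) \<le>
          ((C * c1 ^ (l + i - m)) * (B / c ^ i)) * (1 * ((C * c1 ^ m) * (B' / c ^ l)))"
        unfolding w_def x case_prod_conv using True by (simp only: if_True) (rule absv_mult_le)
      also have "\<dots> = (C * C) * (B * B') * ((c1 ^ (l + i - m) * c1 ^ m) / (c ^ i * c ^ l))"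
        by simp
      also have "c1 ^ (l + i - m) * c1 ^ m = c1 ^ (i + l)"
        using True by (simp add: add.commute flip: power_add)
      also have "c1 ^ (i + l) / (c ^ i * c ^ l) = \<rho> ^ (i + l)"
        by (simp add: C(5) power_divide power_add)
      finally show ?thesis .
    next
      case False
      then show ?thesis
        using B0 C by (simp add: w_def x)
    qed
    have "{x. w ((i, l), x) \<noteq> 0} \<subseteq> {..i} \<times> {..nat (n + int l + int i)}"
      by (auto simp: w_def cf_def split: if_splits)
    then show "finite {x. w ((i, l), x) \<noteq> 0}"
      by (rule finite_subset) auto
  qed
  have "nsum (\<lambda>m. sym a (t + of_int m) (n - m) * sym b t m) = nsum (\<lambda>m. nsum (\<lambda>q. u (q, m)))"
  proof (intro arg_cong[of _ _ nsum] ext)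
    fix m :: int
    show "sym a (t + of_int m) (n - m) * sym b t m = nsum (\<lambda>q. u (q, m))"
      unfolding sym_def u_def
      by (subst nsum_mult[OF null_sym[OF a c Zlike_shift[OF t]] null_sym[OF b c t]])
        (simp add: case_prod_unfold)
  qed
  also have "\<dots> = nsum (\<lambda>q. nsum (\<lambda>m. u (q, m)))"
    using nsum_swap[of "\<lambda>q m. u (q, m)"] null_u by simp
  also have "\<dots> = nsum (\<lambda>q. nsum (\<lambda>x. w (q, x)))"
  proof (intro arg_cong[of _ _ nsum] ext)
    fix q :: "nat \<times> nat"
    obtain i l where q: "q = (i, l)" by fastforce
    \<comment> \<open>For r > R the coefficient of a would sit at a negative position.\<close>
    define R where "R = nat (n + int l + int i)"
    have "nsum (\<lambda>m. u (q, m)) = (\<Sum>m\<in>(\<lambda>r. int r - int l) ` {..R}. u (q, m))"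
    proof (rule nsum_finite)
      fix m assume m: "m \<notin> (\<lambda>r. int r - int l) ` {..R}"
      show "u (q, m) = 0"
      proof (rule ccontr)
        assume "u (q, m) \<noteq> 0"
        then have "- int l \<le> m" "m \<le> n + int i"
          by (auto simp: u_def q cf_def split: if_splits)
        then have "m = int (nat (m + int l)) - int l" "nat (m + int l) \<le> R"
          by (auto simp: R_def)
        then show False
          using m by blast
      qed
    qed simp
    also have "\<dots> = (\<Sum>r\<le>R. u (q, int r - int l))"
      by (subst sum.reindex) (auto intro: inj_onI)
    also have "\<dots> = (\<Sum>r\<le>R. \<Sum>m\<le>i. w (q, (m, r)))"
    proof (intro sum.cong refl)
      fix r
      \<comment> \<open>After \<partial>^l the exponent is t - l; the i further derivations are
        distributed between x^r and x^(t-l).\<close>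
      have "ff t l * ff (t + of_int (int r - int l)) i =
          ff t l * ff (of_nat r + (t - of_nat l)) i"
        by (simp add: algebra_simps)
      also have "\<dots> = (\<Sum>m\<le>i. of_nat (i choose m) * ff (of_nat r) m * (ff t l * ff (t - of_nat l) (i - m)))"
        unfolding ff_Vandermonde sum_distrib_left by (simp add: mult_ac)
      also have "\<dots> = (\<Sum>m\<le>i. of_nat (i choose m) * ff (of_nat r) m * ff t (l + i - m))"
        by (intro sum.cong refl) (simp flip: ff_add)
      finally have V: "ff t l * ff (t + of_int (int r - int l)) i =
          (\<Sum>m\<le>i. of_nat (i choose m) * ff (of_nat r) m * ff t (l + i - m))" .
      have "u (q, int r - int l) = (ff t l * ff (t + of_int (int r - int l)) i) *
          (cf (a i) (n + int l + int i - int r) * b l $ r)"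
      proof -
        have "cf (b l) (int r - int l + int l) = b l $ r"
          by (simp add: cf_def)
        moreover have "n - (int r - int l) + int i = n + int l + int i - int r"
          by simp
        ultimately show ?thesis
          unfolding u_def q by (simp only: case_prod_conv mult_ac)
      qed
      also have "\<dots> = (\<Sum>m\<le>i. w (q, (m, r)))"
        unfolding V sum_distrib_right by (intro sum.cong refl) (simp add: w_def q mult_ac)
      finally show "u (q, int r - int l) = (\<Sum>m\<le>i. w (q, (m, r)))" .
    qed
    also have "\<dots> = (\<Sum>x\<in>{..i} \<times> {..R}. w (q, x))"
      by (subst sum.swap) (simp add: sum.cartesian_product case_prod_unfold)
    also have "\<dots> = nsum (\<lambda>x. w (q, x))"
      by (rule nsum_finite[symmetric]) (auto simp: w_def q cf_def R_def split: if_splits)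
    finally show "nsum (\<lambda>m. u (q, m)) = nsum (\<lambda>x. w (q, x))" .
  qed
  also have "\<dots> = nsum w"
    by (rule nsum_Sigma[OF null_w])
  finally have rhs: "nsum (\<lambda>m. sym a (t + of_int m) (n - m) * sym b t m) = nsum w" .
  \<comment> \<open>l + i - m is the order of the resulting term, so the fibre of \<open>h\<close>
    over (k, i) collects what \<open>pterm\<close> contributes to the k-th coefficient.\<close>
  define h :: "(nat \<times> nat) \<times> nat \<times> nat \<Rightarrow> nat \<times> nat" where
    "h = (\<lambda>((i, l), (m, r)). (l + i - m, i))"
  define g where "g = (\<lambda>e. nsum (\<lambda>q. if h q = e then w q else 0))"
  have g: "g (k, i) = ff t k * cf (pterm a b k i) (n + int k)" for k i
  proof (cases "n + int k < 0")
    case True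
    \<comment> \<open>A nonzero term needs m \<le> r, as the falling factorial of r vanishes
      otherwise, and r \<le> n + l + i = n + k + m. Together they contradict n + k < 0.\<close>
    have "w q = 0" if "h q = (k, i)" for q
    proof -
      obtain i' l m r where "q = ((i', l), (m, r))"
        by (metis surj_pair)
      then have q: "q = ((i, l), (m, r))" "l + i - m = k"
        using \<open>h q = (k, i)\<close> by (auto simp: h_def)
      show ?thesis
      proof (rule ccontr)
        assume "w q \<noteq> 0"
        then have "m \<le> i" "int r \<le> n + int l + int i" "ff (of_nat r) m \<noteq> (0 :: 'k)"
          by (auto simp: w_def q cf_def split: if_splits)
        then have "m \<le> r"
          by (metis binomial_eq_0 ff_of_nat mult_zero_right not_le of_nat_0)
        with \<open>m \<le> i\<close> \<open>int r \<le> n + int l + int i\<close> q(2) True show False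
          by linarith
      qed
    qed
    then have "(\<lambda>q. if h q = (k, i) then w q else 0) = (\<lambda>q. 0)"
      by auto
    then show ?thesis
      using True by (simp add: g_def cf_def)
  next
    case False
    define N where "N = nat (n + int k)"
    have N: "int N = n + int k"
      using False by (simp add: N_def)
    define M where "M = {m. m \<le> i \<and> i \<le> k + m}"
    have finM: "finite M"
      unfolding M_def by (rule finite_subset[of _ "{..i}"]) auto
    \<comment> \<open>s = r - m is the exponent left of x^r after m derivations, and (s, m)
      parametrises the part of the fibre on which \<open>w\<close> can be nonzero.\<close>
    define \<phi> :: "nat \<times> nat \<Rightarrow> (nat \<times> nat) \<times> nat \<times> nat" where
      "\<phi> = (\<lambda>(s, m). ((i, k + m - i), (m, s + m)))"
    have inj: "inj_on \<phi> ({0..N} \<times> M)"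
      by (auto simp: inj_on_def \<phi>_def)
    have "g (k, i) = (\<Sum>q\<in>\<phi> ` ({0..N} \<times> M). if h q = (k, i) then w q else 0)"
      unfolding g_def
    proof (rule nsum_finite)
      fix q assume q: "q \<notin> \<phi> ` ({0..N} \<times> M)"
      show "(if h q = (k, i) then w q else 0) = 0"
      proof (rule ccontr)
        assume "(if h q = (k, i) then w q else 0) \<noteq> 0"
        then have hq: "h q = (k, i)" "w q \<noteq> 0"
          by (auto split: if_splits)
        obtain i' l m r where "q = ((i', l), (m, r))"
          by (metis surj_pair)
        then have q': "q = ((i, l), (m, r))" "l + i - m = k"
          using hq(1) by (auto simp: h_def)
        have m: "m \<le> i" "int r \<le> n + int l + int i" "ff (of_nat r) m \<noteq> (0 :: 'k)"
          using hq(2) by (auto simp: w_def q' cf_def split: if_splits)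
        then have "m \<le> r"
          by (metis binomial_eq_0 ff_of_nat mult_zero_right not_le of_nat_0)
        have "q = \<phi> (r - m, m)" "r - m \<in> {0..N}" "m \<in> M"
          using m(1,2) \<open>m \<le> r\<close> q' N by (auto simp: \<phi>_def M_def)
        then show False
          using q by blast
      qed
    qed (use finM in simp)
    also have "\<dots> = (\<Sum>x\<in>{0..N} \<times> M. w (\<phi> x))"
      unfolding sum.reindex[OF inj] by (intro sum.cong) (auto simp: \<phi>_def h_def M_def)
    also have "\<dots> = (\<Sum>s=0..N. \<Sum>m\<in>M. w (\<phi> (s, m)))"
      by (simp add: sum.cartesian_product case_prod_unfold)
    also have "\<dots> = (\<Sum>s=0..N. \<Sum>m\<in>M. ff t k * (a i $ (N - s) *
        (of_nat (i choose m) * (fps_deriv ^^ m) (b (k + m - i))) $ s))"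
    proof (intro sum.cong refl)
      fix s m assume s: "s \<in> {0..N}" and m: "m \<in> M"
      have 1: "k + m - i + i - m = k"
        using m by (auto simp: M_def)
      have "n + int (k + m - i) + int i - int (s + m) = int (N - s)"
        using m s N by (auto simp: M_def of_nat_diff)
      then have 2: "cf (a i) (n + int (k + m - i) + int i - int (s + m)) = a i $ (N - s)"
        by (simp add: cf_def)
      have 3: "ff (of_nat (s + m)) m * b (k + m - i) $ (s + m) = (fps_deriv ^^ m) (b (k + m - i)) $ s"
        unfolding fps_deriv_funpow_nth ff_of_nat ..
      have 4: "(of_nat (i choose m) * (fps_deriv ^^ m) (b (k + m - i))) $ s =
          of_nat (i choose m) * (fps_deriv ^^ m) (b (k + m - i)) $ s"
        by (simp flip: fps_of_nat)
      show "w (\<phi> (s, m)) = ff t k * (a i $ (N - s) * (of_nat (i choose m) * (fps_deriv ^^ m) (b (k + m - i))) $ s)"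
        using m unfolding \<phi>_def w_def case_prod_conv 1 2 3 4 by (simp add: M_def)
    qed
    also have "\<dots> = ff t k * pterm a b k i $ N"
    proof -
      define H where "H m = of_nat (i choose m) * (fps_deriv ^^ m) (b (k + m - i))" for m
      have "pterm a b k i = sum H M * a i"
        by (simp add: pterm_def H_def M_def mult.commute)
      then have "pterm a b k i $ N = (\<Sum>s=0..N. (\<Sum>m\<in>M. H m $ s) * a i $ (N - s))"
        by (simp add: fps_mult_nth[of "sum H M"] fps_sum_nth)
      then show ?thesis
        unfolding H_def[symmetric] by (simp add: sum_distrib_left sum_distrib_right mult_ac)
    qed
    also have "\<dots> = ff t k * cf (pterm a b k i) (n + int k)"
      using False by (simp add: cf_def N_def)
    finally show ?thesis .
  qed
  obtain C' where C': "\<And>a b B B' k. nb c B a \<Longrightarrow> nb c B' b \<Longrightarrow> null_fps (pterm a b k)"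
    using pmul_bound[OF c] by metis
  have null_pterm: "null_family (\<lambda>i. pterm a b k i $ m)" for k m
    by (rule null_fps_nth[OF C'[OF a b]])
  have "sym (pmul a b) t n = nsum (\<lambda>k. nsum (\<lambda>i. g (k, i)))"
    unfolding sym_def
  proof (intro arg_cong[of _ _ nsum] ext)
    fix k
    have "ff t k * cf (pmul a b k) (n + int k) = ff t k * nsum (\<lambda>i. cf (pterm a b k i) (n + int k))"
      by (simp add: cf_def pmul_def fsum_nth)
    also have "\<dots> = nsum (\<lambda>i. ff t k * cf (pterm a b k i) (n + int k))"
    proof (rule nsum_cmult[symmetric])
      show "null_family (\<lambda>i. cf (pterm a b k i) (n + int k))"
        using null_pterm by (cases "n + int k < 0") (simp_all add: cf_def)
    qed
    finally show "ff t k * cf (pmul a b k) (n + int k) = nsum (\<lambda>i. g (k, i))"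
      by (simp add: g)
  qed
  also have "\<dots> = nsum g"
    using nsum_fibers(1)[OF null_w, of h] by (intro nsum_Sigma) (simp add: g_def)
  also have "\<dots> = nsum w"
    unfolding g_def by (rule nsum_fibers(2)[OF null_w])
  finally show ?thesis
    using rhs by simp
qed


section \<open>Operators of a single order, and right multiplication by the Euler operator\<close>

lemma fsum_finite:
  assumes "finite F" "\<And>i. i \<notin> F \<Longrightarrow> s i = 0"
  shows "fsum s = sum s F"
  by (rule fps_ext) (simp add: fsum_nth fps_sum_nth nsum_finite[OF assms(1)] assms(2))

definition single :: "'k fps \<Rightarrow> nat \<Rightarrow> nat \<Rightarrow> 'k fps" where
  "single f k j = (if j = k then f else 0)"

lemma sym_single: "sym (single f k) t n = ff t k * cf f (n + int k)"
  unfolding sym_def by (subst nsum_single[of k]) (auto simp: single_def)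

lemma pone_single: "pone = single 1 0"
  by (simp add: pone_def single_def fun_eq_iff)

lemma cf_one: "cf 1 z = (if z = 0 then 1 else 0)"
  by (auto simp: cf_def)

lemma nb_single: "bnd r f \<Longrightarrow> 0 < c \<Longrightarrow> nb c (r * c ^ k) (single f k)"
  using bnd_nonneg[of r f] by (auto simp: nb_def single_def bnd_zero)

definition euler :: "'k \<Rightarrow> nat \<Rightarrow> 'k fps" where
  "euler l j = (if j = 0 then fps_const (- l) else if j = 1 then fps_X else 0)"

lemma deriv_euler: "fps_deriv (euler l j) = (if j = 1 then 1 else 0)"
  by (simp add: euler_def)

lemma deriv_funpow_euler:
  "(fps_deriv ^^ m) (euler l j) = (if m = 0 then euler l j else if m = 1 \<and> j = 1 then 1 else 0)"
proof (induction m)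
  case (Suc m)
  then show ?case
    by (cases m) (auto simp: euler_def)
qed simp

text \<open>By the Leibniz rule, \<partial>^i (x\<partial> - l) = x \<partial>^(i+1) + (i - l)
  \<partial>^i, so only i = k and i = k - 1 reach order k.\<close>

lemma pmul_euler:
  "pmul q (euler l) k = fps_const (of_nat k - l) * q k + (if k = 0 then 0 else fps_X * q (k - 1))"
proof -
  have pt: "pterm q (euler l) k i = q i * ((if i \<le> k then euler l (k - i) else 0) +
      (if 1 \<le> i \<and> i = k then of_nat i else 0))" for i
  proof -
    define M where "M = {m. m \<le> i \<and> i \<le> k + m}"
    define h where "h m = of_nat (i choose m) * (fps_deriv ^^ m) (euler l (k + m - i))" for m
    have finM: "finite M"
      unfolding M_def by (rule finite_subset[of _ "{..i}"]) auto
    have "sum h M = (\<Sum>m\<in>{0, 1}. if m \<in> M then h m else 0)"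
      using finM by (intro sum.mono_neutral_cong) (auto simp: h_def deriv_funpow_euler)
    also have "\<dots> = (if i \<le> k then euler l (k - i) else 0) + (if 1 \<le> i \<and> i = k then of_nat i else 0)"
      by (auto simp: M_def h_def deriv_funpow_euler deriv_euler)
    finally show ?thesis
      by (simp add: pterm_def M_def h_def)
  qed
  have "pterm q (euler l) k i = 0" if "i \<notin> {k - 1, k}" for i
    using that by (auto simp: pt euler_def)
  then have "pmul q (euler l) k = sum (pterm q (euler l) k) {k - 1, k}"
    unfolding pmul_def by (intro fsum_finite) auto
  moreover have k: "pterm q (euler l) k k = fps_const (of_nat k - l) * q k"
  proof -
    have "fps_const (of_nat k - l) = euler l 0 + of_nat k"
      by (metis euler_def add.commute fps_const_add fps_of_nat uminus_add_conv_diff)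
    moreover have "(if 1 \<le> k \<and> k = k then of_nat k else 0 :: 'k fps) = of_nat k"
      by (cases k) auto
    ultimately show ?thesis
      unfolding pt by (simp add: mult.commute)
  qed
  moreover have "pterm q (euler l) k (k - 1) = fps_X * q (k - 1)" if "k \<noteq> 0"
    using that by (auto simp: pt euler_def mult.commute)
  ultimately show ?thesis
    by (cases "k = 0") (auto simp: add.commute)
qed

text \<open>The equation is the recursion (k - l) q_k + x q_(k-1) = b_k. It can be solved upwards
  from k = 0 because l is not a natural number, and the accumulated divisors form a falling
  factorial.\<close>

lemma pmul_euler_unique:
  assumes "\<And>i :: nat. l \<noteq> of_nat i" "pmul q (euler l) = b"
  shows "q n = - (fps_const (inverse (ff l (Suc n))) * (\<Sum>j\<le>n. fps_const (ff l j) * (b j * fps_X ^ (n - j))))"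
proof (induction n)
  case 0
  have "l \<noteq> 0"
    using assms(1)[of 0] by simp
  have b0: "b 0 = fps_const (- l) * q 0"
    using assms(2) pmul_euler[of q l 0] by auto
  have "fps_const (inverse l) * b 0 = fps_const (inverse l * - l) * q 0"
    unfolding b0 by (simp only: fps_const_mult[symmetric] mult.assoc)
  moreover have "fps_const (- 1 :: 'k) = - 1"
    by (metis fps_const_1_eq_1 fps_const_neg)
  ultimately show ?case
    using \<open>l \<noteq> 0\<close> by simp
next
  case (Suc n)
  let ?S = "\<lambda>n. \<Sum>j\<le>n. fps_const (ff l j) * (b j * fps_X ^ (n - j))"
  have ff0: "ff l m \<noteq> 0" for m
    using assms(1) by (auto simp: ff_def)
  define e where "e = l - of_nat (Suc n)"
  have e: "e \<noteq> 0" "ff l (Suc (Suc n)) = ff l (Suc n) * e"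
    using assms(1)[of "Suc n"] by (auto simp: e_def ff_Suc[of l "Suc n"])
  have "fps_X * ?S n = (\<Sum>j\<le>n. fps_const (ff l j) * (b j * fps_X ^ (Suc n - j)))"
    unfolding sum_distrib_left by (intro sum.cong refl) (simp add: Suc_diff_le mult_ac)
  then have S: "?S (Suc n) = fps_X * ?S n + fps_const (ff l (Suc n)) * b (Suc n)"
    by simp
  have "b (Suc n) = fps_const (- e) * q (Suc n) + fps_X * q n"
    using assms(2) pmul_euler[of q l "Suc n"] by (auto simp: e_def simp del: of_nat_Suc)
  then have "fps_const e * q (Suc n) = fps_X * q n - b (Suc n)"
    by (simp add: algebra_simps flip: fps_const_neg)
  then have "fps_const (inverse e * e) * q (Suc n) = fps_const (inverse e) * (fps_X * q n - b (Suc n))"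
    by (simp only: fps_const_mult[symmetric] mult.assoc)
  then have "q (Suc n) = fps_const (inverse e) * (fps_X * q n - b (Suc n))"
    using e by simp
  also have "fps_X * q n - b (Suc n) = - (fps_const (inverse (ff l (Suc n))) * ?S (Suc n))"
  proof -
    have "fps_const (inverse (ff l (Suc n))) * (fps_const (ff l (Suc n)) * b (Suc n)) = b (Suc n)"
      using ff0[of "Suc n"] by (simp flip: mult.assoc)
    then show ?thesis
      unfolding S Suc.IH by (simp add: distrib_left mult_ac)
  qed
  finally show ?case
    unfolding e(2) by (simp add: mult_ac fps_const_mult[symmetric] del: fps_const_mult)
qed

text \<open>A purely formal statement. Whether the sequence q defines an operator is decided by
  separate estimates.\<close>

lemma pmul_euler_solution:
  assumes "\<And>i :: nat. l \<noteq> of_nat i"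
    and "\<And>n. q n = - (fps_const (inverse (ff l (Suc n))) * (\<Sum>j\<le>n. fps_const (ff l j) * (b j * fps_X ^ (n - j))))"
  shows "pmul q (euler l) = b"
proof
  fix k
  let ?S = "\<lambda>n. \<Sum>j\<le>n. fps_const (ff l j) * (b j * fps_X ^ (n - j))"
  have ff0: "ff l m \<noteq> 0" for m
    using assms(1) by (auto simp: ff_def)
  have "l - of_nat k \<noteq> 0"
    using assms(1)[of k] by simp
  have "fps_const (of_nat k - l) * q k =
      fps_const ((l - of_nat k) * inverse (ff l (Suc k))) * ?S k"
  proof -
    have "fps_const (of_nat k - l) = - fps_const (l - of_nat k)"
      by (simp only: fps_const_neg minus_diff_eq)
    then show ?thesis
      unfolding assms(2)[of k] by (simp only: fps_const_mult[symmetric] mult.assoc minus_mult_minus)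
  qed
  also have "(l - of_nat k) * inverse (ff l (Suc k)) = inverse (ff l k)"
    using \<open>l - of_nat k \<noteq> 0\<close> by (simp add: ff_Suc)
  finally have 1: "fps_const (of_nat k - l) * q k = fps_const (inverse (ff l k)) * ?S k" .
  show "pmul q (euler l) k = b k"
  proof (cases k)
    case 0
    then show ?thesis
      using 1 by (simp add: pmul_euler)
  next
    case (Suc n)
    have "fps_X * ?S n = (\<Sum>j\<le>n. fps_const (ff l j) * (b j * fps_X ^ (Suc n - j)))"
      unfolding sum_distrib_left by (intro sum.cong refl) (simp add: Suc_diff_le mult_ac)
    then have S: "?S (Suc n) = fps_X * ?S n + fps_const (ff l (Suc n)) * b (Suc n)"
      by simp
    have "fps_const (inverse (ff l (Suc n))) * (fps_const (ff l (Suc n)) * b (Suc n)) = b (Suc n)"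
      using ff0[of "Suc n"] by (simp flip: mult.assoc)
    moreover have "fps_X * q n = - (fps_const (inverse (ff l (Suc n))) * (fps_X * ?S n))"
      unfolding assms(2)[of n] by (simp add: mult_ac)
    ultimately show ?thesis
      using 1 unfolding Suc pmul_euler S by (simp add: distrib_left)
  qed
qed

lemma power_small_less:
  fixes \<rho> D \<epsilon> :: real
  assumes "0 \<le> \<rho>" "\<rho> < 1" "0 < \<epsilon>"
  obtains N where "\<And>n. \<epsilon> \<le> D * \<rho> ^ n \<Longrightarrow> n < N"
proof -
  obtain N where "\<And>n. N \<le> n \<Longrightarrow> D * \<rho> ^ n < \<epsilon>"
    using power_small[OF assms] by blast
  then show ?thesis
    using that[of N] by (meson not_le)
qed

end

section \<open>The ring laws for operators that converge for some c above the critical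
  radius\<close>

context disc_complement
begin

definition Dset :: "(nat \<Rightarrow> 'k fps) set" where
  "Dset = {a. (\<forall>j. afun (a j)) \<and> (\<exists>c B. varpi p < c \<and> nb c B a)}"

lemma DsetI: "(\<And>j. afun (a j)) \<Longrightarrow> varpi p < c \<Longrightarrow> nb c B a \<Longrightarrow> a \<in> Dset"
  unfolding Dset_def by blast

lemma Dset_afun: "a \<in> Dset \<Longrightarrow> afun (a j)"
  by (simp add: Dset_def)

lemma Dset_common:
  assumes "a \<in> Dset" "b \<in> Dset"
  obtains c B B' where "varpi p < c" "nb c B a" "nb c B' b"
proof -
  obtain c1 B c2 B' where *: "varpi p < c1" "nb c1 B a" "varpi p < c2" "nb c2 B' b"
    using assms unfolding Dset_def by blast
  have "0 < min c1 c2"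
    using * varpi_pos by simp
  then have "nb (min c1 c2) B a" "nb (min c1 c2) B' b"
    using * by (auto intro: nb_mono)
  then show ?thesis
    using that[of "min c1 c2" B B'] * by simp
qed

lemma DsetE:
  assumes "a \<in> Dset"
  obtains c B where "varpi p < c" "nb c B a"
  using assms unfolding Dset_def by blast

lemma nb_add: "nb c B a \<Longrightarrow> nb c B b \<Longrightarrow> nb c B (\<lambda>j. a j + b j)"
  by (simp add: nb_def bnd_add)

lemma Dset_add:
  assumes "a \<in> Dset" "b \<in> Dset"
  shows "(\<lambda>j. a j + b j) \<in> Dset"
proof -
  obtain c B B' where c: "varpi p < c" "nb c B a" "nb c B' b"
    using Dset_common[OF assms] by blast
  have "0 < c"
    using c(1) varpi_pos by simp
  then have "nb c (max B B') (\<lambda>j. a j + b j)"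
    using c by (intro nb_add) (auto intro: nb_mono)
  then show ?thesis
    using c(1) assms Dset_afun by (intro DsetI) auto
qed

lemma Dset_uminus: "a \<in> Dset \<Longrightarrow> (\<lambda>j. - a j) \<in> Dset"
  unfolding Dset_def nb_def by auto

lemma Dset_diff: "a \<in> Dset \<Longrightarrow> b \<in> Dset \<Longrightarrow> (\<lambda>j. a j - b j) \<in> Dset"
  using Dset_add[of a "\<lambda>j. - b j"] Dset_uminus[of b] by simp

lemma Dset_single:
  assumes "afun f"
  shows "single f k \<in> Dset"
proof -
  obtain B where "bnd B f"
    using afun_bnd[OF assms] by blast
  then have "nb (varpi p + 1) (B * (varpi p + 1) ^ k) (single f k)"
    using varpi_pos by (intro nb_single) auto
  then show ?thesis
    using assms by (intro DsetI[of _ "varpi p + 1"]) (auto simp: single_def)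
qed

lemma Dset_zero: "(\<lambda>_. 0) \<in> Dset"
  using Dset_single[OF afun_zero, of 0] by (simp add: single_def[abs_def])

lemma Dset_one: "pone \<in> Dset"
  unfolding pone_single by (rule Dset_single) simp

lemma euler_Dset: "euler l \<in> Dset"
proof -
  have "euler l = (\<lambda>j. single (fps_const (- l)) 0 j + single fps_X 1 j)"
    by (auto simp: euler_def single_def fun_eq_iff)
  then show ?thesis
    using Dset_add[OF Dset_single Dset_single] by simp
qed

lemma Dset_pmul:
  assumes "a \<in> Dset" "b \<in> Dset"
  shows "pmul a b \<in> Dset"
proof -
  obtain c B B' where c: "varpi p < c" "nb c B a" "nb c B' b"
    using Dset_common[OF assms] by blast
  obtain C where C: "nb c (C * B * B') (pmul a b)" "\<And>k. null_fps (pterm a b k)"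
    using pmul_bound[OF c(1)] c(2,3) by metis
  have "afun (pterm a b k i)" for k i
    unfolding pterm_def using assms Dset_afun
    by (intro afun_mult afun_sum afun_of_nat_mult afun_deriv_funpow) auto
  then have "afun (pmul a b k)" for k
    unfolding pmul_def using C(2) by (intro afun_fsum)
  then show ?thesis
    using C(1) c(1) by (intro DsetI)
qed

lemma pterm_null: "a \<in> Dset \<Longrightarrow> b \<in> Dset \<Longrightarrow> null_fps (pterm a b k)"
  using Dset_common pmul_bound by metis

lemma sym_pmul_Dset:
  assumes "a \<in> Dset" "b \<in> Dset" "Zlike t"
  shows "sym (pmul a b) t n = nsum (\<lambda>m :: int. sym a (t + of_int m) (n - m) * sym b t m)"
  using Dset_common[OF assms(1,2)] sym_pmul[OF _ _ _ assms(3)] by metis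

lemma sym_add_Dset:
  assumes "a \<in> Dset" "b \<in> Dset" "Zlike t"
  shows "sym (\<lambda>j. a j + b j) t n = sym a t n + sym b t n"
  using Dset_common[OF assms(1,2)] sym_add[OF _ _ _ assms(3)] by metis

lemma sym_diff_Dset:
  assumes "a \<in> Dset" "b \<in> Dset" "Zlike t"
  shows "sym (\<lambda>j. a j - b j) t n = sym a t n - sym b t n"
  using Dset_common[OF assms(1,2)] sym_diff[OF _ _ _ assms(3)] by metis

text \<open>For large m the first factor is small, its shift n - m being very negative; for very
  negative m the second one is. Both are bounded throughout.\<close>

lemma null_sym_product:
  assumes "a \<in> Dset" "b \<in> Dset" "Zlike t"
  shows "null_family (\<lambda>m :: int. sym a (t + of_int m) (n - m) * sym b t m)"
proof -
  obtain c B B' where c: "varpi p < c" "nb c B a" "nb c B' b"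
    using Dset_common[OF assms(1,2)] by blast
  obtain K \<rho> where K: "0 \<le> K" "0 \<le> \<rho>" "\<rho> < 1"
    "\<And>t n. Zlike t \<Longrightarrow> absv (sym a t n) \<le> K * \<rho> ^ nat (- n)" "\<And>t n. Zlike t \<Longrightarrow> absv (sym a t n) \<le> K"
    using sym_bound[OF c(2,1)] by blast
  obtain L \<sigma> where L: "0 \<le> L" "0 \<le> \<sigma>" "\<sigma> < 1"
    "\<And>t n. Zlike t \<Longrightarrow> absv (sym b t n) \<le> L * \<sigma> ^ nat (- n)" "\<And>t n. Zlike t \<Longrightarrow> absv (sym b t n) \<le> L"
    using sym_bound[OF c(3,1)] by blast
  show ?thesis
    unfolding null_family_def
  proof (intro allI impI)
    fix \<epsilon> :: real assume "0 < \<epsilon>"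
    obtain N where N: "\<And>n. \<epsilon> \<le> K * L * \<rho> ^ n \<Longrightarrow> n < N"
      using power_small_less[OF K(2,3) \<open>0 < \<epsilon>\<close>, where D = "K * L"] by blast
    obtain M where M: "\<And>n. \<epsilon> \<le> K * L * \<sigma> ^ n \<Longrightarrow> n < M"
      using power_small_less[OF L(2,3) \<open>0 < \<epsilon>\<close>, where D = "K * L"] by blast
    have "m \<in> {- int M..n + int N}" if m: "\<epsilon> \<le> absv (sym a (t + of_int m) (n - m) * sym b t m)" for m
    proof -
      have "absv (sym a (t + of_int m) (n - m) * sym b t m) \<le> K * \<rho> ^ nat (- (n - m)) * L"
        by (intro absv_mult_le K(4) L(5) Zlike_shift assms(3))
      then have "K * L * \<rho> ^ nat (- (n - m)) \<ge> \<epsilon>"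
        using m by (simp add: mult_ac)
      then have 1: "nat (- (n - m)) < N"
        by (rule N)
      have "absv (sym a (t + of_int m) (n - m) * sym b t m) \<le> K * (L * \<sigma> ^ nat (- m))"
        by (intro absv_mult_le K(5) L(4) Zlike_shift assms(3))
      then have "K * L * \<sigma> ^ nat (- m) \<ge> \<epsilon>"
        using m by (simp add: mult_ac)
      then have "nat (- m) < M"
        by (rule M)
      with 1 show ?thesis
        by auto
    qed
    then have "{m. \<epsilon> \<le> absv (sym a (t + of_int m) (n - m) * sym b t m)} \<subseteq> {- int M..n + int N}"
      by blast
    then show "finite {m. \<epsilon> \<le> absv (sym a (t + of_int m) (n - m) * sym b t m)}"
      using finite_subset by blast
  qed
qed

text \<open>Operators are determined by their symbols at natural numbers, and there both sides
  become the same double sum over the intermediate exponents. This avoids comparing iterated Leibniz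
  expansions.\<close>

lemma pmul_assoc:
  assumes "a \<in> Dset" "b \<in> Dset" "d \<in> Dset"
  shows "pmul (pmul a b) d = pmul a (pmul b d)"
proof (rule sym_faithful)
  fix k n
  let ?t = "of_nat k :: 'k"
  have t: "Zlike ?t" "\<And>m. Zlike (?t + of_int m)"
    using Zlike_of_nat Zlike_shift by blast+
  \<comment> \<open>\<open>m\<close> is the shift caused by d, \<open>l\<close> that by b, and n - m
    - l that by a. Each symbol decays towards negative shifts and the total is n, so large values
    can occur only in a finite box.\<close>
  define W where "W = (\<lambda>(m, l). sym a (?t + of_int m + of_int l) (n - m - l) * sym b (?t + of_int m) l * sym d ?t m)"
  have null: "null_family W"
  proof -
    obtain c1 B1 c2 B2 c3 B3 where c: "varpi p < c1" "nb c1 B1 a" "varpi p < c2" "nb c2 B2 b" "varpi p < c3" "nb c3 B3 d"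
      using assms DsetE by metis
    obtain K1 r1 where K1: "0 \<le> K1" "0 \<le> r1" "r1 < 1"
      "\<And>t n. Zlike t \<Longrightarrow> absv (sym a t n) \<le> K1 * r1 ^ nat (- n)" "\<And>t n. Zlike t \<Longrightarrow> absv (sym a t n) \<le> K1"
      using sym_bound[OF c(2,1)] by blast
    obtain K2 r2 where K2: "0 \<le> K2" "0 \<le> r2" "r2 < 1"
      "\<And>t n. Zlike t \<Longrightarrow> absv (sym b t n) \<le> K2 * r2 ^ nat (- n)" "\<And>t n. Zlike t \<Longrightarrow> absv (sym b t n) \<le> K2"
      using sym_bound[OF c(4,3)] by blast
    obtain K3 r3 where K3: "0 \<le> K3" "0 \<le> r3" "r3 < 1"
      "\<And>t n. Zlike t \<Longrightarrow> absv (sym d t n) \<le> K3 * r3 ^ nat (- n)" "\<And>t n. Zlike t \<Longrightarrow> absv (sym d t n) \<le> K3"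
      using sym_bound[OF c(6,5)] by blast
    let ?K = "K1 * K2 * K3"
    show ?thesis
      unfolding null_family_def
    proof (intro allI impI)
      fix \<epsilon> :: real assume "0 < \<epsilon>"
      obtain N1 where N1: "\<And>n. \<epsilon> \<le> ?K * r1 ^ n \<Longrightarrow> n < N1"
        using power_small_less[OF K1(2,3) \<open>0 < \<epsilon>\<close>, where D = ?K] by blast
      obtain N2 where N2: "\<And>n. \<epsilon> \<le> ?K * r2 ^ n \<Longrightarrow> n < N2"
        using power_small_less[OF K2(2,3) \<open>0 < \<epsilon>\<close>, where D = ?K] by blast
      obtain N3 where N3: "\<And>n. \<epsilon> \<le> ?K * r3 ^ n \<Longrightarrow> n < N3"
        using power_small_less[OF K3(2,3) \<open>0 < \<epsilon>\<close>, where D = ?K] by blast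
      let ?I = "{- int N3..n + int N1 + int N2} \<times> {- int N2..n + int N1 + int N3}"
      have "(m, l) \<in> ?I" if m: "\<epsilon> \<le> absv (W (m, l))" for m l
      proof -
        have z: "Zlike (?t + of_int m + of_int l)" "Zlike (?t + of_int m)"
          using t Zlike_shift by blast+
        have "absv (W (m, l)) \<le> K1 * r1 ^ nat (- (n - m - l)) * K2 * K3"
          unfolding W_def case_prod_conv by (intro absv_mult_le K1(4) K2(5) K3(5) z t)
        then have "?K * r1 ^ nat (- (n - m - l)) \<ge> \<epsilon>"
          using m by (simp add: mult_ac)
        then have 1: "nat (- (n - m - l)) < N1"
          by (rule N1)
        have "absv (W (m, l)) \<le> K1 * (K2 * r2 ^ nat (- l)) * K3"
          unfolding W_def case_prod_conv by (intro absv_mult_le K1(5) K2(4) K3(5) z t)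
        then have "?K * r2 ^ nat (- l) \<ge> \<epsilon>"
          using m by (simp add: mult_ac)
        then have 2: "nat (- l) < N2"
          by (rule N2)
        have "absv (W (m, l)) \<le> K1 * K2 * (K3 * r3 ^ nat (- m))"
          unfolding W_def case_prod_conv by (intro absv_mult_le K1(5) K2(5) K3(4) z t)
        then have "?K * r3 ^ nat (- m) \<ge> \<epsilon>"
          using m by (simp add: mult_ac)
        then have "nat (- m) < N3"
          by (rule N3)
        with 1 2 show ?thesis
          by auto
      qed
      then have "{q. \<epsilon> \<le> absv (W q)} \<subseteq> ?I"
        by (intro subsetI) (metis mem_Collect_eq surj_pair)
      then show "finite {q. \<epsilon> \<le> absv (W q)}"
        by (rule finite_subset) simp
    qed
  qed
  have "sym (pmul (pmul a b) d) ?t n = nsum (\<lambda>m. nsum (\<lambda>l. W (m, l)))"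
    unfolding sym_pmul_Dset[OF Dset_pmul[OF assms(1,2)] assms(3) t(1)]
  proof (intro arg_cong[of _ _ nsum] ext)
    fix m
    show "sym (pmul a b) (?t + of_int m) (n - m) * sym d ?t m = nsum (\<lambda>l. W (m, l))"
      unfolding sym_pmul_Dset[OF assms(1,2) t(2)] W_def case_prod_conv
      using nsum_cmult[OF null_sym_product[OF assms(1,2) t(2)], of "sym d ?t m" m "n - m"]
      by (simp add: mult.commute)
  qed
  also have "\<dots> = nsum W"
    by (rule nsum_Sigma[OF null])
  \<comment> \<open>The new index m' = m + l is the joint shift by d and b.\<close>
  also have "\<dots> = nsum (\<lambda>q. W (case q of (m', m) \<Rightarrow> (m, m' - m)))"
  proof (rule nsum_reindex[symmetric, OF _ _ null])
    show "inj (\<lambda>q. case q of (m', m) \<Rightarrow> (m, m' - m :: int))"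
      by (auto simp: inj_def)
    fix q :: "int \<times> int"
    have "q = (case (fst q + snd q, fst q) of (m', m) \<Rightarrow> (m, m' - m))"
      by simp
    then have "q \<in> range (\<lambda>q. case q of (m', m) \<Rightarrow> (m, m' - m))"
      by (rule range_eqI)
    then show "q \<notin> range (\<lambda>q. case q of (m', m) \<Rightarrow> (m, m' - m)) \<Longrightarrow> W q = 0"
      by contradiction
  qed
  also have "\<dots> = nsum (\<lambda>m'. nsum (\<lambda>m. W (m, m' - m)))"
  proof -
    have "null_family (\<lambda>q. W (case q of (m', m) \<Rightarrow> (m, m' - m)))"
      by (rule null_family_inj[OF null]) (auto simp: inj_def)
    from nsum_Sigma[OF this] show ?thesis
      by simp
  qed
  also have "\<dots> = sym (pmul a (pmul b d)) ?t n"
    unfolding sym_pmul_Dset[OF assms(1) Dset_pmul[OF assms(2,3)] t(1)]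
  proof (intro arg_cong[of _ _ nsum] ext)
    fix m'
    show "nsum (\<lambda>m. W (m, m' - m)) = sym a (?t + of_int m') (n - m') * sym (pmul b d) ?t m'"
      unfolding sym_pmul_Dset[OF assms(2,3) t(1)] W_def case_prod_conv
      using nsum_cmult[OF null_sym_product[OF assms(2,3) t(1)], of "sym a (?t + of_int m') (n - m')" m']
      by (simp add: mult.assoc)
  qed
  finally show "sym (pmul (pmul a b) d) ?t n = sym (pmul a (pmul b d)) ?t n" .
qed

lemma pmul_add_left:
  assumes "a \<in> Dset" "b \<in> Dset" "d \<in> Dset"
  shows "pmul (\<lambda>j. a j + b j) d = (\<lambda>j. pmul a d j + pmul b d j)"
proof (rule sym_faithful)
  fix k n
  have t: "Zlike (of_nat k)" "\<And>m. Zlike (of_nat k + of_int m)"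
    using Zlike_of_nat Zlike_shift by blast+
  show "sym (pmul (\<lambda>j. a j + b j) d) (of_nat k) n = sym (\<lambda>j. pmul a d j + pmul b d j) (of_nat k) n"
    using assms t
    by (simp add: sym_add_Dset sym_pmul_Dset Dset_add Dset_pmul distrib_right nsum_add null_sym_product)
qed

lemma pmul_add_right:
  assumes "a \<in> Dset" "b \<in> Dset" "d \<in> Dset"
  shows "pmul d (\<lambda>j. a j + b j) = (\<lambda>j. pmul d a j + pmul d b j)"
proof (rule sym_faithful)
  fix k n
  have t: "Zlike (of_nat k)" "\<And>m. Zlike (of_nat k + of_int m)"
    using Zlike_of_nat Zlike_shift by blast+
  show "sym (pmul d (\<lambda>j. a j + b j)) (of_nat k) n = sym (\<lambda>j. pmul d a j + pmul d b j) (of_nat k) n"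
    using assms t
    by (simp add: sym_add_Dset sym_pmul_Dset Dset_add Dset_pmul distrib_left nsum_add null_sym_product)
qed

lemma pmul_one_left: "a \<in> Dset \<Longrightarrow> pmul pone a = a"
proof (rule sym_faithful)
  fix k n assume a: "a \<in> Dset"
  have "sym (pmul pone a) (of_nat k) n = sym pone (of_nat k + of_int n) (n - n) * sym a (of_nat k) n"
    unfolding sym_pmul_Dset[OF Dset_one a Zlike_of_nat]
    by (rule nsum_single) (simp add: pone_single sym_single cf_one)
  then show "sym (pmul pone a) (of_nat k) n = sym a (of_nat k) n"
    by (simp add: pone_single sym_single cf_one)
qed

lemma pmul_one_right: "a \<in> Dset \<Longrightarrow> pmul a pone = a"
proof (rule sym_faithful)
  fix k n assume a: "a \<in> Dset"
  have "sym (pmul a pone) (of_nat k) n = sym a (of_nat k + of_int 0) (n - 0) * sym pone (of_nat k) 0"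
    unfolding sym_pmul_Dset[OF a Dset_one Zlike_of_nat]
    by (rule nsum_single) (simp add: pone_single sym_single cf_one)
  then show "sym (pmul a pone) (of_nat k) n = sym a (of_nat k) n"
    by (simp add: pone_single sym_single cf_one)
qed


section \<open>Left multiples of the Euler operator\<close>

text \<open>For b = 1 the closed form reduces to q_n = - x^n / \<open>ff l (n + 1)\<close>. The
  lower bound for falling factorials away from the p-adic integers gives |q_n| = O(c^(-n)) with some
  c > \<open>varpi p\<close>.\<close>

lemma euler_invertible:
  assumes "l \<notin> padic_integers absv"
  shows "\<exists>q\<in>Dset. pmul q (euler l) = pone"
proof -
  obtain c B where c: "varpi p < c" "c < 1" "0 < B" "\<And>n. c ^ n \<le> B * absv (ff l n)"
    using absv_ff_ge[OF assms] by blast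
  have c0: "0 < c"
    using c(1) varpi_pos by linarith
  have pos: "0 < absv (ff l n)" for n
    using c(3) c(4)[of n] zero_less_power[OF c0, of n] by (smt (verit) zero_less_mult_iff)
  have nat: "l \<noteq> of_nat i" for i
    using pos[of "Suc i"] by (auto simp: ff_Suc)
  define q where "q n = - (fps_const (inverse (ff l (Suc n))) * (\<Sum>j\<le>n. fps_const (ff l j) * (pone j * fps_X ^ (n - j))))" for n
  have q: "q n = - (fps_const (inverse (ff l (Suc n))) * fps_X ^ n)" for n
  proof -
    have "(\<Sum>j\<le>n. fps_const (ff l j) * (pone j * fps_X ^ (n - j))) = (\<Sum>j\<in>{0}. fps_const (ff l j) * (pone j * fps_X ^ (n - j)))"
      by (rule sum.mono_neutral_right) (auto simp: pone_def)
    then show ?thesis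
      by (simp add: q_def pone_def)
  qed
  have "nb c (B / c) q"
    unfolding nb_def
  proof
    fix n
    have "bnd (absv (inverse (ff l (Suc n))) * 1) (q n)"
      unfolding q bnd_uminus by (intro bnd_const_mult bnd_power bnd_X)
    moreover have "absv (inverse (ff l (Suc n))) * 1 \<le> B / c / c ^ n"
      unfolding absv_inverse using c(4)[of "Suc n"] c0 pos[of "Suc n"] by (simp add: field_simps)
    ultimately show "bnd (B / c / c ^ n) (q n)"
      by (rule bnd_mono)
  qed
  moreover have "afun (q n)" for n
    unfolding q by (intro afun_uminus afun_mult afun_const afun_power afun_X)
  ultimately have "q \<in> Dset"
    using c(1) by (intro DsetI)
  moreover have "pmul q (euler l) = pone"
    by (rule pmul_euler_solution[OF nat q_def])
  ultimately show ?thesis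
    by blast
qed

text \<open>The recursion forces q_n = - x^n / \<open>ff l (n + 1)\<close>. Convergence would bound
  c^n by a multiple of |\<open>ff l (n + 1)\<close>|, but this is at most |(n+1)!| and hence O(c1^n)
  with c1 < c. This is what makes the quotient module nonzero.\<close>

lemma euler_not_invertible:
  assumes l: "Zlike l" "\<And>i :: nat. l \<noteq> of_nat i" and q: "q \<in> Dset" "pmul q (euler l) = pone"
  shows False
proof -
  have qn: "q n = - (fps_const (inverse (ff l (Suc n))) * fps_X ^ n)" for n
  proof -
    have "(\<Sum>j\<le>n. fps_const (ff l j) * (pone j * fps_X ^ (n - j))) = (\<Sum>j\<in>{0}. fps_const (ff l j) * (pone j * fps_X ^ (n - j)))"
      by (rule sum.mono_neutral_right) (auto simp: pone_def)
    then show ?thesis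
      using pmul_euler_unique[OF l(2) q(2), of n] by (simp add: pone_def)
  qed
  obtain c B where c: "varpi p < c" "nb c B q"
    using q(1) by (rule DsetE)
  obtain c1 C \<rho> where C: "0 < c1" "c1 \<le> c" "\<And>m. afact m \<le> C * c1 ^ m" "1 \<le> C" "\<rho> = c1 / c" "0 \<le> \<rho>" "\<rho> < 1"
    using nb_split[OF c(1)] by blast
  have c0: "0 < c"
    using C by linarith
  obtain n where n: "B * (C * c1) * \<rho> ^ n < 1"
    using power_small[OF C(6,7) zero_less_one, where D = "B * (C * c1)"] by blast
  have ff0: "ff l m \<noteq> 0" for m
    using l(2) by (auto simp: ff_def)
  have "absv (q n $ n) = inverse (absv (ff l (Suc n)))"
    unfolding qn by (simp add: absv_inverse)
  then have "inverse (absv (ff l (Suc n))) \<le> B / c ^ n"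
    using bndD[OF nbD[OF c(2)], of n n] by simp
  moreover have pos: "0 < absv (ff l (Suc n))"
    using ff0[of "Suc n"] absv_eq_0_iff absv_nonneg by (metis less_eq_real_def)
  ultimately have "c ^ n \<le> B * absv (ff l (Suc n))"
    using c0 by (simp add: field_simps)
  also have "\<dots> \<le> B * (C * c1 ^ Suc n)"
    using ZlikeD[OF l(1), of "Suc n"] C(3)[of "Suc n"] nb_nonneg[OF c(2)] by (intro mult_left_mono) auto
  finally have "1 \<le> B * (C * c1 ^ Suc n) / c ^ n"
    using c0 by (simp add: field_simps)
  also have "\<dots> = B * (C * c1) * \<rho> ^ n"
    using c0 by (simp add: C(5) power_divide)
  finally show False
    using n by simp
qed

text \<open>Since b kills x^l, the finite sum in the closed form for q_n equals minus its own tail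
  over j > n. Dividing this tail by \<open>ff l (n + 1)\<close> leaves falling factorials of l - (n
  + 1), which are bounded by absolute values of factorials. So the small divisor does not spoil
  convergence.\<close>

lemma euler_multiple:
  assumes l: "Zlike l" "\<And>i :: nat. l \<noteq> of_nat i" and b: "b \<in> Dset" "\<And>n. sym b l n = 0"
  shows "\<exists>q\<in>Dset. pmul q (euler l) = b"
proof -
  define q where "q n = - (fps_const (inverse (ff l (Suc n))) * (\<Sum>j\<le>n. fps_const (ff l j) * (b j * fps_X ^ (n - j))))" for n
  have ff0: "ff l m \<noteq> 0" for m
    using l(2) by (auto simp: ff_def)
  obtain c B where c: "varpi p < c" "nb c B b"
    using b(1) by (rule DsetE)
  obtain c1 C \<rho> where C: "0 < c1" "c1 \<le> c" "\<And>m. afact m \<le> C * c1 ^ m" "1 \<le> C" "\<rho> = c1 / c" "0 \<le> \<rho>" "\<rho> < 1"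
    using nb_split[OF c(1)] by blast
  have c0: "0 < c"
    using C by linarith
  have B0: "0 \<le> C * B"
    using C(4) nb_nonneg[OF c(2)] by simp
  have "absv (q n $ m) \<le> C * B / c / c ^ n" for n m
  proof -
    \<comment> \<open>The coefficient of x^m in b_j x^(n-j) is that of b_j at m - n + j, so the full
      sum over j is the symbol of b for the shift m - n.\<close>
    let ?z = "int m - int n"
    define g where "g j = ff l j * cf (b j) (?z + int j)" for j
    have null: "null_family g"
      unfolding g_def by (rule null_sym[OF c(2,1) l(1)])
    have null1: "null_family (\<lambda>j. if j \<le> n then g j else 0)" "null_family (\<lambda>j. if j \<le> n then 0 else g j)"
      by (rule null_family_le[OF null], simp add: absv_nonneg)+
    have "0 = nsum g"
      using b(2)[of ?z] by (simp add: sym_def g_def[abs_def])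
    also have "\<dots> = nsum (\<lambda>j. (if j \<le> n then g j else 0) + (if j \<le> n then 0 else g j))"
      by (intro arg_cong[of _ _ nsum]) auto
    also have "\<dots> = (\<Sum>j\<le>n. g j) + nsum (\<lambda>j. if j \<le> n then 0 else g j)"
      unfolding nsum_add[OF null1] by (subst nsum_finite[of "{..n}"]) auto
    finally have "(\<Sum>j\<le>n. g j) = - nsum (\<lambda>j. if j \<le> n then 0 else g j)"
      by (simp add: add_eq_0_iff)
    moreover have "(\<Sum>j\<le>n. fps_const (ff l j) * (b j * fps_X ^ (n - j))) $ m = (\<Sum>j\<le>n. g j)"
      unfolding fps_sum_nth
      by (intro sum.cong refl) (auto simp: g_def cf_def fps_X_power_mult_right_nth nat_diff_distrib of_nat_diff
          intro!: arg_cong[of _ _ "\<lambda>i. b _ $ i"])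
    ultimately have "q n $ m = inverse (ff l (Suc n)) * nsum (\<lambda>j. if j \<le> n then 0 else g j)"
      by (simp add: q_def)
    also have "\<dots> = nsum (\<lambda>j. inverse (ff l (Suc n)) * (if j \<le> n then 0 else g j))"
      by (rule nsum_cmult[symmetric, OF null1(2)])
    also have "absv \<dots> \<le> C * B / c / c ^ n"
    proof (rule absv_nsum_le[OF null_family_cmult[OF null1(2)]])
      show 0: "0 \<le> C * B / c / c ^ n"
        using B0 c0 by simp
      fix j
      show "absv (inverse (ff l (Suc n)) * (if j \<le> n then 0 else g j)) \<le> C * B / c / c ^ n"
      proof (cases "j \<le> n")
        case False
        define i where "i = j - Suc n"
        have j: "j = Suc n + i"
          using False by (simp add: i_def)
        have z: "Zlike (l - of_nat (Suc n))"
          using Zlike_shift[OF l(1), of "- int (Suc n)"] by (simp del: of_nat_Suc)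
        have "inverse (ff l (Suc n)) * g j = ff (l - of_nat (Suc n)) i * cf (b j) (?z + int j)"
          unfolding g_def j ff_add using ff0[of "Suc n"] by simp
        also have "absv \<dots> \<le> (C * c1 ^ i) * (B / c ^ j)"
          by (intro absv_mult_le order_trans[OF ZlikeD[OF z] C(3)] absv_cf_le[OF nbD[OF c(2)]])
        also have "\<dots> = C * B / c / c ^ n * \<rho> ^ i"
          using c0 by (simp add: j power_add C(5) power_divide mult_ac)
        also have "\<dots> \<le> C * B / c / c ^ n * 1"
          using 0 C(6,7) by (intro mult_left_mono power_le_one) auto
        finally show ?thesis
          using False by simp
      qed (use 0 in simp)
    qed
    finally show ?thesis .
  qed
  then have "nb c (C * B / c) q"
    by (simp add: nb_def bnd_def)
  moreover have "afun (q n)" for n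
    unfolding q_def using Dset_afun[OF b(1)]
    by (intro afun_uminus afun_mult afun_const afun_sum afun_power afun_X)
  ultimately have "q \<in> Dset"
    using c(1) by (intro DsetI)
  moreover have "pmul q (euler l) = b"
    by (rule pmul_euler_solution[OF l(2) q_def])
  ultimately show ?thesis
    by blast
qed

end

section \<open>Simplicity for \<open>p\<close>-adic integers\<close>

context complete_discretely_valued_field
begin

lemma nsum_remove:
  assumes "null_family s"
  shows "nsum s = s j + nsum (\<lambda>i. if i = j then 0 else s i)"
proof -
  have null: "null_family (\<lambda>i. if i = j then s j else 0)" "null_family (\<lambda>i. if i = j then 0 else s i)"
    by (rule null_family_le[OF assms], simp add: absv_nonneg)+
  have "nsum s = nsum (\<lambda>i. (if i = j then s j else 0) + (if i = j then 0 else s i))"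
    by (intro arg_cong[of _ _ nsum]) auto
  also have "\<dots> = s j + nsum (\<lambda>i. if i = j then 0 else s i)"
    unfolding nsum_add[OF null] by (subst nsum_single[of j]) auto
  finally show ?thesis .
qed

text \<open>Decay towards negative indices leaves finitely many n \<le> n0 with |F n| \<ge> |F n0|.
  The leftmost point at which the maximum over these is attained has the property.\<close>

lemma dominant_index:
  fixes F :: "int \<Rightarrow> 'k"
  assumes "0 \<le> \<rho>" "\<rho> < 1" "\<And>n. absv (F n) \<le> K * \<rho> ^ nat (- n)" "F n0 \<noteq> 0"
  obtains a where "F a \<noteq> 0" "\<And>n. n < a \<Longrightarrow> absv (F n) < absv (F a)"
proof -
  have pos: "0 < absv (F n0)"
    using assms(4) absv_eq_0_iff[of "F n0"] absv_nonneg[of "F n0"] by linarith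
  obtain N where N: "\<And>n. absv (F n0) \<le> K * \<rho> ^ n \<Longrightarrow> n < N"
    using power_small_less[OF assms(1,2) pos, where D = K] by blast
  define S where "S = {n. n \<le> n0 \<and> absv (F n0) \<le> absv (F n)}"
  have "S \<subseteq> {- int N..n0}"
  proof
    fix n assume n: "n \<in> S"
    then have "absv (F n0) \<le> K * \<rho> ^ nat (- n)"
      using assms(3)[of n] by (simp add: S_def)
    then have "nat (- n) < N"
      by (rule N)
    then show "n \<in> {- int N..n0}"
      using n by (simp add: S_def)
  qed
  then have finS: "finite S"
    using finite_subset by blast
  have "n0 \<in> S"
    by (simp add: S_def)
  define M where "M = Max ((\<lambda>n. absv (F n)) ` S)"
  have le_M: "absv (F n) \<le> M" if "n \<in> S" for n
    unfolding M_def using finS that by (intro Max_ge) auto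
  define R where "R = {n \<in> S. absv (F n) = M}"
  have "M \<in> (\<lambda>n. absv (F n)) ` S"
    unfolding M_def using finS \<open>n0 \<in> S\<close> by (intro Max_in) auto
  then have "R \<noteq> {}"
    by (auto simp: R_def)
  moreover have finR: "finite R"
    using finS by (simp add: R_def)
  ultimately have a: "Min R \<in> R"
    by (intro Min_in)
  have *: "absv (F n) < absv (F (Min R))" if "n < Min R" for n
  proof -
    have "n \<notin> R"
    proof
      assume "n \<in> R"
      then have "Min R \<le> n"
        using finR by (intro Min_le)
      with that show False by simp
    qed
    show ?thesis
    proof (cases "n \<in> S")
      case True
      then show ?thesis
        using le_M[OF True] \<open>n \<notin> R\<close> a by (auto simp: R_def)
    next
      case False
      have "Min R \<le> n0"
        using a by (simp add: R_def S_def)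
      then have "absv (F n) < absv (F n0)"
        using False that by (auto simp: S_def)
      also have "\<dots> \<le> absv (F (Min R))"
        using le_M[OF \<open>n0 \<in> S\<close>] a by (simp add: R_def)
      finally show ?thesis .
    qed
  qed
  have "0 < absv (F (Min R))"
    using pos le_M[OF \<open>n0 \<in> S\<close>] a by (auto simp: R_def)
  then have "F (Min R) \<noteq> 0"
    by auto
  then show ?thesis
    using that * by blast
qed

lemma pmul_single_left: "pmul (single f 0) b = (\<lambda>j. f * b j)"
proof
  fix k
  have "pterm (single f 0) b k i = 0" if "i \<notin> {0}" for i
    using that by (simp add: pterm_def single_def)
  then have "pmul (single f 0) b k = pterm (single f 0) b k 0"
    unfolding pmul_def by (subst fsum_finite[of "{0}"]) auto
  also have "{m :: nat. m \<le> 0 \<and> 0 \<le> k + m} = {0}"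
    by auto
  then have "pterm (single f 0) b k 0 = f * b k"
    by (simp add: pterm_def single_def)
  finally show "pmul (single f 0) b k = f * b k" .
qed

lemma sym_euler: "sym (euler \<mu>) t n = (if n = 0 then t - \<mu> else 0)"
proof -
  have "sym (euler \<mu>) t n = (\<Sum>j\<in>{0, 1}. ff t j * cf (euler \<mu> j) (n + int j))"
    unfolding sym_def by (rule nsum_finite) (auto simp: euler_def)
  then show ?thesis
    by (auto simp: euler_def cf_def fps_X_def nat_eq_iff)
qed

end

context disc_complement
begin

text \<open>The left inverse is the sum of the powers of -S. As products are bounded only up to the
  constant C, smallness has to mean C \<delta> \<le> 1/2; then the n-th power has the bound
  2^(-n).\<close>

lemma Neumann:
  assumes c: "varpi p < c" and C: "\<And>a b B B'. nb c B a \<Longrightarrow> nb c B' b \<Longrightarrow> nb c (C * B * B') (pmul a b)"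
    and S: "S \<in> Dset" "nb c \<delta> S" "C * \<delta> \<le> 1 / 2" and "1 \<le> C"
  shows "\<exists>Q\<in>Dset. pmul Q (\<lambda>j. pone j + S j) = pone"
proof -
  have c0: "0 < c"
    using c varpi_pos by linarith
  have \<delta>0: "0 \<le> \<delta>"
    using nb_nonneg[OF S(2)] .
  define S' where "S' = (\<lambda>j. - S j)"
  have S': "S' \<in> Dset" "nb c \<delta> S'"
    using S by (simp_all add: S'_def Dset_uminus nb_def)
  define R where "R = rec_nat pone (\<lambda>_ x. pmul x S')"
  have R0: "R 0 = pone" and RS: "R (Suc n) = pmul (R n) S'" for n
    by (simp_all add: R_def)
  have R: "R n \<in> Dset" "nb c ((1 / 2) ^ n) (R n)" for n
  proof (induction n)
    case 0
    have "nb c (1 * c ^ 0) pone"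
      unfolding pone_single by (rule nb_single[OF bnd_one c0])
    then show "R 0 \<in> Dset" "nb c ((1 / 2) ^ 0) (R 0)"
      by (simp_all add: R0 Dset_one)
  next
    case (Suc n)
    then show "R (Suc n) \<in> Dset"
      unfolding RS using S'(1) by (intro Dset_pmul)
    have "nb c (C * (1 / 2) ^ n * \<delta>) (R (Suc n))"
      unfolding RS by (rule C[OF Suc(2) S'(2)])
    moreover have "C * (1 / 2) ^ n * \<delta> \<le> (1 / 2) ^ Suc n"
      using mult_left_mono[OF S(3), of "(1 / 2) ^ n"] by (simp add: mult_ac)
    ultimately show "nb c ((1 / 2) ^ Suc n) (R (Suc n))"
      using c0 by (auto intro: nb_mono)
  qed
  define Q where "Q j = fsum (\<lambda>n. R n j)" for j
  have null: "null_fps (\<lambda>n. R n j)" for j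
  proof (rule null_fps_geometric[of "1 / 2" "1 / c ^ j" 0])
    show "bnd (1 / c ^ j * (1 / 2) ^ (n - 0)) (R n j)" for n
      using nbD[OF R(2), of n j] by simp
  qed auto
  have tail: "nb c ((1 / 2) ^ N) (\<lambda>j. Q j - (\<Sum>n<N. R n j))" for N
    unfolding nb_def
  proof
    fix j
    have "bnd ((1 / 2) ^ N / c ^ j) ((\<Sum>n<N. R n j) - Q j)"
      unfolding Q_def
    proof (rule fsum_approx[OF null])
      show "0 < (1 / 2) ^ N / c ^ j"
        using c0 by simp
      fix n assume n: "\<not> bnd ((1 / 2) ^ N / c ^ j) (R n j)"
      show "n \<in> {..<N}"
      proof (rule ccontr)
        assume "n \<notin> {..<N}"
        then have "(1 / 2 :: real) ^ n \<le> (1 / 2) ^ N"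
          by (intro power_decreasing) auto
        then have "(1 / 2) ^ n / c ^ j \<le> (1 / 2) ^ N / c ^ j"
          using c0 by (intro divide_right_mono) auto
        then show False
          using n bnd_mono[OF nbD[OF R(2)]] by blast
      qed
    qed simp
    then show "bnd ((1 / 2) ^ N / c ^ j) (Q j - (\<Sum>n<N. R n j))"
      using bnd_uminus[of _ "Q j - (\<Sum>n<N. R n j)"] by simp
  qed
  have Q: "Q \<in> Dset"
  proof (rule DsetI[OF _ c])
    show "afun (Q j)" for j
      unfolding Q_def using null Dset_afun[OF R(1)] by (intro afun_fsum)
    show "nb c 1 Q"
      using tail[of 0] by simp
  qed
  have partial: "(\<lambda>j. \<Sum>n<N. R n j) \<in> Dset" for N
    by (induction N) (simp_all add: Dset_zero Dset_add R)
  have zero: "pmul (\<lambda>_. 0) S' = (\<lambda>_. 0)"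
  proof
    fix j
    have "pmul (\<lambda>_. 0) S' j = pmul (\<lambda>_. 0) S' j + pmul (\<lambda>_. 0) S' j"
      using fun_cong[OF pmul_add_left[OF Dset_zero Dset_zero S'(1)], of j] by (simp only: add_0)
    then show "pmul (\<lambda>_. 0) S' j = 0"
      by (metis add_cancel_right_right)
  qed
  have pm: "pmul (\<lambda>j. \<Sum>n<N. R n j) S' = (\<lambda>j. \<Sum>n<N. R (Suc n) j)" for N
  proof (induction N)
    case (Suc N)
    then show ?case
      using pmul_add_left[OF partial[of N] R(1)[of N] S'(1)] by (simp add: RS)
  qed (simp add: zero)
  \<comment> \<open>With \<open>?E\<close> the tail of Q after N terms, the defect equals the tail
    after N + 1 terms minus \<open>?E\<close> S', and both are bounded by 2^(-N).\<close>
  have "Q j - pone j - pmul Q S' j = 0" for j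
  proof (rule bnd_all_imp_zero)
    fix \<epsilon> :: real assume "0 < \<epsilon>"
    obtain N where "\<And>n. N \<le> n \<Longrightarrow> 1 / c ^ j * (1 / 2) ^ n < \<epsilon>"
      using power_small[of "1 / 2" \<epsilon> "1 / c ^ j"] \<open>0 < \<epsilon>\<close> by auto
    then have N: "(1 / 2) ^ N / c ^ j \<le> \<epsilon>"
      by (simp add: less_imp_le)
    let ?E = "\<lambda>j. Q j - (\<Sum>n<N. R n j)"
    have E: "?E \<in> Dset"
      by (intro Dset_diff Q partial)
    have "pmul Q S' = (\<lambda>j. pmul (\<lambda>j. \<Sum>n<N. R n j) S' j + pmul ?E S' j)"
      using pmul_add_left[OF partial[of N] E S'(1)] by simp
    moreover have "(\<Sum>n<Suc N. R n j) = pone j + (\<Sum>n<N. R (Suc n) j)"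
      unfolding R0[symmetric] by (rule sum.lessThan_Suc_shift)
    ultimately have eq: "Q j - pone j - pmul Q S' j = (Q j - (\<Sum>n<Suc N. R n j)) - pmul ?E S' j"
      unfolding pm by (simp add: algebra_simps)
    have "nb c (C * (1 / 2) ^ N * \<delta>) (pmul ?E S')"
      by (rule C[OF tail S'(2)])
    moreover have "C * (1 / 2) ^ N * \<delta> \<le> (1 / 2) ^ N"
      using mult_left_mono[OF S(3), of "(1 / 2) ^ N"] by (simp add: mult_ac)
    ultimately have 1: "nb c ((1 / 2) ^ N) (pmul ?E S')"
      using c0 by (auto intro: nb_mono)
    have 2: "nb c ((1 / 2) ^ N) (\<lambda>j. Q j - (\<Sum>n<Suc N. R n j))"
      using c0 by (intro nb_mono[OF tail]) auto
    show "bnd \<epsilon> (Q j - pone j - pmul Q S' j)"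
      unfolding eq using nbD[OF 1, of j] nbD[OF 2, of j] by (intro bnd_mono[OF bnd_diff N])
  qed
  then have QS': "pmul Q S' j = Q j - pone j" for j
    by (simp add: algebra_simps)
  have "Q = pmul Q (\<lambda>j. (pone j + S j) + S' j)"
    using pmul_one_right[OF Q] by (simp add: S'_def)
  also have "\<dots> = (\<lambda>j. pmul Q (\<lambda>j. pone j + S j) j + pmul Q S' j)"
    by (intro pmul_add_right Dset_add Dset_one S S' Q)
  finally have "Q j = pmul Q (\<lambda>j. pone j + S j) j + (Q j - pone j)" for j
    using QS' by metis
  then have "pmul Q (\<lambda>j. pone j + S j) = pone"
    by (simp add: fun_eq_iff)
  then show ?thesis
    using Q by blast
qed

section \<open>Isolating a single component\<close>

lemma sym_pmul_single_left:
  assumes "afun f" "b \<in> Dset" "Zlike t"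
  shows "sym (pmul (single f k) b) t n = nsum (\<lambda>m. ff (t + of_int m) k * cf f (n - m + int k) * sym b t m)"
    and "null_family (\<lambda>m. ff (t + of_int m) k * cf f (n - m + int k) * sym b t m)"
  using sym_pmul_Dset[OF Dset_single[OF assms(1)] assms(2,3), of k n]
    null_sym_product[OF Dset_single[OF assms(1)] assms(2,3), of k n]
  by (simp_all add: sym_single)

text \<open>Each x\<partial> - \<mu> acts on powers of x by the scalar t - \<mu>, so products of
  such operators realise polynomials in the exponent as diagonal operators.\<close>

lemma euler_product:
  fixes m :: nat and \<mu> :: "nat \<Rightarrow> 'k"
  shows "\<exists>e\<in>Dset. \<forall>t n. Zlike t \<longrightarrow> sym e t n = (if n = 0 then w * (\<Prod>i<m. t - \<mu> i) else 0)"
proof (induction m)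
  case 0
  have "sym (single (fps_const w) 0) t n = (if n = 0 then w else 0)" for t n
    by (simp add: sym_single cf_def)
  then show ?case
    by (intro bexI[of _ "single (fps_const w) 0"]) (auto intro: Dset_single)
next
  case (Suc m)
  then obtain e where e: "e \<in> Dset"
    "\<And>t n. Zlike t \<Longrightarrow> sym e t n = (if n = 0 then w * (\<Prod>i<m. t - \<mu> i) else 0)"
    by blast
  have "sym (pmul e (euler (\<mu> m))) t n = (if n = 0 then w * (\<Prod>i<Suc m. t - \<mu> i) else 0)" if "Zlike t" for t n
  proof -
    have "sym (pmul e (euler (\<mu> m))) t n = sym e (t + of_int 0) (n - 0) * sym (euler (\<mu> m)) t 0"
      unfolding sym_pmul_Dset[OF e(1) euler_Dset that] by (rule nsum_single) (simp add: sym_euler)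
    then show ?thesis
      using e(2)[OF that] by (simp add: sym_euler mult.assoc)
  qed
  then show ?case
    using Dset_pmul[OF e(1) euler_Dset] by blast
qed

text \<open>As a polynomial in \<open>x\<partial> - l\<close>, it isolates the component \<open>x\<^bsup>l+a\<^esup>\<close> among those within distance
  \<open>L\<close>; being integer valued, it does not enlarge the others.\<close>

definition bump :: "int \<Rightarrow> nat \<Rightarrow> int \<Rightarrow> 'k" where
  "bump a L n = inverse ((- 1) ^ L * of_nat (fact L * fact L)) *
     (ff (of_int (n - a - 1)) L * ff (of_int (n - a + int L)) L)"

lemma fact_nonzero: "of_nat (fact m) \<noteq> (0 :: 'k)"
  using afact_pos[of m] by auto

text \<open>Both falling factorials are taken at integers, so each is divisible by L! and
  compensates one factor L! of the denominator.\<close>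

lemma absv_bump_le: "absv (bump a L n) \<le> 1"
proof -
  have "absv (ff (of_int (n - a - 1)) L * ff (of_int (n - a + int L)) L) \<le> afact L * afact L"
    by (intro absv_mult_le absv_ff_of_int)
  then have "absv (bump a L n) \<le> inverse (afact L * afact L) * (afact L * afact L)"
    unfolding bump_def absv_mult[of "inverse _"]
    using afact_pos[of L] by (intro mult_mono) (auto simp: absv_inverse absv_mult absv_power absv_nonneg)
  also have "\<dots> = 1"
    using afact_pos[of L] by (intro left_inverse) auto
  finally show ?thesis .
qed

text \<open>At n = a the two falling factorials are (-1)^L L! and L!, which is the origin of the
  normalising factor.\<close>

lemma bump_self: "bump a L a = 1"
proof -
  have 1: "ff (- 1 :: 'k) L = (- 1) ^ L * of_nat (fact L)"
  proof (induction L)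
    case (Suc L)
    have "ff (- 1 :: 'k) (Suc L) = (- 1) ^ L * of_nat (fact L) * (- of_nat (Suc L))"
      unfolding ff_Suc Suc by simp
    then show ?case
      by (simp add: algebra_simps)
  qed simp
  have 2: "ff (of_nat L :: 'k) L = of_nat (fact L)"
    by (simp add: ff_of_nat)
  have "of_int (a - a - 1) = (- 1 :: 'k)" "of_int (a - a + int L) = (of_nat L :: 'k)"
    by simp_all
  then show ?thesis
    unfolding bump_def using fact_nonzero[of L] by (simp only: 1 2) (simp add: field_simps)
qed

text \<open>The first falling factorial vanishes at a + 1, ..., a + L and the second one at a - L,
  ..., a - 1.\<close>

lemma bump_eq_0:
  assumes "n \<noteq> a" "\<bar>n - a\<bar> \<le> int L"
  shows "bump a L n = 0"
proof -
  have ff0: "ff (of_int z) L = (0 :: 'k)" if "0 \<le> z" "z < int L" for z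
    using that unfolding ff_def by (intro prod_zero bexI[of _ "nat z"]) auto
  show ?thesis
  proof (cases "a < n")
    case True
    then show ?thesis
      using assms ff0[of "n - a - 1"] by (simp add: bump_def)
  next
    case False
    then show ?thesis
      using assms ff0[of "n - a + int L"] by (simp add: bump_def)
  qed
qed

text \<open>Every factor of \<open>bump\<close> at n is the exponent l + n minus a constant, hence
  comes from an operator x\<partial> - \<mu>.\<close>

lemma bump_operator:
  obtains e where "e \<in> Dset"
    "\<And>x n. x \<in> Dset \<Longrightarrow> Zlike l \<Longrightarrow> sym (pmul e x) l n = bump a L n * sym x l n"
proof -
  let ?w = "inverse ((- 1) ^ L * of_nat (fact L * fact L)) :: 'k"
  obtain e1 where e1: "e1 \<in> Dset" "\<And>t n. Zlike t \<Longrightarrow>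
      sym e1 t n = (if n = 0 then ?w * (\<Prod>i<L. t - (l + of_int (a + 1) + of_nat i)) else 0)"
    using euler_product[where w = ?w and m = L and \<mu> = "\<lambda>i. l + of_int (a + 1) + of_nat i"] by blast
  obtain e2 where e2: "e2 \<in> Dset" "\<And>t n. Zlike t \<Longrightarrow>
      sym e2 t n = (if n = 0 then 1 * (\<Prod>i<L. t - (l + of_int (a - int L) + of_nat i)) else 0)"
    using euler_product[where w = 1 and m = L and \<mu> = "\<lambda>i. l + of_int (a - int L) + of_nat i"] by blast
  have act: "sym (pmul e x) l n = g n * sym x l n"
    if "e \<in> Dset" "x \<in> Dset" "Zlike l" "\<And>m n. sym e (l + of_int m) n = (if n = 0 then g m else 0)"
    for e x n and g :: "int \<Rightarrow> 'k"
  proof -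
    have "sym (pmul e x) l n = sym e (l + of_int n) (n - n) * sym x l n"
      unfolding sym_pmul_Dset[OF that(1,2,3)] by (rule nsum_single) (simp add: that(4))
    then show ?thesis
      by (simp add: that(4))
  qed
  have "sym (pmul (pmul e1 e2) x) l n = bump a L n * sym x l n" if x: "x \<in> Dset" "Zlike l" for x n
  proof -
    have p1: "sym e1 (l + of_int m) k = (if k = 0 then ?w * ff (of_int (m - a - 1)) L else 0)" for m k
      using e1(2)[OF Zlike_shift[OF x(2)]] by (simp add: ff_def algebra_simps)
    have p2: "sym e2 (l + of_int m) k = (if k = 0 then ff (of_int (m - a + int L)) L else 0)" for m k
      using e2(2)[OF Zlike_shift[OF x(2)]] by (simp add: ff_def algebra_simps)
    have "sym (pmul (pmul e1 e2) x) l n = sym (pmul e1 (pmul e2 x)) l n"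
      using e1(1) e2(1) x(1) by (simp add: pmul_assoc)
    also have "\<dots> = (?w * ff (of_int (n - a - 1)) L) * (ff (of_int (n - a + int L)) L * sym x l n)"
      using act[OF e1(1) Dset_pmul[OF e2(1) x(1)] x(2) p1] act[OF e2(1) x p2] by simp
    finally show ?thesis
      by (simp add: bump_def mult.assoc)
  qed
  then show ?thesis
    using that[of "pmul e1 e2"] Dset_pmul[OF e1(1) e2(1)] by blast
qed

text \<open>Multiplying S by the operator of \<open>bump_operator\<close> may enlarge its bound by a
  factor depending on L. Instead, the coefficient of x^n \<partial>^j, a term that shifts exponents
  by n - j, is multiplied by \<open>bump a L (n - j)\<close>. The effect on x^l is the same, and the
  bound \<epsilon> is kept.\<close>

lemma bump_multiplier:
  assumes S: "S \<in> Dset" "nb c \<epsilon> S" and c: "varpi p < c"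
  obtains S' where "S' \<in> Dset" "nb c \<epsilon> S'" "\<And>l n. Zlike l \<Longrightarrow> sym S' l n = bump a L n * sym S l n"
proof -
  define S' where "S' j = Abs_fps (\<lambda>n. bump a L (int n - int j) * S j $ n)" for j
  have nb: "nb c \<epsilon> S'"
    unfolding nb_def bnd_def
  proof (intro allI)
    fix j n
    have "absv (bump a L (int n - int j) * S j $ n) \<le> 1 * (\<epsilon> / c ^ j)"
      by (intro absv_mult_le absv_bump_le bndD[OF nbD[OF S(2)]])
    then show "absv (S' j $ n) \<le> \<epsilon> / c ^ j"
      by (simp add: S'_def)
  qed
  \<comment> \<open>For fixed j the multiplier is a polynomial in n, a constant times two products
    of L linear factors.\<close>
  have "afun (S' j)" for j
  proof -
    let ?w = "inverse ((- 1) ^ L * of_nat (fact L * fact L)) :: 'k"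
    define g where "g = Abs_fps (\<lambda>n. (\<Prod>i\<in>{..<L}. of_nat n - of_int (a + 1 + int j + int i)) * S j $ n)"
    define h where "h = Abs_fps (\<lambda>n. (\<Prod>i\<in>{..<L}. of_nat n - of_int (a - int L + int j + int i)) * g $ n)"
    have "afun h"
      unfolding h_def g_def by (intro afun_multiplier Dset_afun S finite_lessThan)
    moreover have "S' j = fps_const ?w * h"
      by (rule fps_ext) (simp add: S'_def bump_def h_def g_def ff_def algebra_simps)
    ultimately show ?thesis
      by (simp add: afun_mult)
  qed
  then have "S' \<in> Dset"
    using nb c by (intro DsetI)
  moreover have "sym S' l n = bump a L n * sym S l n" if "Zlike l" for l n
  proof -
    have "cf (S' j) (n + int j) = bump a L n * cf (S j) (n + int j)" for j
      by (simp add: cf_def S'_def)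
    then show ?thesis
      unfolding sym_def using nsum_cmult[OF null_sym[OF S(2) c that], of "bump a L n" n]
      by (simp add: mult_ac)
  qed
  ultimately show ?thesis
    using that nb by blast
qed

text \<open>\<open>J\<close> stands for a left ideal that contains all left multiples of
  \<open>euler l\<close>, given through its closure properties.\<close>

context
  fixes l :: 'k and J :: "(nat \<Rightarrow> 'k fps) set"
  assumes l: "Zlike l" and l_int: "\<And>z :: int. l \<noteq> of_int z"
    and J_sub: "J \<subseteq> Dset"
    and J_add: "\<And>x y. x \<in> J \<Longrightarrow> y \<in> J \<Longrightarrow> (\<lambda>j. x j + y j) \<in> J"
    and J_mult: "\<And>q x. q \<in> Dset \<Longrightarrow> x \<in> J \<Longrightarrow> pmul q x \<in> J"
    and J_euler: "\<And>q. q \<in> Dset \<Longrightarrow> pmul q (euler l) \<in> J"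
begin

lemma l_nat: "l \<noteq> of_nat i"
  using l_int[of "int i"] by simp

text \<open>\<open>J\<close> contains every operator that kills x^l, so membership depends only on
  the effect on x^l. This freedom is what keeps the error terms small below.\<close>

lemma mem_if_sym_eq:
  assumes "x \<in> J" "y \<in> Dset" "\<And>n. sym y l n = sym x l n"
  shows "y \<in> J"
proof -
  have x: "x \<in> Dset"
    using assms(1) J_sub by blast
  have d: "(\<lambda>j. y j - x j) \<in> Dset"
    by (rule Dset_diff[OF assms(2) x])
  moreover have "sym (\<lambda>j. y j - x j) l n = 0" for n
    using assms(3) by (simp add: sym_diff_Dset[OF assms(2) x l])
  ultimately obtain q where "q \<in> Dset" "pmul q (euler l) = (\<lambda>j. y j - x j)"
    using euler_multiple[OF l l_nat] by blast
  then have "(\<lambda>j. y j - x j) \<in> J"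
    using J_euler by metis
  from J_add[OF assms(1) this] show ?thesis
    by simp
qed

lemma one_mem_if_dominant_nat:
  assumes b: "b \<in> J" and a: "sym b l (int a) \<noteq> 0" "\<And>n. n < int a \<Longrightarrow> absv (sym b l n) < absv (sym b l (int a))"
  shows "pone \<in> J"
proof -
  have bD: "b \<in> Dset"
    using b J_sub by blast
  obtain c0 B0 where c0: "varpi p < c0" "nb c0 B0 b"
    using bD by (rule DsetE)
  \<comment> \<open>A radius below c0: measured at c, the coefficients of b tend to 0, so high
    orders count as error.\<close>
  define c where "c = (varpi p + c0) / 2"
  have c: "varpi p < c" "c < c0" "0 < c"
    using c0(1) varpi_pos by (auto simp: c_def)
  obtain C1 where C1: "1 \<le> C1" "\<And>a B t n. nb c B a \<Longrightarrow> Zlike t \<Longrightarrow> absv (sym a t n) \<le> C1 * B"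
    using sym_bound_nb[OF c(1)] by blast
  obtain C where C: "1 \<le> C"
    "\<And>a b B B'. nb c B a \<Longrightarrow> nb c B' b \<Longrightarrow> nb c (C * B * B') (pmul a b)"
    by (rule pmul_bound[OF c(1)]) (rule that; assumption)
  define r where "r = absv (sym b l (int a))"
  have r: "0 < r"
    using a(1) absv_eq_0_iff absv_nonneg unfolding r_def by (metis less_eq_real_def)
  \<comment> \<open>The factor produced by \<partial>^a on x^(l+a). It is nonzero because l is not
    an integer.\<close>
  have ffa: "ff (l + of_nat a) a \<noteq> 0"
    unfolding ff_def
  proof (subst prod_zero_iff, simp, clarify)
    fix i assume "l + of_nat a - of_nat i = 0"
    then have "l = of_int (int i - int a)"
      by (simp add: algebra_simps)
    then show False
      using l_int by blast
  qed
  define k0 where "k0 = absv (ff (l + of_nat a) a) * r"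
  have k0: "0 < k0"
    using ffa r absv_eq_0_iff absv_nonneg unfolding k0_def by (metis less_eq_real_def mult_pos_pos)
  \<comment> \<open>The first entry keeps the symbol of the error below the dominant value r. The
    second makes the error, after \<partial>^a and division by a scalar of size k0, small enough for
    the Neumann series. Neither depends on the exponent N or on the width L, which are chosen
    later.\<close>
  define \<epsilon> where "\<epsilon> = min (r / (2 * C1)) (k0 / (2 * (C * (C * c ^ a))))"
  have \<epsilon>: "0 < \<epsilon>" "C1 * \<epsilon> < r" "C * (C * c ^ a * \<epsilon>) \<le> k0 / 2"
  proof -
    have CC: "0 < C * (C * c ^ a)"
      using C(1) c(3) by simp
    show "0 < \<epsilon>"
      unfolding \<epsilon>_def using r k0 CC C1(1) by (simp add: divide_pos_pos)
    have "C1 * \<epsilon> \<le> C1 * (r / (2 * C1))"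
      unfolding \<epsilon>_def using C1(1) by (intro mult_left_mono) auto
    also have "\<dots> < r"
      using r C1(1) by simp
    finally show "C1 * \<epsilon> < r" .
    have "C * (C * c ^ a) * \<epsilon> \<le> C * (C * c ^ a) * (k0 / (2 * (C * (C * c ^ a))))"
      unfolding \<epsilon>_def using CC by (intro mult_left_mono) auto
    also have "\<dots> = k0 / 2"
    proof -
      have "x * (k0 / (2 * x)) = k0 / 2" if "0 < x" for x
        using that by simp
      from this[OF CC] show ?thesis .
    qed
    finally show "C * (C * c ^ a * \<epsilon>) \<le> k0 / 2"
      by (simp add: mult.assoc)
  qed
  obtain J0 where J0: "\<And>j. J0 \<le> j \<Longrightarrow> B0 * (c / c0) ^ j < \<epsilon>"
    using power_small[of "c / c0" \<epsilon> B0] c \<epsilon>(1) by auto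
  \<comment> \<open>Only the orders below J0 need approximation, so one exponent N clears the
    denominators of all of them.\<close>
  have "eventually (\<lambda>N. \<forall>j\<in>{..<J0}. \<exists>q. fpoly q \<and> bnd (\<epsilon> / c ^ j) (b j * den ^ N - q)) sequentially"
    using c(3) \<epsilon>(1) Dset_afun[OF bD]
    by (intro eventually_ball_finite ballI afun_eventually) auto
  then obtain N where "\<forall>j\<in>{..<J0}. \<exists>q. fpoly q \<and> bnd (\<epsilon> / c ^ j) (b j * den ^ N - q)"
    by (auto dest: eventually_happens)
  from bchoice[OF this] obtain q where
    q: "\<And>j. j < J0 \<Longrightarrow> fpoly (q j)" "\<And>j. j < J0 \<Longrightarrow> bnd (\<epsilon> / c ^ j) (b j * den ^ N - q j)"
    by auto
  define x1 where "x1 = pmul (single (den ^ N) 0) b"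
  define P where "P j = (if j < J0 then q j else 0)" for j
  define S where "S j = den ^ N * b j - P j" for j
  have den: "afun (den ^ N)"
    by (intro afun_fpoly fpoly_power fpoly_den)
  have x1_eq: "x1 = (\<lambda>j. P j + S j)"
    unfolding x1_def pmul_single_left S_def by simp
  have x1: "x1 \<in> J"
    unfolding x1_def by (intro J_mult Dset_single den b)
  have nbS: "nb c \<epsilon> S"
    unfolding nb_def
  proof
    fix j
    show "bnd (\<epsilon> / c ^ j) (S j)"
    proof (cases "j < J0")
      case True
      then show ?thesis
        using q(2)[OF True] by (simp add: S_def P_def mult.commute)
    next
      case False
      have "bnd (B0 / c0 ^ j) (den ^ N * b j)"
        by (intro bnd_mult_left bnd_power bnd_den nbD[OF c0(2)])
      moreover have "B0 / c0 ^ j = B0 * (c / c0) ^ j / c ^ j"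
        using c by (simp add: power_divide)
      moreover have "\<dots> \<le> \<epsilon> / c ^ j"
        using J0[of j] False c(3) by (intro divide_right_mono) auto
      ultimately show ?thesis
        using False bnd_mono by (simp add: S_def P_def)
    qed
  qed
  have SD: "S \<in> Dset"
  proof (rule DsetI[OF _ c(1) nbS])
    show "afun (S j)" for j
      unfolding S_def P_def using den Dset_afun[OF bD] q(1)
      by (intro afun_diff afun_mult) (auto intro: afun_fpoly)
  qed
  have PD: "P \<in> Dset"
  proof -
    have "P = (\<lambda>j. x1 j - S j)"
      unfolding x1_eq by simp
    then show ?thesis
      using Dset_diff[OF _ SD] x1 J_sub by auto
  qed
  have F1: "sym x1 l n = sym P l n + sym S l n" for n
    unfolding x1_eq by (rule sym_add_Dset[OF PD SD l])
  \<comment> \<open>The constant term of den^N is a unit, so the term m = a has size r. The terms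
    with m < a are strictly smaller by the choice of a, and those with m > a vanish.\<close>
  have "absv (sym x1 l (int a)) = r"
  proof -
    let ?s = "\<lambda>m. ff (l + of_int m) 0 * cf (den ^ N) (int a - m + int 0) * sym b l m"
    have null: "null_family ?s"
      by (rule sym_pmul_single_left(2)[OF den bD l])
    have "sym x1 l (int a) = nsum ?s"
      unfolding x1_def by (rule sym_pmul_single_left(1)[OF den bD l])
    also have "\<dots> = ?s (int a) + nsum (\<lambda>m. if m = int a then 0 else ?s m)"
      by (rule nsum_remove[OF null])
    finally have eq: "sym x1 l (int a) = ?s (int a) + nsum (\<lambda>m. if m = int a then 0 else ?s m)" .
    have "(den ^ N) $ 0 = (den $ 0) ^ N"
      by (simp add: fps_nth_power_0)
    then have 1: "absv (?s (int a)) = r"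
      by (simp add: cf_def absv_mult absv_power absv_den_0 r_def)
    have "absv (nsum (\<lambda>m. if m = int a then 0 else ?s m)) < r"
    proof (rule absv_nsum_less[OF _ r])
      show "null_family (\<lambda>m. if m = int a then 0 else ?s m)"
        by (rule null_family_le[OF null]) (simp add: absv_nonneg)
      fix m
      show "absv (if m = int a then 0 else ?s m) < r"
      proof (cases "m < int a")
        case True
        have "absv (?s m) \<le> 1 * absv (sym b l m)"
          using absv_cf_le[OF bnd_power[OF bnd_den]] by (intro absv_mult_le) auto
        also have "\<dots> < r"
          using a(2)[OF True] by (simp add: r_def)
        finally show ?thesis
          using r by simp
      next
        case False
        then show ?thesis
          using r by (simp add: cf_def)
      qed
    qed
    then have "absv (nsum (\<lambda>m. if m = int a then 0 else ?s m)) < absv (?s (int a))"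
      unfolding 1 .
    from absv_add_eq[OF this] show ?thesis
      unfolding eq 1 .
  qed
  moreover have FS: "absv (sym S l n) < r" for n
    using C1(2)[OF nbS l] \<epsilon>(2) le_less_trans by blast
  ultimately have FP: "absv (sym P l (int a)) = r"
    using absv_add_eq[of "- sym S l (int a)" "sym x1 l (int a)"] F1[of "int a"] by simp
  have "finite {n. sym P l n \<noteq> 0}"
  proof -
    have P_sum: "sym P l n = (\<Sum>j<J0. ff l j * cf (q j) (n + int j))" for n
    proof -
      have "sym P l n = (\<Sum>j\<in>{..<J0}. ff l j * cf (P j) (n + int j))"
        unfolding sym_def by (rule nsum_finite) (auto simp: P_def)
      then show ?thesis
        by (simp add: P_def)
    qed
    have "finite {n. cf (q j) (n + int j) \<noteq> 0}" if "j < J0" for j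
    proof -
      obtain d where d: "\<forall>n>d. q j $ n = 0"
        using q(1)[OF \<open>j < J0\<close>] fpoly_def by blast
      have "n \<in> {- int j..int d}" if "cf (q j) (n + int j) \<noteq> 0" for n
      proof -
        have "0 \<le> n + int j" "q j $ nat (n + int j) \<noteq> 0"
          using that by (auto simp: cf_def split: if_splits)
        moreover from this d have "\<not> d < nat (n + int j)"
          by blast
        ultimately show ?thesis
          by auto
      qed
      then have "{n. cf (q j) (n + int j) \<noteq> 0} \<subseteq> {- int j..int d}"
        by blast
      then show ?thesis
        using finite_subset by blast
    qed
    then have "finite (\<Union>j\<in>{..<J0}. {n. cf (q j) (n + int j) \<noteq> 0})"
      by auto
    moreover have "{n. sym P l n \<noteq> 0} \<subseteq> (\<Union>j\<in>{..<J0}. {n. cf (q j) (n + int j) \<noteq> 0})"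
    proof
      fix n assume "n \<in> {n. sym P l n \<noteq> 0}"
      then obtain j where "j < J0" "ff l j * cf (q j) (n + int j) \<noteq> 0"
        unfolding P_sum by (auto elim: sum.not_neutral_contains_not_neutral)
      then show "n \<in> (\<Union>j\<in>{..<J0}. {n. cf (q j) (n + int j) \<noteq> 0})"
        by auto
    qed
    ultimately show ?thesis
      by (rule rev_finite_subset)
  qed
  then have "finite ((\<lambda>n. nat \<bar>n - int a\<bar>) ` {n. sym P l n \<noteq> 0})"
    by simp
  \<comment> \<open>L covers the distance from a to every component of P x^l, so the bump removes
    all of them except the one at a.\<close>
  then obtain L where "\<forall>x\<in>(\<lambda>n. nat \<bar>n - int a\<bar>) ` {n. sym P l n \<noteq> 0}. x \<le> L"
    using finite_nat_set_iff_bounded_le by blast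
  then have L: "\<bar>n - int a\<bar> \<le> int L" if "sym P l n \<noteq> 0" for n
    using that by auto
  obtain e where e: "e \<in> Dset"
    "\<And>x n. x \<in> Dset \<Longrightarrow> Zlike l \<Longrightarrow> sym (pmul e x) l n = bump (int a) L n * sym x l n"
    using bump_operator[where l = l] by blast
  obtain S' where S': "S' \<in> Dset" "nb c \<epsilon> S'"
    "\<And>l n. Zlike l \<Longrightarrow> sym S' l n = bump (int a) L n * sym S l n"
    using bump_multiplier[OF SD nbS c(1)] by blast
  define k where "k = sym P l (int a)"
  \<comment> \<open>Has the same effect on x^l as the bump operator applied to
    \<open>P\<close>.\<close>
  define f where "f = fps_const k * fps_X ^ a"
  have f: "afun f"
    unfolding f_def by (intro afun_mult afun_const afun_power afun_X)
  have cf_f: "cf f n = (if n = int a then k else 0)" for n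
    by (auto simp: f_def cf_def fps_X_power_nth)
  define W where "W j = single f 0 j + S' j" for j
  have WD: "W \<in> Dset"
    unfolding W_def by (intro Dset_add Dset_single f S')
  have "W \<in> J"
  proof (rule mem_if_sym_eq[OF J_mult[OF e(1) x1] WD])
    fix n
    have "sym W l n = (if n = int a then k else 0) + bump (int a) L n * sym S l n"
      unfolding W_def sym_add_Dset[OF Dset_single[OF f] S'(1) l] by (simp add: sym_single cf_f S'(3)[OF l])
    moreover have "sym (pmul e x1) l n = bump (int a) L n * sym P l n + bump (int a) L n * sym S l n"
      using x1 J_sub by (subst e(2)[OF _ l]) (auto simp: F1 distrib_left)
    moreover have "bump (int a) L n * sym P l n = (if n = int a then k else 0)"
      using L[of n] bump_eq_0[of n "int a" L] bump_self[of "int a" L] by (auto simp: k_def)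
    ultimately show "sym W l n = sym (pmul e x1) l n"
      by simp
  qed
  define D where "D = single 1 a"
  have D: "D \<in> Dset"
    unfolding D_def by (rule Dset_single) simp
  have nb_D: "nb c (1 * c ^ a) D"
    unfolding D_def by (rule nb_single[OF bnd_one c(3)])
  define S2 where "S2 = pmul D S'"
  have S2: "S2 \<in> Dset" "nb c (C * c ^ a * \<epsilon>) S2"
    unfolding S2_def using Dset_pmul[OF D S'(1)] C(2)[OF nb_D S'(2)] by simp_all
  define \<kappa> where "\<kappa> = ff (l + of_nat a) a * k"
  have \<kappa>: "absv \<kappa> = k0"
    by (simp add: \<kappa>_def k_def absv_mult FP k0_def)
  have \<kappa>0: "\<kappa> \<noteq> 0"
    using \<kappa> k0 by auto
  \<comment> \<open>The composite of \<partial>^a with f is traded for the constant \<kappa>, which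
    acts on x^l in the same way; only the image of the error under \<partial>^a remains.\<close>
  define V where "V j = single (fps_const \<kappa>) 0 j + S2 j" for j
  have VD: "V \<in> Dset"
    unfolding V_def by (intro Dset_add Dset_single afun_const S2)
  have "V \<in> J"
  proof (rule mem_if_sym_eq[OF J_mult[OF D \<open>W \<in> J\<close>] VD])
    fix n
    have "sym (pmul D (single f 0)) l n =
        ff (l + of_int (int a)) a * cf 1 (n - int a + int a) * sym (single f 0) l (int a)"
      unfolding D_def sym_pmul_single_left(1)[OF afun_one Dset_single[OF f] l]
      by (rule nsum_single) (simp add: sym_single cf_f)
    then have 1: "sym (pmul D (single f 0)) l n = (if n = 0 then \<kappa> else 0)"
      by (simp add: sym_single cf_f cf_one \<kappa>_def)
    have "pmul D W = (\<lambda>j. pmul D (single f 0) j + S2 j)"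
      unfolding W_def S2_def by (rule pmul_add_right[OF Dset_single[OF f] S'(1) D])
    then have "sym (pmul D W) l n = (if n = 0 then \<kappa> else 0) + sym S2 l n"
      by (simp add: sym_add_Dset[OF Dset_pmul[OF D Dset_single[OF f]] S2(1) l] 1)
    moreover have "sym V l n = (if n = 0 then \<kappa> else 0) + sym S2 l n"
      unfolding V_def sym_add_Dset[OF Dset_single[OF afun_const] S2(1) l]
      by (simp add: sym_single cf_def)
    ultimately show "sym V l n = sym (pmul D W) l n"
      by simp
  qed
  define S3 where "S3 j = fps_const (inverse \<kappa>) * S2 j" for j
  have S3D: "S3 \<in> Dset"
    using Dset_pmul[OF Dset_single[OF afun_const] S2(1), of "inverse \<kappa>" 0]
    by (simp add: pmul_single_left S3_def[abs_def])
  have nbS3: "nb c (C * c ^ a * \<epsilon> / k0) S3"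
    unfolding nb_def
  proof
    fix j
    have "bnd (absv (inverse \<kappa>) * (C * c ^ a * \<epsilon> / c ^ j)) (S3 j)"
      unfolding S3_def by (rule bnd_const_mult[OF nbD[OF S2(2)]])
    then show "bnd (C * c ^ a * \<epsilon> / k0 / c ^ j) (S3 j)"
      unfolding absv_inverse \<kappa> by (simp add: field_simps)
  qed
  have "C * (C * c ^ a * \<epsilon> / k0) \<le> 1 / 2"
    using \<epsilon>(3) k0 by (simp add: field_simps)
  from Neumann[OF c(1) C(2) S3D nbS3 this C(1)] obtain Q where
    Q: "Q \<in> Dset" "pmul Q (\<lambda>j. pone j + S3 j) = pone"
    by blast
  have "pmul (single (fps_const (inverse \<kappa>)) 0) V = (\<lambda>j. pone j + S3 j)"
    using \<kappa>0 by (auto simp: pmul_single_left V_def S3_def pone_def single_def fun_eq_iff distrib_left)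
  then have "(\<lambda>j. pone j + S3 j) \<in> J"
    using J_mult[OF Dset_single[OF afun_const] \<open>V \<in> J\<close>] by metis
  then show ?thesis
    using J_mult[OF Q(1)] Q(2) by metis
qed

text \<open>Since \<partial>^a requires a \<ge> 0, a negative dominant index is first moved to 0 by
  a power of x, which merely shifts the symbol.\<close>

lemma one_mem_if_sym_nonzero:
  assumes b: "b \<in> J" "sym b l n0 \<noteq> 0"
  shows "pone \<in> J"
proof -
  have bD: "b \<in> Dset"
    using b J_sub by blast
  obtain c B where c: "varpi p < c" "nb c B b"
    using bD by (rule DsetE)
  obtain K \<rho> where K: "0 \<le> K" "0 \<le> \<rho>" "\<rho> < 1"
    "\<And>t n. Zlike t \<Longrightarrow> absv (sym b t n) \<le> K * \<rho> ^ nat (- n)" "\<And>t n. Zlike t \<Longrightarrow> absv (sym b t n) \<le> K"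
    using sym_bound[OF c(2,1)] by blast
  obtain a where a: "sym b l a \<noteq> 0" "\<And>n. n < a \<Longrightarrow> absv (sym b l n) < absv (sym b l a)"
    using dominant_index[OF K(2,3) K(4)[OF l] b(2)] by blast
  define s where "s = nat (- a)"
  define b' where "b' = pmul (single (fps_X ^ s) 0) b"
  have X: "afun (fps_X ^ s)"
    by (intro afun_power afun_X)
  have b': "b' \<in> J"
    unfolding b'_def by (intro J_mult Dset_single X b)
  have cf_X: "cf (fps_X ^ s) z = (if z = int s then 1 else 0)" for z
    by (auto simp: cf_def fps_X_power_nth)
  have shift: "sym b' l n = sym b l (n - int s)" for n
  proof -
    have "sym b' l n = ff (l + of_int (n - int s)) 0 * cf (fps_X ^ s) (n - (n - int s) + int 0) * sym b l (n - int s)"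
      unfolding b'_def sym_pmul_single_left(1)[OF X bD l]
      by (rule nsum_single) (simp add: cf_X)
    then show ?thesis
      by (simp add: cf_X)
  qed
  define a' where "a' = nat (a + int s)"
  have a': "int a' = a + int s"
    by (auto simp: a'_def s_def)
  show ?thesis
    by (rule one_mem_if_dominant_nat[OF b', of a']) (use a in \<open>auto simp: shift a'\<close>)
qed

end

end

section \<open>Quotients of a ring by a left ideal\<close>

locale left_ideal = ring R + abelian_subgroup I R for I and R (structure) +
  assumes left_closed: "\<lbrakk>r \<in> carrier R; a \<in> I\<rbrakk> \<Longrightarrow> r \<otimes> a \<in> I"
begin

abbreviation quot :: "('a, 'a set) module" where
  "quot \<equiv> quot_left_module R I"

lemma coset_eq_iff:
  assumes "a \<in> carrier R" "b \<in> carrier R"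
  shows "I +> a = I +> b \<longleftrightarrow> a \<ominus> b \<in> I"
  using assms a_rcos_module_minus[OF ring_axioms assms(2,1)]
  by (metis a_rcos_self a_repr_independence' a_repr_independenceD)

lemma coset_add:
  "a \<in> carrier R \<Longrightarrow> b \<in> carrier R \<Longrightarrow> (I +> a) \<oplus>\<^bsub>quot\<^esub> (I +> b) = I +> (a \<oplus> b)"
  by (simp add: quot_left_module_def a_rcos_sum)

text \<open>The union over all representatives is a single coset: I is closed under left
  multiplication, so it contains r (b - a) together with b - a.\<close>

lemma coset_smult:
  assumes "r \<in> carrier R" "a \<in> carrier R"
  shows "r \<odot>\<^bsub>quot\<^esub> (I +> a) = I +> (r \<otimes> a)"
proof -
  have eq: "I +> (r \<otimes> b) = I +> (r \<otimes> a)" if b: "b \<in> I +> a" for b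
  proof -
    have bc: "b \<in> carrier R"
      using b assms(2) a_subset by (meson a_elemrcos_carrier)
    have "b \<ominus> a \<in> I"
      using b assms(2) bc a_rcos_module_minus[OF ring_axioms assms(2) bc] by simp
    then have "r \<otimes> (b \<ominus> a) \<in> I"
      using assms(1) by (rule left_closed[rotated])
    moreover have "r \<otimes> (b \<ominus> a) = r \<otimes> b \<ominus> r \<otimes> a"
      using assms bc by (simp add: minus_eq r_distr r_minus)
    ultimately show ?thesis
      using assms bc by (subst coset_eq_iff) auto
  qed
  have "r \<odot>\<^bsub>quot\<^esub> (I +> a) = (\<Union>b\<in>I +> a. I +> (r \<otimes> b))"
    by (simp add: quot_left_module_def)
  also have "\<dots> = (\<Union>b\<in>I +> a. I +> (r \<otimes> a))"
    using eq by (intro SUP_cong refl)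
  also have "\<dots> = I +> (r \<otimes> a)"
  proof -
    have "I +> a \<noteq> {}"
      using a_rcos_self[OF assms(2)] by blast
    then show ?thesis
      by (simp only: UN_constant if_False)
  qed
  finally show ?thesis .
qed

lemma quot_carrier: "carrier quot = {I +> a | a. a \<in> carrier R}"
  by (auto simp: quot_left_module_def A_RCOSETS_def')

lemma quot_zero: "\<zero>\<^bsub>quot\<^esub> = I"
  by (simp add: quot_left_module_def)

lemma coset_zero: "I +> \<zero> = I"
  using a_rcos_const[OF additive_subgroup.zero_closed[OF is_additive_subgroup]] .

lemma quot_left_module: "left_module R quot"
proof -
  have ab: "abelian_group quot"
  proof (rule abelian_groupI)
    fix x assume "x \<in> carrier quot"
    then obtain a where a: "a \<in> carrier R" "x = I +> a"
      by (auto simp: quot_carrier)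
    have "(I +> (\<ominus> a)) \<oplus>\<^bsub>quot\<^esub> x = \<zero>\<^bsub>quot\<^esub>"
      using a by (simp add: coset_add l_neg coset_zero quot_zero)
    then show "\<exists>y\<in>carrier quot. y \<oplus>\<^bsub>quot\<^esub> x = \<zero>\<^bsub>quot\<^esub>"
      using a by (intro bexI[of _ "I +> (\<ominus> a)"]) (auto simp: quot_carrier)
  next
    show "\<zero>\<^bsub>quot\<^esub> \<in> carrier quot"
      unfolding quot_zero quot_carrier using coset_zero by blast
  next
    fix x assume "x \<in> carrier quot"
    then obtain a where a: "a \<in> carrier R" "x = I +> a"
      by (auto simp: quot_carrier)
    then have "(I +> \<zero>) \<oplus>\<^bsub>quot\<^esub> x = x"
      by (simp add: coset_add)
    then show "\<zero>\<^bsub>quot\<^esub> \<oplus>\<^bsub>quot\<^esub> x = x"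
      by (simp add: coset_zero quot_zero)
  qed (auto simp: quot_carrier coset_add a_ac)
  show ?thesis
  proof (intro left_module.intro left_module_axioms.intro ring_axioms ab)
    fix a b x assume "a \<in> carrier R" "b \<in> carrier R" "x \<in> carrier quot"
    then show "(a \<oplus> b) \<odot>\<^bsub>quot\<^esub> x = a \<odot>\<^bsub>quot\<^esub> x \<oplus>\<^bsub>quot\<^esub> b \<odot>\<^bsub>quot\<^esub> x"
      by (auto simp: quot_carrier coset_add coset_smult l_distr)
  qed (auto simp: quot_carrier coset_add coset_smult l_distr r_distr m_assoc)
qed

text \<open>A nonzero submodule N pulls back to the left ideal of all a whose coset lies in N. It
  properly contains I, and once it contains 1, N is everything. The second hypothesis is thus a
  condition on left ideals alone.\<close>

lemma quot_simple:
  assumes "\<one> \<notin> I"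
    and "\<And>J b. \<lbrakk>J \<subseteq> carrier R; I \<subseteq> J; \<And>x y. x \<in> J \<Longrightarrow> y \<in> J \<Longrightarrow> x \<oplus> y \<in> J;
      \<And>r x. r \<in> carrier R \<Longrightarrow> x \<in> J \<Longrightarrow> r \<otimes> x \<in> J; b \<in> J; b \<notin> I\<rbrakk> \<Longrightarrow> \<one> \<in> J"
  shows "simple_left_module R quot"
proof (intro simple_left_module.intro quot_left_module simple_left_module_axioms.intro)
  have mem_iff: "I +> a = I \<longleftrightarrow> a \<in> I" if "a \<in> carrier R" for a
    using that a_rcos_self[OF that] a_rcos_const by blast
  show "carrier quot \<noteq> {\<zero>\<^bsub>quot\<^esub>}"
    using assms(1) mem_iff[OF one_closed] unfolding quot_carrier quot_zero by blast
  fix N assume N: "submodule N R quot"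
  interpret N: submodule N R quot
    by (rule N)
  have N_sub: "N \<subseteq> carrier quot"
    using N.subset by simp
  have N_add: "x \<oplus>\<^bsub>quot\<^esub> y \<in> N" if "x \<in> N" "y \<in> N" for x y
    using N.m_closed[OF that] by simp
  define J where "J = {a \<in> carrier R. I +> a \<in> N}"
  show "N = {\<zero>\<^bsub>quot\<^esub>} \<or> N = carrier quot"
  proof (cases "N \<subseteq> {\<zero>\<^bsub>quot\<^esub>}")
    case True
    moreover have "\<zero>\<^bsub>quot\<^esub> \<in> N"
      using N.one_closed by simp
    ultimately show ?thesis
      by blast
  next
    case False
    then obtain b where b: "b \<in> J" "b \<notin> I"
      using N_sub mem_iff unfolding J_def quot_carrier quot_zero by blast
    have "\<one> \<in> J"
    proof (rule assms(2)[OF _ _ _ _ b])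
      show "I \<subseteq> J"
      proof
        fix a assume "a \<in> I"
        then have "a \<in> carrier R" "I +> a = I"
          using a_subset a_rcos_const by auto
        then show "a \<in> J"
          using N.one_closed by (simp add: J_def quot_zero)
      qed
      show "x \<oplus> y \<in> J" if "x \<in> J" "y \<in> J" for x y
        using that N_add[of "I +> x" "I +> y"] by (simp add: J_def coset_add)
      show "r \<otimes> x \<in> J" if "r \<in> carrier R" "x \<in> J" for r x
        using that N.smult_closed[of r "I +> x"] by (simp add: J_def coset_smult)
    qed (auto simp: J_def)
    then have "I +> a \<in> N" if "a \<in> carrier R" for a
      using that N.smult_closed[of a "I +> \<one>"] by (simp add: J_def coset_smult)
    then have "carrier quot \<subseteq> N"
      by (auto simp: quot_carrier)
    then show ?thesis
      using N_sub by blast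
  qed
qed

end

lemma left_ideal_PIdl:
  assumes "ring R" "a \<in> carrier R"
  shows "left_ideal (PIdl\<^bsub>R\<^esub> a) R"
proof -
  interpret ring R by fact
  have sub: "PIdl\<^bsub>R\<^esub> a \<subseteq> carrier R"
    using assms(2) by (auto simp: cgenideal_def)
  have "additive_subgroup (PIdl\<^bsub>R\<^esub> a) R"
  proof (intro additive_subgroup.intro add.subgroupI sub)
    have "\<zero>\<^bsub>R\<^esub> \<otimes>\<^bsub>R\<^esub> a \<in> PIdl\<^bsub>R\<^esub> a"
      unfolding cgenideal_def by blast
    then show "PIdl\<^bsub>R\<^esub> a \<noteq> {}"
      by blast
  next
    fix x assume "x \<in> PIdl\<^bsub>R\<^esub> a"
    then obtain r where "r \<in> carrier R" "x = r \<otimes>\<^bsub>R\<^esub> a"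
      by (auto simp: cgenideal_def)
    then have "\<ominus>\<^bsub>R\<^esub> x = (\<ominus>\<^bsub>R\<^esub> r) \<otimes>\<^bsub>R\<^esub> a" "\<ominus>\<^bsub>R\<^esub> r \<in> carrier R"
      using assms(2) by (simp_all add: l_minus)
    then show "\<ominus>\<^bsub>R\<^esub> x \<in> PIdl\<^bsub>R\<^esub> a"
      unfolding cgenideal_def by blast
  next
    fix x y assume "x \<in> PIdl\<^bsub>R\<^esub> a" "y \<in> PIdl\<^bsub>R\<^esub> a"
    then obtain r s where "r \<in> carrier R" "x = r \<otimes>\<^bsub>R\<^esub> a" "s \<in> carrier R" "y = s \<otimes>\<^bsub>R\<^esub> a"
      by (auto simp: cgenideal_def)
    then have "x \<oplus>\<^bsub>R\<^esub> y = (r \<oplus>\<^bsub>R\<^esub> s) \<otimes>\<^bsub>R\<^esub> a" "r \<oplus>\<^bsub>R\<^esub> s \<in> carrier R"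
      using assms(2) by (simp_all add: l_distr)
    then show "x \<oplus>\<^bsub>R\<^esub> y \<in> PIdl\<^bsub>R\<^esub> a"
      unfolding cgenideal_def by blast
  qed
  then have "abelian_subgroup (PIdl\<^bsub>R\<^esub> a) R"
    by (rule abelian_subgroupI3[OF _ abelian_group_axioms])
  moreover have "r \<otimes>\<^bsub>R\<^esub> x \<in> PIdl\<^bsub>R\<^esub> a" if "r \<in> carrier R" "x \<in> PIdl\<^bsub>R\<^esub> a" for r x
  proof -
    obtain s where "s \<in> carrier R" "x = s \<otimes>\<^bsub>R\<^esub> a"
      using \<open>x \<in> PIdl\<^bsub>R\<^esub> a\<close> by (auto simp: cgenideal_def)
    then have "r \<otimes>\<^bsub>R\<^esub> x = (r \<otimes>\<^bsub>R\<^esub> s) \<otimes>\<^bsub>R\<^esub> a" "r \<otimes>\<^bsub>R\<^esub> s \<in> carrier R"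
      using assms(2) \<open>r \<in> carrier R\<close> by (simp_all add: m_assoc)
    then show ?thesis
      unfolding cgenideal_def by blast
  qed
  ultimately show ?thesis
    by (intro left_ideal.intro left_ideal_axioms.intro assms(1))
qed


section \<open>The ring \<open>D\<^sup>\<dagger>\<close>\<close>

context disc_complement
begin

abbreviation D :: "'k diffop ring" where
  "D \<equiv> D_dagger absv v \<alpha> (varpi p)"

definition ser :: "'k diffop \<Rightarrow> nat \<Rightarrow> 'k fps" where
  "ser a j = aval (a j)"

lemma D_mult_eq: "a \<otimes>\<^bsub>D\<^esub> b = D_mult absv v \<alpha> a b"
  and D_add_eq: "a \<oplus>\<^bsub>D\<^esub> b = (\<lambda>j. a j \<oplus>\<^bsub>A\<^esub> b j)"
  and D_zero_eq: "\<zero>\<^bsub>D\<^esub> = (\<lambda>j. \<zero>\<^bsub>A\<^esub>)"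
  and D_one_eq: "\<one>\<^bsub>D\<^esub> = (\<lambda>j. if j = 0 then \<one>\<^bsub>A\<^esub> else \<zero>\<^bsub>A\<^esub>)"
  by (simp_all add: D_dagger_def D_ring_def Let_def)

text \<open>A null sequence is bounded, so in one direction c can be kept. Conversely, a bound at c0
  gives a null sequence at a smaller radius, here the midpoint of \<open>varpi p\<close> and c0,
  which still belongs to the union.\<close>

lemma D_carrier_iff: "a \<in> carrier D \<longleftrightarrow> (\<forall>j. a j \<in> carrier A) \<and> ser a \<in> Dset"
proof
  assume "a \<in> carrier D"
  then obtain c where c: "varpi p < c" and car: "\<And>j. a j \<in> carrier A"
    and lim: "(\<lambda>j. aff_norm absv (a j) * c ^ j) \<longlonglongrightarrow> 0"
    by (auto simp: D_dagger_def D_ring_def D_carrier_def Let_def)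
  have c0: "0 < c"
    using c varpi_pos by linarith
  have "Bseq (\<lambda>j. aff_norm absv (a j) * c ^ j)"
    using lim by (intro convergent_imp_Bseq convergentI)
  then obtain B where B: "\<And>j. norm (aff_norm absv (a j) * c ^ j) \<le> B"
    unfolding Bseq_def by blast
  have "nb c B (ser a)"
    unfolding nb_def ser_def
  proof
    fix j
    have "aff_norm absv (a j) * c ^ j \<le> B"
      using B[of j] by (simp add: abs_le_iff)
    then have "aff_norm absv (a j) \<le> B / c ^ j"
      using c0 by (simp add: le_divide_eq)
    then show "bnd (B / c ^ j) (aval (a j))"
      using aff_norm_le_iff[OF car] by blast
  qed
  then have "ser a \<in> Dset"
    using c afun_aval[OF car] by (intro DsetI) (auto simp: ser_def)
  then show "(\<forall>j. a j \<in> carrier A) \<and> ser a \<in> Dset"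
    using car by blast
next
  assume *: "(\<forall>j. a j \<in> carrier A) \<and> ser a \<in> Dset"
  then obtain c0 B where c0: "varpi p < c0" "nb c0 B (ser a)"
    using DsetE by blast
  define c where "c = (varpi p + c0) / 2"
  have c: "varpi p < c" "c < c0" "0 < c"
    using c0(1) varpi_pos by (auto simp: c_def)
  have "(\<lambda>j. aff_norm absv (a j) * c ^ j) \<longlonglongrightarrow> 0"
  proof (rule tendsto_sandwich[of "\<lambda>_. 0" _ _ "\<lambda>j. B * (c / c0) ^ j"])
    show "eventually (\<lambda>j. 0 \<le> aff_norm absv (a j) * c ^ j) sequentially"
      using * c(3) by (intro always_eventually allI mult_nonneg_nonneg aff_norm_nonneg) auto
    show "eventually (\<lambda>j. aff_norm absv (a j) * c ^ j \<le> B * (c / c0) ^ j) sequentially"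
    proof (intro always_eventually allI)
      fix j
      have "aff_norm absv (a j) \<le> B / c0 ^ j"
        using * nbD[OF c0(2), of j] by (intro aff_norm_le) (auto simp: ser_def)
      then have "aff_norm absv (a j) * c ^ j \<le> B / c0 ^ j * c ^ j"
        using c(3) by (intro mult_right_mono) auto
      then show "aff_norm absv (a j) * c ^ j \<le> B * (c / c0) ^ j"
        by (simp add: power_divide)
    qed
    have "(\<lambda>j. B * (c / c0) ^ j) \<longlonglongrightarrow> B * 0"
      using c by (intro tendsto_mult tendsto_const LIMSEQ_power_zero) auto
    then show "(\<lambda>j. B * (c / c0) ^ j) \<longlonglongrightarrow> 0"
      by simp
  qed simp
  then show "a \<in> carrier D"
    using * c(1) by (auto simp: D_dagger_def D_ring_def D_carrier_def Let_def)
qed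

lemma D_coeff: "a \<in> carrier D \<Longrightarrow> a j \<in> carrier A"
  and ser_Dset: "a \<in> carrier D \<Longrightarrow> ser a \<in> Dset"
  by (simp_all add: D_carrier_iff)

lemma ser_inj:
  assumes "a \<in> carrier D" "b \<in> carrier D" "ser a = ser b"
  shows "a = b"
  using assms aval_inj[OF D_coeff D_coeff] by (metis ext ser_def)

lemma ser_surj:
  assumes "x \<in> Dset"
  obtains a where "a \<in> carrier D" "ser a = x"
proof -
  have "\<exists>C. C \<in> carrier A \<and> aval C = x j" for j
    using aval_surj[OF Dset_afun[OF assms]] by metis
  then obtain a where "\<And>j. a j \<in> carrier A \<and> aval (a j) = x j"
    by metis
  then have "a \<in> carrier D" "ser a = x"
    using assms by (auto simp: D_carrier_iff ser_def[abs_def])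
  then show ?thesis
    using that by blast
qed

text \<open>Every ingredient of the product formula translates under \<open>aval\<close>:
  derivations, integer multiples, finite sums and, as the terms tend to 0 uniformly, the infinite
  sum.\<close>

lemma ser_mult:
  assumes "a \<in> carrier D" "b \<in> carrier D"
  shows "a \<otimes>\<^bsub>D\<^esub> b \<in> carrier D" "ser (a \<otimes>\<^bsub>D\<^esub> b) = pmul (ser a) (ser b)"
proof -
  have 1: "(a \<otimes>\<^bsub>D\<^esub> b) k \<in> carrier A \<and> aval ((a \<otimes>\<^bsub>D\<^esub> b) k) = pmul (ser a) (ser b) k" for k
  proof -
    define t where "t i m = add_pow A (i choose m) ((aff_deriv absv v \<alpha> ^^ m) (b (k + m - i)))" for i m :: nat
    define s where "s i = a i \<otimes>\<^bsub>A\<^esub> finsum A (t i) {m. m \<le> i \<and> i \<le> k + m}" for i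
    have t: "t i m \<in> carrier A" for i m
      unfolding t_def by (intro A.add.nat_pow_closed aff_deriv_funpow D_coeff assms)
    have fin: "finite {m. m \<le> i \<and> i \<le> k + m}" for i
      by (rule finite_subset[of _ "{..i}"]) auto
    have s: "s i \<in> carrier A" for i
      unfolding s_def using t by (intro A.m_closed D_coeff assms A.finsum_closed) auto
    have "aval (t i m) = of_nat (i choose m) * (fps_deriv ^^ m) (ser b (k + m - i))" for i m
      unfolding t_def ser_def
      by (simp add: aval_add_pow aff_deriv_funpow D_coeff assms)
    then have av: "aval (s i) = pterm (ser a) (ser b) k i" for i
      unfolding s_def pterm_def using t fin
      by (simp add: aval_mult aval_finsum D_coeff[OF assms(1)] A.finsum_closed ser_def)
    have null: "null_fps (\<lambda>i. aval (s i))"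
      unfolding av by (rule pterm_null[OF ser_Dset[OF assms(1)] ser_Dset[OF assms(2)]])
    have "(a \<otimes>\<^bsub>D\<^esub> b) k = aff_suminf absv v \<alpha> s"
      unfolding D_mult_eq D_mult_def Let_def s_def[abs_def] t_def[abs_def] ..
    then show ?thesis
      using aff_suminf[OF s null] by (simp add: av pmul_def)
  qed
  then show 2: "ser (a \<otimes>\<^bsub>D\<^esub> b) = pmul (ser a) (ser b)"
    by (simp add: ser_def[abs_def])
  show "a \<otimes>\<^bsub>D\<^esub> b \<in> carrier D"
    unfolding D_carrier_iff 2 using 1 assms by (auto intro: Dset_pmul ser_Dset)
qed

lemma ser_add:
  assumes "a \<in> carrier D" "b \<in> carrier D"
  shows "a \<oplus>\<^bsub>D\<^esub> b \<in> carrier D" "ser (a \<oplus>\<^bsub>D\<^esub> b) = (\<lambda>j. ser a j + ser b j)"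
proof -
  show 1: "ser (a \<oplus>\<^bsub>D\<^esub> b) = (\<lambda>j. ser a j + ser b j)"
    using assms by (simp add: ser_def[abs_def] D_add_eq aval_add D_coeff)
  show "a \<oplus>\<^bsub>D\<^esub> b \<in> carrier D"
    unfolding D_carrier_iff 1 using assms by (auto simp: D_add_eq D_coeff intro: Dset_add ser_Dset)
qed

lemma ser_zero: "\<zero>\<^bsub>D\<^esub> \<in> carrier D" "ser \<zero>\<^bsub>D\<^esub> = (\<lambda>_. 0)"
proof -
  show 1: "ser \<zero>\<^bsub>D\<^esub> = (\<lambda>_. 0)"
    by (simp add: ser_def[abs_def] D_zero_eq aval_zero)
  show "\<zero>\<^bsub>D\<^esub> \<in> carrier D"
    unfolding D_carrier_iff 1 by (simp add: D_zero_eq Dset_zero)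
qed

lemma ser_one: "\<one>\<^bsub>D\<^esub> \<in> carrier D" "ser \<one>\<^bsub>D\<^esub> = pone"
proof -
  show 1: "ser \<one>\<^bsub>D\<^esub> = pone"
    by (auto simp: ser_def D_one_eq aval_zero aval_one pone_def fun_eq_iff)
  show "\<one>\<^bsub>D\<^esub> \<in> carrier D"
    unfolding D_carrier_iff 1 by (simp add: D_one_eq Dset_one)
qed

text \<open>The multiplicative laws hold for \<open>pmul\<close> and are pulled back along the
  injective map \<open>ser\<close>; the additive ones hold coefficientwise.\<close>

lemma D_ring: "ring D"
proof (rule ringI)
  show "abelian_group D"
  proof (rule abelian_groupI)
    fix a assume a: "a \<in> carrier D"
    let ?b = "\<lambda>j. \<ominus>\<^bsub>A\<^esub> a j"
    have "ser ?b = (\<lambda>j. - ser a j)"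
      using a by (simp add: ser_def[abs_def] aval_uminus D_coeff)
    then have b: "?b \<in> carrier D"
      using a by (simp add: D_carrier_iff Dset_uminus)
    have "?b \<oplus>\<^bsub>D\<^esub> a = \<zero>\<^bsub>D\<^esub>"
      using a by (simp add: D_add_eq D_zero_eq D_coeff A.l_neg)
    then show "\<exists>b\<in>carrier D. b \<oplus>\<^bsub>D\<^esub> a = \<zero>\<^bsub>D\<^esub>"
      using b by blast
  next
    fix a b assume "a \<in> carrier D" "b \<in> carrier D"
    then show "a \<oplus>\<^bsub>D\<^esub> b = b \<oplus>\<^bsub>D\<^esub> a"
      by (simp add: D_add_eq D_coeff A.a_comm)
  qed (auto simp: ser_add ser_zero, auto simp: D_add_eq D_zero_eq D_coeff A.a_assoc)
  show "monoid D"
    by (rule monoidI)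
      (auto intro!: ser_inj simp: ser_mult ser_one pmul_assoc pmul_one_left pmul_one_right ser_Dset)
qed (auto intro!: ser_inj simp: ser_mult ser_add pmul_add_left pmul_add_right ser_Dset)

lemma ser_euler: "euler_op absv v \<alpha> l \<in> carrier D" "ser (euler_op absv v \<alpha> l) = euler l"
proof -
  have var: "tate_var 0 \<in> carrier T"
    by (rule tate_var_carrier) simp
  show 1: "ser (euler_op absv v \<alpha> l) = euler l"
    by (auto simp: ser_def euler_op_def euler_def aval_cls tate_const_carrier taylor_const var
        taylor_var_0 aval_zero fun_eq_iff)
  show "euler_op absv v \<alpha> l \<in> carrier D"
    unfolding D_carrier_iff 1
    by (auto simp: euler_op_def euler_Dset cls_closed tate_const_carrier var)
qed

lemma euler_quotient_zero:
  assumes "l \<notin> padic_integers absv"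
  shows "carrier (quot_left_module D (PIdl\<^bsub>D\<^esub> (euler_op absv v \<alpha> l))) =
    {\<zero>\<^bsub>quot_left_module D (PIdl\<^bsub>D\<^esub> (euler_op absv v \<alpha> l))\<^esub>}"
proof -
  let ?P = "euler_op absv v \<alpha> l"
  interpret D: ring D
    by (rule D_ring)
  interpret L: left_ideal "PIdl\<^bsub>D\<^esub> ?P" D
    by (rule left_ideal_PIdl[OF D_ring ser_euler(1)])
  obtain x where x: "x \<in> Dset" "pmul x (euler l) = pone"
    using euler_invertible[OF assms] by blast
  obtain q where q: "q \<in> carrier D" "ser q = x"
    using ser_surj[OF x(1)] by blast
  have "q \<otimes>\<^bsub>D\<^esub> ?P = \<one>\<^bsub>D\<^esub>"
    using q x(2) by (intro ser_inj) (simp_all add: ser_mult ser_euler ser_one)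
  then have one: "\<one>\<^bsub>D\<^esub> \<in> PIdl\<^bsub>D\<^esub> ?P"
    using q(1) unfolding cgenideal_def by force
  have "a \<in> PIdl\<^bsub>D\<^esub> ?P" if "a \<in> carrier D" for a
    using L.left_closed[OF that one] that by simp
  then have "PIdl\<^bsub>D\<^esub> ?P +>\<^bsub>D\<^esub> a = PIdl\<^bsub>D\<^esub> ?P" if "a \<in> carrier D" for a
    using that L.a_rcos_const by blast
  then show ?thesis
    unfolding L.quot_carrier L.quot_zero by blast
qed

lemma euler_quotient_simple:
  assumes "l \<in> padic_integers absv" "l \<notin> \<int>"
  shows "simple_left_module D (quot_left_module D (PIdl\<^bsub>D\<^esub> (euler_op absv v \<alpha> l)))"
proof -
  let ?P = "euler_op absv v \<alpha> l"
  interpret D: ring D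
    by (rule D_ring)
  interpret L: left_ideal "PIdl\<^bsub>D\<^esub> ?P" D
    by (rule left_ideal_PIdl[OF D_ring ser_euler(1)])
  have l: "Zlike l" "\<And>z :: int. l \<noteq> of_int z"
    using assms by (auto simp: Zlike_padic_integer)
  have l_nat: "\<And>i :: nat. l \<noteq> of_nat i"
    using l(2)[of "int _"] by simp
  have mem: "b \<in> PIdl\<^bsub>D\<^esub> ?P" if "b \<in> carrier D" "q \<in> Dset" "pmul q (euler l) = ser b" for b q
  proof -
    obtain q' where q': "q' \<in> carrier D" "ser q' = q"
      using ser_surj[OF \<open>q \<in> Dset\<close>] by blast
    then have "q' \<otimes>\<^bsub>D\<^esub> ?P = b"
      using that by (intro ser_inj) (simp_all add: ser_mult ser_euler)
    then show ?thesis
      using q'(1) unfolding cgenideal_def by blast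
  qed
  show ?thesis
  proof (rule L.quot_simple)
    show "\<one>\<^bsub>D\<^esub> \<notin> PIdl\<^bsub>D\<^esub> ?P"
    proof
      assume "\<one>\<^bsub>D\<^esub> \<in> PIdl\<^bsub>D\<^esub> ?P"
      then obtain q where q: "q \<in> carrier D" "\<one>\<^bsub>D\<^esub> = q \<otimes>\<^bsub>D\<^esub> ?P"
        unfolding cgenideal_def by blast
      then have "pmul (ser q) (euler l) = pone"
        using ser_mult(2)[OF q(1) ser_euler(1)] by (metis q(2) ser_euler(2) ser_one(2))
      then show False
        using euler_not_invertible[OF l(1) l_nat ser_Dset[OF q(1)]] by blast
    qed
    fix J b
    assume J: "J \<subseteq> carrier D" "PIdl\<^bsub>D\<^esub> ?P \<subseteq> J" "\<And>x y. x \<in> J \<Longrightarrow> y \<in> J \<Longrightarrow> x \<oplus>\<^bsub>D\<^esub> y \<in> J"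
      "\<And>r x. r \<in> carrier D \<Longrightarrow> x \<in> J \<Longrightarrow> r \<otimes>\<^bsub>D\<^esub> x \<in> J"
      and b: "b \<in> J" "b \<notin> PIdl\<^bsub>D\<^esub> ?P"
    have bD: "b \<in> carrier D"
      using b(1) J(1) by blast
    have "\<exists>n. sym (ser b) l n \<noteq> 0"
    proof (rule ccontr)
      assume "\<nexists>n. sym (ser b) l n \<noteq> 0"
      then obtain q where "q \<in> Dset" "pmul q (euler l) = ser b"
        using euler_multiple[OF l(1) l_nat ser_Dset[OF bD]] by blast
      then show False
        using mem[OF bD] b(2) by blast
    qed
    then obtain n where n: "sym (ser b) l n \<noteq> 0"
      by blast
    have "pone \<in> ser ` J"
    proof (rule one_mem_if_sym_nonzero[OF l _ _ _ _ _ n])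
      show "ser ` J \<subseteq> Dset"
        using J(1) ser_Dset by blast
      show "(\<lambda>j. x j + y j) \<in> ser ` J" if xy: "x \<in> ser ` J" "y \<in> ser ` J" for x y
      proof -
        obtain a d where ad: "a \<in> J" "x = ser a" "d \<in> J" "y = ser d"
          using xy by blast
        then have "(\<lambda>j. x j + y j) = ser (a \<oplus>\<^bsub>D\<^esub> d)"
          using J(1) by (subst ser_add(2)) auto
        then show ?thesis
          using J(3)[OF ad(1,3)] by (rule image_eqI)
      qed
      show "pmul q x \<in> ser ` J" if qx: "q \<in> Dset" "x \<in> ser ` J" for q x
      proof -
        obtain a where a: "a \<in> J" "x = ser a"
          using qx(2) by blast
        obtain q' where q': "q' \<in> carrier D" "ser q' = q"
          using ser_surj[OF qx(1)] by blast
        have "pmul q x = ser (q' \<otimes>\<^bsub>D\<^esub> a)"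
          using a q' J(1) by (subst ser_mult(2)) auto
        then show ?thesis
          using J(4)[OF q'(1) a(1)] by (rule image_eqI)
      qed
      show "pmul q (euler l) \<in> ser ` J" if q: "q \<in> Dset" for q
      proof -
        obtain q' where q': "q' \<in> carrier D" "ser q' = q"
          using ser_surj[OF q] by blast
        have "q' \<otimes>\<^bsub>D\<^esub> ?P \<in> J"
          using J(2) q'(1) unfolding cgenideal_def by blast
        moreover have "pmul q (euler l) = ser (q' \<otimes>\<^bsub>D\<^esub> ?P)"
          using ser_mult(2)[OF q'(1) ser_euler(1)] by (simp add: ser_euler q'(2))
        ultimately show ?thesis
          by (intro image_eqI)
      qed
      show "ser b \<in> ser ` J"
        using b(1) by blast
    qed
    then obtain u where u: "u \<in> J" "ser u = pone"
      by (metis imageE)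
    then have "u = \<one>\<^bsub>D\<^esub>"
      using J(1) by (intro ser_inj) (auto simp: ser_one)
    then show "\<one>\<^bsub>D\<^esub> \<in> J"
      using u(1) by simp
  qed
qed

end

theorem theorem4p4p1:
  fixes absv :: "'k::field \<Rightarrow> real" and p v :: nat and \<alpha> :: "nat \<Rightarrow> 'k" and l :: 'k
  assumes "complete_discretely_valued_field absv p"
    and "\<And>i. i \<in> {1..v} \<Longrightarrow> absv (\<alpha> i) = 1"
    and "l \<notin> \<int>"
  defines "D \<equiv> D_dagger absv v \<alpha> (varpi p)"
  defines "M \<equiv> quot_left_module D (PIdl\<^bsub>D\<^esub> (euler_op absv v \<alpha> l))"
  shows "(l \<in> padic_integers absv \<longrightarrow> simple_left_module D M) \<and>
         (l \<notin> padic_integers absv \<longrightarrow> carrier M = {\<zero>\<^bsub>M\<^esub>})"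
proof -
  interpret disc_complement absv p v \<alpha>
    using assms(1,2) by (intro disc_complement.intro disc_complement_axioms.intro)
  show ?thesis
    unfolding M_def D_def using euler_quotient_simple euler_quotient_zero assms(3) by blast
qed

end
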